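(* Let $\mathcal{Z} = \operatorname{span}\{(0,0,1)\}$ denote the $z$-axis of $\mathbb{R}^3$. Let $M$ be a solid torus in $\mathbb{R}^3$ which wraps around $\mathcal{Z}$ once, in the sense that 1. $M \cap \mathcal{Z} = \emptyset$, and 2. letting $\iota : M \subset \mathbb{R}^3 \setminus \mathcal{Z}$ denote the inclusion, $\iota_* : H_1(M) \to H_1(\mathbb{R}^3 \setminus \mathcal{Z})$ is surjective. Let $\mathcal{I} : \mathbb{R}^3 \to \mathbb{R}^3$ be the orientation-preserving isometry given by $\mathcal{I}(x,y,z) = (x,-y,-z)$ and suppose that $\mathcal{I}(M) = M$. Let $\Psi : M \to M$ denote the corresponding diffeomorphism of $M$. Then, for any MHD equilibrium $(B,p)$ on $M$ where $p$ has toroidally nested level sets, one has the equivalence $$p \circ \Psi = p \iff \Psi_* B = - B.$$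
   Context: Everything is smooth; $\mathbb{R}^3$ carries the Euclidean metric; $H_1$ is integral singular homology; $\Psi_*B$ is the pushforward. Solid torus (solid toroidal domain) in $\mathbb{R}^3$: a regular domain (codimension-0 embedded submanifold with boundary) $M\subset\mathbb{R}^3$ diffeomorphic to $\mathbb{S}^1 \times D$, where $D$ is the closed unit disk in $\mathbb{R}^2$. MHD equilibrium on $M$: a pair $(B,p)$ of a smooth vector field $B$ and a smooth function $p$ on $M$ with $\operatorname{curl} B \times B = \nabla p$, $\operatorname{div} B = 0$, and $B \cdot n = 0$ on $\partial M$, where $n$ is the outward unit normal. Toroidally nested level sets: $p\in C^\infty(M)$ has toroidally nested level sets (with axis $\gamma$, for an embedded circle $\gamma\subset \mathrm{int}\, M$) if $\partial M$ is a regular level set of $p$ and each non-empty level set of $p$ is either a regular level set diffeomorphic to $\mathbb{S}^1\times\mathbb{S}^1$, or equal to $\gamma$. *)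

theory Defs
  imports "HOL-Analysis.Analysis" "HOL-Analysis.Cross3" "HOL-Homology.Homology"
begin

section \<open>Smooth maps between subsets of Euclidean spaces\<close>

text \<open>The functions of class \<open>C\<^sup>k\<close> on an open set \<open>U\<close>, by recursion on \<open>k\<close> through all
  directional derivatives.\<close>

primrec Ck_on :: "nat \<Rightarrow> 'a::euclidean_space set \<Rightarrow> ('a \<Rightarrow> 'b::real_normed_vector) \<Rightarrow> bool" where
  "Ck_on 0 U f \<longleftrightarrow> continuous_on U f"
| "Ck_on (Suc k) U f \<longleftrightarrow>
     (\<forall>x\<in>U. f differentiable (at x)) \<and>
     (\<forall>v. Ck_on k U (\<lambda>x. frechet_derivative f (at x) v))"

text \<open>A map on an arbitrary subset \<open>S\<close> is smooth if it extends locally to a smooth map on an open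
  set.  On an embedded submanifold (with boundary) this is smoothness in the sense of
  manifolds.\<close>

definition smooth_on :: "'a::euclidean_space set \<Rightarrow> ('a \<Rightarrow> 'b::real_normed_vector) \<Rightarrow> bool" where
  "smooth_on S f \<longleftrightarrow>
     (\<forall>x\<in>S. \<exists>U g. open U \<and> x \<in> U \<and> (\<forall>k. Ck_on k U g) \<and> (\<forall>y\<in>S \<inter> U. g y = f y))"

definition diffeomorphism ::
    "'a::euclidean_space set \<Rightarrow> 'b::euclidean_space set \<Rightarrow> ('a \<Rightarrow> 'b) \<Rightarrow> ('b \<Rightarrow> 'a) \<Rightarrow> bool" where
  "diffeomorphism S T f g \<longleftrightarrow>
     f ` S = T \<and> g ` T = S \<and> (\<forall>x\<in>S. g (f x) = x) \<and> (\<forall>y\<in>T. f (g y) = y) \<and>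
     smooth_on S f \<and> smooth_on T g"

definition diffeomorphic :: "'a::euclidean_space set \<Rightarrow> 'b::euclidean_space set \<Rightarrow> bool"
    (infix "diffeomorphic" 50) where
  "S diffeomorphic T \<longleftrightarrow> (\<exists>f g. diffeomorphism S T f g)"

section \<open>Regular domains and solid tori\<close>

text \<open>A chart of \<open>\<real>\<^sup>3\<close> on \<open>U\<close> that straightens \<open>M\<close> to the closed upper half-space.  The target \<open>V\<close>
  need not meet the bounding plane, so charts around interior points are included.\<close>

definition half_space_chart ::
    "(real^3) set \<Rightarrow> (real^3) set \<Rightarrow> (real^3 \<Rightarrow> real^3) \<Rightarrow> bool" where
  "half_space_chart M U \<phi> \<longleftrightarrow>
     open U \<and>
     (\<exists>V \<psi>. open V \<and> diffeomorphism U V \<phi> \<psi> \<and> \<phi> ` (U \<inter> M) = V \<inter> {y. 0 \<le> y $ 3})"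

definition regular_domain :: "(real^3) set \<Rightarrow> bool" where
  "regular_domain M \<longleftrightarrow> (\<forall>x\<in>M. \<exists>U \<phi>. x \<in> U \<and> half_space_chart M U \<phi>)"

definition manifold_boundary :: "(real^3) set \<Rightarrow> (real^3) set" where
  "manifold_boundary M = {x \<in> M. \<exists>U \<phi>. x \<in> U \<and> half_space_chart M U \<phi> \<and> \<phi> x $ 3 = 0}"

definition manifold_interior :: "(real^3) set \<Rightarrow> (real^3) set" where
  "manifold_interior M = M - manifold_boundary M"

definition solid_torus :: "(real^3) set \<Rightarrow> bool" where
  "solid_torus M \<longleftrightarrow>
     regular_domain M \<and> M diffeomorphic (sphere (0::real^2) 1 \<times> cball (0::real^2) 1)"

definition tangent_space :: "(real^3) set \<Rightarrow> real^3 \<Rightarrow> (real^3) set" where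
  "tangent_space S x =
     {v. \<exists>c \<epsilon>. 0 < \<epsilon> \<and> smooth_on {-\<epsilon><..<\<epsilon>} c \<and> c ` {-\<epsilon><..<\<epsilon>} \<subseteq> S \<and> c 0 = x \<and>
             (c has_vector_derivative v) (at (0::real))}"

definition outward_unit_normal :: "(real^3) set \<Rightarrow> real^3 \<Rightarrow> real^3 \<Rightarrow> bool" where
  "outward_unit_normal M x n \<longleftrightarrow>
     norm n = 1 \<and>
     (\<forall>v\<in>tangent_space (manifold_boundary M) x. v \<bullet> n = 0) \<and>
     (\<forall>\<^sub>F t in at_right 0. x + t *\<^sub>R n \<notin> M)"

section \<open>Vector calculus on a regular domain\<close>

text \<open>Derivatives are taken within \<open>M\<close>.  At a boundary point of a regular domain the derivative
  within \<open>M\<close> is unique, and it is the derivative of any smooth local extension.\<close>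

definition partial_deriv ::
    "(real^3) set \<Rightarrow> (real^3 \<Rightarrow> 'b::real_normed_vector) \<Rightarrow> 3 \<Rightarrow> real^3 \<Rightarrow> 'b" where
  "partial_deriv M f i x = frechet_derivative f (at x within M) (axis i 1)"

definition grad :: "(real^3) set \<Rightarrow> (real^3 \<Rightarrow> real) \<Rightarrow> real^3 \<Rightarrow> real^3" where
  "grad M p x = (\<chi> i. partial_deriv M p i x)"

definition divergence :: "(real^3) set \<Rightarrow> (real^3 \<Rightarrow> real^3) \<Rightarrow> real^3 \<Rightarrow> real" where
  "divergence M B x = (\<Sum>i\<in>UNIV. partial_deriv M B i x $ i)"

definition curl :: "(real^3) set \<Rightarrow> (real^3 \<Rightarrow> real^3) \<Rightarrow> real^3 \<Rightarrow> real^3" where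
  "curl M B x =
     vector [partial_deriv M B 2 x $ 3 - partial_deriv M B 3 x $ 2,
             partial_deriv M B 3 x $ 1 - partial_deriv M B 1 x $ 3,
             partial_deriv M B 1 x $ 2 - partial_deriv M B 2 x $ 1]"

text \<open>Only the values of \<open>\<Psi>\<close> and \<open>B\<close> on \<open>M\<close> matter; \<open>\<Psi>\<close> is meant to be a diffeomorphism of \<open>M\<close>.\<close>

definition pushforward ::
    "(real^3) set \<Rightarrow> (real^3 \<Rightarrow> real^3) \<Rightarrow> (real^3 \<Rightarrow> real^3) \<Rightarrow> real^3 \<Rightarrow> real^3" where
  "pushforward M \<Psi> B y =
     (let x = inv_into M \<Psi> y in frechet_derivative \<Psi> (at x within M) (B x))"

section \<open>MHD equilibria and toroidally nested level sets\<close>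

definition MHD_equilibrium ::
    "(real^3) set \<Rightarrow> (real^3 \<Rightarrow> real^3) \<Rightarrow> (real^3 \<Rightarrow> real) \<Rightarrow> bool" where
  "MHD_equilibrium M B p \<longleftrightarrow>
     smooth_on M B \<and> smooth_on M p \<and>
     (\<forall>x\<in>M. cross3 (curl M B x) (B x) = grad M p x) \<and>
     (\<forall>x\<in>M. divergence M B x = 0) \<and>
     (\<forall>x\<in>manifold_boundary M. \<forall>n. outward_unit_normal M x n \<longrightarrow> B x \<bullet> n = 0)"

definition level_set :: "(real^3) set \<Rightarrow> (real^3 \<Rightarrow> real) \<Rightarrow> real \<Rightarrow> (real^3) set" where
  "level_set M p c = {x \<in> M. p x = c}"

definition regular_level :: "(real^3) set \<Rightarrow> (real^3 \<Rightarrow> real) \<Rightarrow> real \<Rightarrow> bool" where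
  "regular_level M p c \<longleftrightarrow> (\<forall>x\<in>level_set M p c. grad M p x \<noteq> 0)"

text \<open>A set diffeomorphic to the circle, with smoothness on subsets of \<open>\<real>\<^sup>3\<close> understood by local
  extension, is the same thing as an embedded circle.\<close>

definition toroidally_nested_with_axis ::
    "(real^3) set \<Rightarrow> (real^3 \<Rightarrow> real) \<Rightarrow> (real^3) set \<Rightarrow> bool" where
  "toroidally_nested_with_axis M p \<gamma> \<longleftrightarrow>
     smooth_on M p \<and>
     \<gamma> \<subseteq> manifold_interior M \<and> \<gamma> diffeomorphic (sphere (0::real^2) 1) \<and>
     (\<exists>c. manifold_boundary M = level_set M p c \<and> regular_level M p c) \<and>
     (\<forall>c. level_set M p c \<noteq> {} \<longrightarrow>
        regular_level M p c \<and>
          level_set M p c diffeomorphic (sphere (0::real^2) 1 \<times> sphere (0::real^2) 1) \<or>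
        level_set M p c = \<gamma>)"

definition toroidally_nested :: "(real^3) set \<Rightarrow> (real^3 \<Rightarrow> real) \<Rightarrow> bool" where
  "toroidally_nested M p \<longleftrightarrow> (\<exists>\<gamma>. toroidally_nested_with_axis M p \<gamma>)"

section \<open>The axis and the half-turn\<close>

definition z_axis :: "(real^3) set" where
  "z_axis = span {vector [0, 0, 1]}"

definition half_turn :: "real^3 \<Rightarrow> real^3" where
  "half_turn v = vector [v $ 1, - v $ 2, - v $ 3]"

end

theory Submission
  imports Defs
begin

text \<open>Write \<open>I\<close> for the half-turn.  If \<open>I\<^sub>* B = -B\<close>, then \<open>curl B \<times> B\<close> is \<open>I\<close>-invariant, so \<open>p \<circ> I - p\<close> is
  constant, and the constant is \<open>0\<close> because \<open>I\<close> is an involution.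

  Conversely, let \<open>p \<circ> I = p\<close> and \<open>C = B + I\<^sub>* B\<close>.  On a level torus \<open>T\<close> the one-forms
  \<open>\<alpha> = C\<^sup>\<flat>\<close> and \<open>\<beta> = (N \<times> C)\<^sup>\<flat>\<close>, with \<open>N = \<nabla>p / \<bar>\<nabla>p\<bar>\<^sup>2\<close>, restrict to closed \<open>I\<close>-invariant
  forms, and \<open>\<alpha> \<and> \<beta>\<close> is \<open>\<bar>C\<bar>\<^sup>2\<close> times a nowhere vanishing area form.  If \<open>C\<close> does not vanish
  identically on \<open>T\<close>, Riemann's bilinear relation makes the classes of \<open>\<alpha>\<close> and \<open>\<beta>\<close> a basis of
  \<open>H\<^sup>1(T)\<close>, so the whole of \<open>H\<^sup>1(T)\<close> is fixed by \<open>I\<close>.  But the angle form \<open>d\<theta>\<close> around the axis is reversed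
  by \<open>I\<close>, so it is exact on \<open>T\<close>.  That is impossible: whether \<open>\<theta>\<close> is single-valued on a level torus
  is locally constant in the level, and if it were single-valued on all of them, then the core
  circle of \<open>M\<close> would not wind around the axis.\<close>

section \<open>Calculus of \<open>C\<^sup>k\<close> functions\<close>

text \<open>That \<alpha> is closed on a level torus comes from J x B = grad p with J = curl B: a
  cross product is orthogonal to both factors, so J and, by symmetry of p, the curl of C have no
  normal component. That \<beta> is closed comes from div C = 0 and the normalisation N . grad p =
  1, which makes the remaining normal terms of curl (N x C) cancel. The half-turn acts on H^1(T) by
  an unknown matrix, and no coordinates on T are adapted to it. Hence nothing is computed in
  cohomology: for suitable constants s, t the form s \<alpha> + t \<beta> - d\<theta> has a
  primitive l on T, and (l o I - l)/2 is then a primitive of d\<theta>. Forms, periods and the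
  bilinear relation live on the plane that covers T, as functions and integrals there. Winding
  around the axis is encoded by continuous logarithms of x + i y, which link the singular homology
  of the hypothesis to these forms without de Rham theory. Only level tori inside M are treated; the
  circle \<gamma> and the boundary are reached by continuity.\<close>

lemma Ck_on_subset: "Ck_on k U f \<Longrightarrow> V \<subseteq> U \<Longrightarrow> Ck_on k V f"
  by (induction k arbitrary: f) (auto intro: continuous_on_subset)

lemma Ck_on_cong:
  assumes "open U" "\<And>x. x \<in> U \<Longrightarrow> f x = g x"
  shows "Ck_on k U f \<longleftrightarrow> Ck_on k U g"
  using assms(2)
proof (induction k arbitrary: f g)
  case 0
  then show ?case by (simp cong: continuous_on_cong)
next
  case (Suc k)
  have der: "(f has_derivative D) (at x) \<longleftrightarrow> (g has_derivative D) (at x)" if "x \<in> U" for x D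
    using has_derivative_transform_within_open[OF _ assms(1) that] Suc.prems by metis
  have "frechet_derivative f (at x) = frechet_derivative g (at x)" if "x \<in> U" for x
    using der[OF that] by (simp add: frechet_derivative_def)
  then have "Ck_on k U (\<lambda>x. frechet_derivative f (at x) v) \<longleftrightarrow>
      Ck_on k U (\<lambda>x. frechet_derivative g (at x) v)" for v
    by (intro Suc.IH) auto
  then show ?case
    using der by (auto simp: differentiable_def)
qed

lemma Ck_on_continuous: "Ck_on k U f \<Longrightarrow> continuous_on U f"
  by (cases k) (auto intro!: continuous_at_imp_continuous_on differentiable_imp_continuous_within)

lemma Ck_on_SucD: "Ck_on (Suc k) U f \<Longrightarrow> Ck_on k U f"
proof (induction k arbitrary: f)
  case 0
  then show ?case using Ck_on_continuous[of "Suc 0" U f] by (simp del: Ck_on.simps(2))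
next
  case (Suc k)
  then show ?case by (subst Ck_on.simps(2), subst (asm) (2) Ck_on.simps(2)) blast
qed

lemma Ck_on_local:
  assumes "\<And>x. x \<in> U \<Longrightarrow> \<exists>V. open V \<and> x \<in> V \<and> Ck_on k V f"
  shows "Ck_on k U f"
  using assms
proof (induction k arbitrary: f)
  case 0
  then show ?case
    unfolding Ck_on.simps(1)
    by (intro continuous_at_imp_continuous_on ballI) (metis continuous_on_eq_continuous_at)
next
  case (Suc k)
  have "f differentiable (at x)" if "x \<in> U" for x
    using Suc.prems[OF that] by auto
  moreover have "Ck_on k U (\<lambda>x. frechet_derivative f (at x) v)" for v
    using Suc.prems by (intro Suc.IH) fastforce
  ultimately show ?case by simp
qed

text \<open>Derivatives are unique, so any explicit candidate \<open>D\<close> may replace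
  \<open>frechet_derivative\<close>. The closure rules for linear images, sums, products and
  composites take their inductive step through this rule.\<close>

lemma Ck_on_SucI:
  assumes "open U" "\<And>x. x \<in> U \<Longrightarrow> (f has_derivative D x) (at x)"
    and "\<And>v. Ck_on k U (\<lambda>x. D x v)"
  shows "Ck_on (Suc k) U f"
proof -
  have "frechet_derivative f (at x) = D x" if "x \<in> U" for x
    using assms(2)[OF that] frechet_derivative_at by metis
  then have "Ck_on k U (\<lambda>x. frechet_derivative f (at x) v)" for v
    using assms(3)[of v] Ck_on_cong[OF assms(1), of "\<lambda>x. frechet_derivative f (at x) v" "\<lambda>x. D x v"]
    by auto
  then show ?thesis
    using assms(2) by (auto simp: differentiable_def)
qed

lemma Ck_on_has_derivative:
  "Ck_on (Suc k) U f \<Longrightarrow> x \<in> U \<Longrightarrow> (f has_derivative frechet_derivative f (at x)) (at x)"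
  by (simp add: frechet_derivative_works)

lemma Ck_on_const: "Ck_on k U (\<lambda>x. c)"
  by (induction k arbitrary: c) (auto simp: frechet_derivative_const)

lemma Ck_on_bounded_linear:
  assumes "bounded_linear h" "open U" "Ck_on k U f"
  shows "Ck_on k U (\<lambda>x. h (f x))"
  using assms(3)
proof (induction k arbitrary: f)
  case 0
  then show ?case
    by (auto intro: bounded_linear.continuous_on[OF assms(1)])
next
  case (Suc k)
  show ?case
  proof (rule Ck_on_SucI[OF assms(2)])
    show "((\<lambda>x. h (f x)) has_derivative (\<lambda>v. h (frechet_derivative f (at x) v))) (at x)" if "x \<in> U" for x
      using bounded_linear.has_derivative[OF assms(1) Ck_on_has_derivative[OF Suc.prems that]] .
    show "Ck_on k U (\<lambda>x. h (frechet_derivative f (at x) v))" for v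
      using Suc by auto
  qed
qed

lemma Ck_on_add:
  assumes "open U" "Ck_on k U f" "Ck_on k U g"
  shows "Ck_on k U (\<lambda>x. f x + g x)"
  using assms(2,3)
proof (induction k arbitrary: f g)
  case 0
  then show ?case by (auto intro: continuous_intros)
next
  case (Suc k)
  show ?case
    by (rule Ck_on_SucI[OF assms(1)], rule has_derivative_add)
      (use Suc in \<open>auto intro: Ck_on_has_derivative\<close>)
qed

lemma Ck_on_sum:
  assumes "open U" "\<And>i. i \<in> A \<Longrightarrow> Ck_on k U (f i)"
  shows "Ck_on k U (\<lambda>x. \<Sum>i\<in>A. f i x)"
  using assms(2)
  by (induction A rule: infinite_finite_induct) (auto intro: Ck_on_const Ck_on_add[OF assms(1)])

lemma Ck_on_bilinear:
  assumes "bounded_bilinear h" "open U" "Ck_on k U f" "Ck_on k U g"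
  shows "Ck_on k U (\<lambda>x. h (f x) (g x))"
  using assms(3,4)
proof (induction k arbitrary: f g)
  case 0
  then show ?case by (auto intro: bounded_bilinear.continuous_on[OF assms(1)])
next
  case (Suc k)
  show ?case
  proof (rule Ck_on_SucI[OF assms(2)])
    show "((\<lambda>x. h (f x) (g x)) has_derivative
        (\<lambda>v. h (f x) (frechet_derivative g (at x) v) + h (frechet_derivative f (at x) v) (g x))) (at x)"
      if "x \<in> U" for x
      using bounded_bilinear.FDERIV[OF assms(1) Ck_on_has_derivative[OF Suc.prems(1) that]
          Ck_on_has_derivative[OF Suc.prems(2) that]] .
    show "Ck_on k U (\<lambda>x. h (f x) (frechet_derivative g (at x) v) + h (frechet_derivative f (at x) v) (g x))" for v
      using Suc.prems Ck_on_SucD[OF Suc.prems(1)] Ck_on_SucD[OF Suc.prems(2)]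
      by (intro Ck_on_add assms(2) Suc.IH) auto
  qed
qed

text \<open>The chain rule evaluates the derivative of g in the direction Df(x) v, which moves with
  x, while the induction hypothesis speaks of fixed directions. Expanding that vector in the basis
  restores fixed directions.\<close>

lemma Ck_on_compose:
  fixes f :: "'a::euclidean_space \<Rightarrow> 'b::euclidean_space" and g :: "'b \<Rightarrow> 'c::real_normed_vector"
  assumes "open U" "Ck_on k U f" "Ck_on k V g" "f ` U \<subseteq> V"
  shows "Ck_on k U (\<lambda>x. g (f x))"
  using assms(2,3)
proof (induction k arbitrary: g)
  case 0
  then show ?case using assms(4) by (auto intro: continuous_on_compose2)
next
  case (Suc k)
  show ?case
  proof (rule Ck_on_SucI[OF assms(1)])
    fix x assume x: "x \<in> U"
    have g: "(g has_derivative frechet_derivative g (at (f x))) (at (f x))"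
      using Ck_on_has_derivative[OF Suc.prems(2)] x assms(4) by blast
    have "((\<lambda>x. g (f x)) has_derivative
        (\<lambda>v. frechet_derivative g (at (f x)) (frechet_derivative f (at x) v))) (at x)"
      by (rule has_derivative_compose[OF Ck_on_has_derivative[OF Suc.prems(1) x] g])
    moreover have "frechet_derivative g (at (f x)) (frechet_derivative f (at x) v) =
        (\<Sum>b\<in>Basis. (frechet_derivative f (at x) v \<bullet> b) *\<^sub>R frechet_derivative g (at (f x)) b)" for v
    proof -
      interpret g: bounded_linear "frechet_derivative g (at (f x))"
        using g has_derivative_bounded_linear by blast
      show ?thesis
        by (subst euclidean_representation[of "frechet_derivative f (at x) v", symmetric])
          (simp add: g.sum g.scaleR del: euclidean_representation)
    qed
    ultimately show "((\<lambda>x. g (f x)) has_derivative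
        (\<lambda>v. \<Sum>b\<in>Basis. (frechet_derivative f (at x) v \<bullet> b) *\<^sub>R frechet_derivative g (at (f x)) b)) (at x)"
      by (simp only:)
  next
    fix v
    show "Ck_on k U (\<lambda>x. \<Sum>b\<in>Basis. (frechet_derivative f (at x) v \<bullet> b) *\<^sub>R frechet_derivative g (at (f x)) b)"
    proof (intro Ck_on_sum assms(1) Ck_on_bilinear[OF bounded_bilinear_scaleR])
      fix b :: 'b
      show "Ck_on k U (\<lambda>x. frechet_derivative f (at x) v \<bullet> b)"
        using Suc.prems(1) by (intro Ck_on_bounded_linear[OF bounded_linear_inner_left] assms(1)) auto
      show "Ck_on k U (\<lambda>x. frechet_derivative g (at (f x)) b)"
        using Suc.prems Ck_on_SucD[OF Suc.prems(1)] by (intro Suc.IH) auto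
    qed
  qed
qed

lemma Ck_on_id: "Ck_on k U (\<lambda>x. x)"
  by (cases k) (auto simp: frechet_derivative_ident intro: Ck_on_const)

lemma Ck_on_linear:
  assumes "bounded_linear h"
  shows "Ck_on k U h"
  using Ck_on_subset[OF Ck_on_bounded_linear[OF assms open_UNIV Ck_on_id]] by simp

text \<open>One induction for both, since each function is up to sign the derivative of the
  other.\<close>

lemma Ck_on_sin_cos: "Ck_on k UNIV (sin :: real \<Rightarrow> real) \<and> Ck_on k UNIV (cos :: real \<Rightarrow> real)"
proof (induction k)
  case 0
  then show ?case by (auto intro: continuous_intros)
next
  case (Suc k)
  have "Ck_on (Suc k) UNIV (sin :: real \<Rightarrow> real)"
  proof (rule Ck_on_SucI[OF open_UNIV])
    show "(sin has_derivative (\<lambda>v. v * cos x)) (at x)" for x :: real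
      by (auto intro!: derivative_eq_intros)
    show "Ck_on k UNIV (\<lambda>x. v * cos x)" for v :: real
      using Suc by (intro Ck_on_bounded_linear[OF bounded_linear_mult_right]) auto
  qed
  moreover have "Ck_on (Suc k) UNIV (cos :: real \<Rightarrow> real)"
  proof (rule Ck_on_SucI[OF open_UNIV])
    show "(cos has_derivative (\<lambda>v. (- v) * sin x)) (at x)" for x :: real
      by (auto intro!: derivative_eq_intros)
    show "Ck_on k UNIV (\<lambda>x. (- v) * sin x)" for v :: real
      using Suc by (intro Ck_on_bounded_linear[OF bounded_linear_mult_right]) auto
  qed
  ultimately show ?case by blast
qed

lemma Ck_on_inverse: "Ck_on k (- {0}) (inverse :: real \<Rightarrow> real)"
proof (induction k)
  case 0
  then show ?case by (auto intro!: continuous_intros)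
next
  case (Suc k)
  show ?case
  proof (rule Ck_on_SucI[where D = "\<lambda>x v. - (inverse x * v * inverse x)"])
    fix v :: real
    have "Ck_on k (- {0}) (\<lambda>x. - (v * (inverse x * inverse x :: real)))"
      by (intro Ck_on_bounded_linear[OF bounded_linear_minus[OF bounded_linear_mult_right]]
          Ck_on_bilinear[OF bounded_bilinear_mult] Suc) auto
    then show "Ck_on k (- {0}) (\<lambda>x. - (inverse x * v * inverse x))"
      by (simp add: mult_ac)
  qed (auto intro!: derivative_eq_intros)
qed

lemma Ck_on_divide:
  fixes g :: "'a::euclidean_space \<Rightarrow> real"
  assumes "open U" "Ck_on k U f" "Ck_on k U g" "\<And>x. x \<in> U \<Longrightarrow> g x \<noteq> 0"
  shows "Ck_on k U (\<lambda>x. f x /\<^sub>R g x)"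
proof (rule Ck_on_bilinear[OF bounded_bilinear_scaleR assms(1) _ assms(2)])
  show "Ck_on k U (\<lambda>x. inverse (g x))"
    by (rule Ck_on_compose[OF assms(1,3) Ck_on_inverse]) (use assms(4) in auto)
qed

section \<open>Smooth maps on sets that need not be open, and symmetry of second derivatives\<close>

lemma smooth_on_interior_Ck:
  assumes "smooth_on S f"
  shows "Ck_on k (interior S) f"
proof (rule Ck_on_local)
  fix x assume x: "x \<in> interior S"
  then have "x \<in> S"
    using interior_subset by auto
  then obtain U g where U: "open U" "x \<in> U" "\<forall>k. Ck_on k U g" "\<forall>y\<in>S \<inter> U. g y = f y"
    using assms[unfolded smooth_on_def, rule_format, of x] by metis
  have "Ck_on k (U \<inter> interior S) g"
    using U(3) Ck_on_subset by blast
  moreover have "open (U \<inter> interior S)" "\<And>y. y \<in> U \<inter> interior S \<Longrightarrow> g y = f y"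
    using U interior_subset[of S] by auto
  ultimately have "Ck_on k (U \<inter> interior S) f"
    using Ck_on_cong[of "U \<inter> interior S" g f k] by simp
  then show "\<exists>V. open V \<and> x \<in> V \<and> Ck_on k V f"
    using U x by (intro exI[of _ "U \<inter> interior S"]) auto
qed

lemma smooth_on_continuous:
  assumes "smooth_on S f"
  shows "continuous_on S f"
  unfolding continuous_on_eq_continuous_within
proof
  fix x assume x: "x \<in> S"
  then obtain U g where U: "open U" "x \<in> U" "\<forall>k. Ck_on k U g" "\<forall>y\<in>S \<inter> U. g y = f y"
    using assms[unfolded smooth_on_def, rule_format, of x] by metis
  have "continuous (at x within S) g"
    using U(1,2) U(3)[rule_format, of 0]
    by (simp add: continuous_at_imp_continuous_at_within continuous_on_eq_continuous_at)
  moreover have "\<forall>\<^sub>F y in at x within S. g y = f y"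
    using U by (auto simp: eventually_at_topological)
  ultimately show "continuous (at x within S) f"
    using U(2,4) x unfolding continuous_within by (metis IntI tendsto_cong)
qed

lemma smooth_onE:
  assumes "smooth_on S f" "x \<in> S"
  obtains U g where "open U" "x \<in> U" "\<And>k. Ck_on k U g" "\<And>y. y \<in> S \<Longrightarrow> y \<in> U \<Longrightarrow> g y = f y"
proof -
  from assms(1)[unfolded smooth_on_def, rule_format, OF assms(2)]
  obtain U g where "open U" "x \<in> U" "\<forall>k. Ck_on k U g" "\<forall>y\<in>S \<inter> U. g y = f y" by blast
  then show ?thesis using that[of U g] by simp
qed

text \<open>Symmetry comes from differentiating \<open>F(u,v) = F(u,a) + \<integral>\<^sub>a\<^sup>v F\<^sub>v(u,t) dt\<close> in \<open>u\<close> under the integral.\<close>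

lemma mixed_partials_eq_local:
  fixes F :: "real \<Rightarrow> real \<Rightarrow> real"
  assumes r: "0 < r"
    and Fu: "\<And>s t. \<bar>s - u\<bar> < r \<Longrightarrow> \<bar>t - v\<bar> < r \<Longrightarrow> ((\<lambda>s. F s t) has_real_derivative Fu s t) (at s)"
    and Fv: "\<And>s t. \<bar>s - u\<bar> < r \<Longrightarrow> \<bar>t - v\<bar> < r \<Longrightarrow> (F s has_real_derivative Fv s t) (at t)"
    and Fvu: "\<And>s t. \<bar>s - u\<bar> < r \<Longrightarrow> \<bar>t - v\<bar> < r \<Longrightarrow> ((\<lambda>s. Fv s t) has_real_derivative Fvu s t) (at s)"
    and Fuv: "(Fu u has_real_derivative Fuv) (at v)"
    and cont: "continuous_on ({u-r<..<u+r} \<times> {v-r<..<v+r}) (\<lambda>(u, v). Fvu u v)"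
  shows "Fvu u v = Fuv"
proof -
  define a b where "a = v - r / 2" and "b = v + r / 2"
  have near: "\<bar>t - v\<bar> < r" if "a \<le> t" "t \<le> b" for t
    using that r by (auto simp: a_def b_def abs_less_iff)
  have FTC: "(Fv s has_integral (F s w - F s a)) {a..w}" if "a \<le> w" "w \<le> b" "\<bar>s - u\<bar> < r" for s w
  proof (rule fundamental_theorem_of_calculus[OF that(1)])
    fix t assume "t \<in> {a..w}"
    then have "(F s has_real_derivative Fv s t) (at t)"
      using that near by (intro Fv) auto
    then show "(F s has_vector_derivative Fv s t) (at t within {a..w})"
      by (simp add: has_real_derivative_iff_has_vector_derivative has_vector_derivative_at_within)
  qed
  have cont_Fvu: "continuous_on {a..b} (Fvu u)"
    using continuous_on_compose2[OF cont, of "{a..b}" "\<lambda>t. (u, t)"] r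
    by (force simp: continuous_on_Pair a_def b_def)
  have Fu_eq: "Fu u w = Fu u a + integral {a..w} (Fvu u)" if w: "a \<le> w" "w \<le> b" for w
  proof -
    let ?U = "{u-r<..<u+r}"
    have U: "at u within ?U = at u"
      using r by (intro at_within_open) auto
    have s: "\<bar>s - u\<bar> < r" if "s \<in> ?U" for s
      using that by (auto simp: abs_less_iff)
    have t: "t \<in> {v-r<..<v+r}" if "t \<in> {a..w}" for t
      using near[of t] w that by (auto simp: abs_less_iff)
    have "((\<lambda>s. integral (cbox a w) (Fv s)) has_real_derivative integral (cbox a w) (Fvu u)) (at u within ?U)"
    proof (rule leibniz_rule_field_derivative)
      show "((\<lambda>s. Fv s t) has_real_derivative Fvu s t) (at s within ?U)" if "s \<in> ?U" "t \<in> cbox a w" for s t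
        using Fvu[OF s[OF that(1)] near[of t]] that w by (auto intro: has_field_derivative_at_within)
      show "Fv s integrable_on cbox a w" if "s \<in> ?U" for s
        using FTC[OF w s[OF that]] by (auto intro: has_integral_integrable)
      show "continuous_on (?U \<times> cbox a w) (\<lambda>(s, t). Fvu s t)"
        by (rule continuous_on_subset[OF cont]) (use t in auto)
    qed (use r in auto)
    then have "((\<lambda>s. F s a + integral {a..w} (Fv s)) has_real_derivative Fu u a + integral {a..w} (Fvu u)) (at u)"
      using r near[of a] w unfolding U by (intro DERIV_add Fu) auto
    then have "((\<lambda>s. F s w) has_real_derivative Fu u a + integral {a..w} (Fvu u)) (at u)"
    proof (rule has_field_derivative_transform_within_open)
      show "F s a + integral {a..w} (Fv s) = F s w" if "s \<in> ?U" for s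
        using integral_unique[OF FTC[OF w s[OF that]]] by simp
    qed (use r in auto)
    then show ?thesis
      using DERIV_unique[OF Fu[of u w]] near[of w] w r by simp
  qed
  have "((\<lambda>w. integral {a..w} (Fvu u)) has_real_derivative Fvu u v) (at v within {a..b})"
    using r by (intro integral_has_real_derivative cont_Fvu) (auto simp: a_def b_def)
  moreover have "at v within {a..b} = at v"
    using r by (intro at_within_interior) (auto simp: a_def b_def)
  ultimately have "((\<lambda>w. Fu u a + integral {a..w} (Fvu u)) has_real_derivative Fvu u v) (at v)"
    using DERIV_add[OF DERIV_const] by fastforce
  then have "(Fu u has_real_derivative Fvu u v) (at v)"
  proof (rule has_field_derivative_transform_within_open)
    show "open {a<..<b}" "v \<in> {a<..<b}" using r by (auto simp: a_def b_def)
    show "Fu u a + integral {a..w} (Fvu u) = Fu u w" if "w \<in> {a<..<b}" for w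
      using Fu_eq[of w] that by simp
  qed
  then show ?thesis
    using Fuv DERIV_unique by blast
qed

lemma has_derivative_along_line:
  assumes "(f has_derivative f') (at (x + s *\<^sub>R v))"
  shows "((\<lambda>s. f (x + s *\<^sub>R v)) has_derivative (\<lambda>h. h *\<^sub>R f' v)) (at s)"
proof -
  interpret f': bounded_linear f' using assms has_derivative_bounded_linear by blast
  have "((\<lambda>s. x + s *\<^sub>R v) has_derivative (\<lambda>h. h *\<^sub>R v)) (at s)"
    by (auto intro!: derivative_eq_intros)
  from has_derivative_compose[OF this assms] show ?thesis
    by (simp add: f'.scaleR)
qed

text \<open>Composing f with (s, t) -> x + s v + t w reduces the claim to functions of two real
  variables.\<close>

lemma second_derivative_symmetric_real:
  fixes f :: "'a::euclidean_space \<Rightarrow> real"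
  assumes U: "open U" "x \<in> U" and f: "Ck_on 2 U f"
  shows "frechet_derivative (\<lambda>z. frechet_derivative f (at z) v) (at x) w
       = frechet_derivative (\<lambda>z. frechet_derivative f (at z) w) (at x) v"
proof -
  obtain e where e: "0 < e" "ball x e \<subseteq> U"
    using open_contains_ball U by blast
  \<comment> \<open>The summand 1 keeps the quotient meaningful for v = w = 0 and makes the estimate
    below strict.\<close>
  define r where "r = e / (norm v + norm w + 1)"
  have pos: "0 < norm v + norm w + 1" by (smt (verit) norm_ge_zero)
  have r: "0 < r" using e pos by (simp add: r_def)
  define \<phi> where "\<phi> s t = x + s *\<^sub>R v + t *\<^sub>R w" for s t
  have \<phi>: "\<phi> s t \<in> U" if "\<bar>s\<bar> < r" "\<bar>t\<bar> < r" for s t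
  proof -
    have "norm (s *\<^sub>R v + t *\<^sub>R w) \<le> \<bar>s\<bar> * norm v + \<bar>t\<bar> * norm w"
      using norm_triangle_ineq[of "s *\<^sub>R v" "t *\<^sub>R w"] by simp
    also have "\<dots> \<le> r * norm v + r * norm w"
      using that by (intro add_mono mult_right_mono) auto
    also have "\<dots> < r * (norm v + norm w + 1)" using r by (simp add: algebra_simps)
    also have "\<dots> = e" using pos by (simp add: r_def)
    finally have "dist (\<phi> s t) x < e" by (simp add: \<phi>_def dist_norm add.assoc)
    then have "\<phi> s t \<in> ball x e" by (simp add: dist_commute)
    then show ?thesis using e(2) by blast
  qed
  have along_v: "((\<lambda>s. g (\<phi> s t)) has_real_derivative g' v) (at s)" if "(g has_derivative g') (at (\<phi> s t))" for g :: "'a \<Rightarrow> real" and g' s t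
    using has_derivative_along_line[of g g' "x + t *\<^sub>R w" s v] that
    by (simp add: \<phi>_def has_field_derivative_def add.commute add.left_commute mult_commute_abs)
  have along_w: "((\<lambda>t. g (\<phi> s t)) has_real_derivative g' w) (at t)" if "(g has_derivative g') (at (\<phi> s t))" for g :: "'a \<Rightarrow> real" and g' s t
    using has_derivative_along_line[of g g' "x + s *\<^sub>R v" t w] that
    by (simp add: \<phi>_def has_field_derivative_def mult_commute_abs)
  have f1: "(f has_derivative frechet_derivative f (at z)) (at z)" if "z \<in> U" for z
    using f that Ck_on_has_derivative[of 1 U f z] by (simp add: numeral_2_eq_2)
  have f2: "((\<lambda>z. frechet_derivative f (at z) y) has_derivative
      frechet_derivative (\<lambda>z. frechet_derivative f (at z) y) (at z)) (at z)" if "z \<in> U" for z y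
    using f that Ck_on_has_derivative[of 0 U "\<lambda>z. frechet_derivative f (at z) y" z] by (simp add: numeral_2_eq_2)
  have cont: "continuous_on U (\<lambda>z. frechet_derivative (\<lambda>z. frechet_derivative f (at z) w) (at z) v)"
    using f by (simp add: numeral_2_eq_2)
  have "(\<lambda>s t. frechet_derivative (\<lambda>z. frechet_derivative f (at z) w) (at (\<phi> s t)) v) 0 0
      = frechet_derivative (\<lambda>z. frechet_derivative f (at z) v) (at (\<phi> 0 0)) w"
  proof (rule mixed_partials_eq_local[OF r, where u = 0 and v = 0
        and Fvu = "\<lambda>s t. frechet_derivative (\<lambda>z. frechet_derivative f (at z) w) (at (\<phi> s t)) v" and F = "\<lambda>s t. f (\<phi> s t)" and Fu = "\<lambda>s t. frechet_derivative f (at (\<phi> s t)) v"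
        and Fv = "\<lambda>s t. frechet_derivative f (at (\<phi> s t)) w"])
    have "continuous_on ({-r<..<r} \<times> {-r<..<r}) (\<lambda>z. frechet_derivative (\<lambda>z. frechet_derivative f (at z) w) (at (\<phi> (fst z) (snd z))) v)"
      by (rule continuous_on_compose2[OF cont]) (auto simp: \<phi>_def[symmetric] intro!: \<phi>, auto simp: \<phi>_def intro!: continuous_intros)
    then show "continuous_on ({0-r<..<0+r} \<times> {0-r<..<0+r}) (\<lambda>(s, t). frechet_derivative (\<lambda>z. frechet_derivative f (at z) w) (at (\<phi> s t)) v)"
      by (simp add: case_prod_beta)
  qed (use \<phi> r in \<open>auto intro!: along_v along_w f1 f2\<close>)
  then show ?thesis by (simp add: \<phi>_def)
qed

lemma second_derivative_symmetric:
  fixes f :: "'a::euclidean_space \<Rightarrow> 'b::euclidean_space"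
  assumes U: "open U" "x \<in> U" and f: "Ck_on 2 U f"
  shows "frechet_derivative (\<lambda>z. frechet_derivative f (at z) v) (at x) w
       = frechet_derivative (\<lambda>z. frechet_derivative f (at z) w) (at x) v"
proof (rule euclidean_eqI)
  fix b :: 'b assume "b \<in> Basis"
  have fb: "Ck_on 2 U (\<lambda>z. f z \<bullet> b)"
    using Ck_on_bounded_linear[OF bounded_linear_inner_left U(1) f] .
  have 1: "frechet_derivative (\<lambda>z. f z \<bullet> b) (at z) = (\<lambda>y. frechet_derivative f (at z) y \<bullet> b)" if "z \<in> U" for z
  proof (rule frechet_derivative_at[symmetric])
    have "(f has_derivative frechet_derivative f (at z)) (at z)"
      using f that Ck_on_has_derivative[of 1 U f z] by (simp add: numeral_2_eq_2)
    then show "((\<lambda>z. f z \<bullet> b) has_derivative (\<lambda>y. frechet_derivative f (at z) y \<bullet> b)) (at z)"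
      by (rule has_derivative_inner_left)
  qed
  have 2: "frechet_derivative (\<lambda>z. frechet_derivative (\<lambda>z. f z \<bullet> b) (at z) y) (at x) y'
      = frechet_derivative (\<lambda>z. frechet_derivative f (at z) y) (at x) y' \<bullet> b" for y y'
  proof -
    have "((\<lambda>z. frechet_derivative f (at z) y) has_derivative
      frechet_derivative (\<lambda>z. frechet_derivative f (at z) y) (at x)) (at x)"
      using f U(2) Ck_on_has_derivative[of 0 U "\<lambda>z. frechet_derivative f (at z) y" x] by (simp add: numeral_2_eq_2)
    then have "((\<lambda>z. frechet_derivative f (at z) y \<bullet> b) has_derivative
        (\<lambda>y'. frechet_derivative (\<lambda>z. frechet_derivative f (at z) y) (at x) y' \<bullet> b)) (at x)"
      by (rule has_derivative_inner_left)
    then have "((\<lambda>z. frechet_derivative (\<lambda>z. f z \<bullet> b) (at z) y) has_derivative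
        (\<lambda>y'. frechet_derivative (\<lambda>z. frechet_derivative f (at z) y) (at x) y' \<bullet> b)) (at x)"
      by (rule has_derivative_transform_within_open[OF _ U]) (simp add: 1)
    then show ?thesis
      using frechet_derivative_at by metis
  qed
  show "frechet_derivative (\<lambda>z. frechet_derivative f (at z) v) (at x) w \<bullet> b
       = frechet_derivative (\<lambda>z. frechet_derivative f (at z) w) (at x) v \<bullet> b"
    using second_derivative_symmetric_real[OF U fb, of v w] unfolding 2 .
qed

section \<open>Closed one-forms on the plane and their periods\<close>

text \<open>The integral from 0 to x with its sign: for x < 0 the first interval is empty and the
  second term carries the value.\<close>

definition prim :: "(real \<Rightarrow> real) \<Rightarrow> real \<Rightarrow> real" where
  "prim g x = integral {0..x} g - integral {x..0} g"

text \<open>A base point to the left of both 0 and x removes the case distinction, so that results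
  for a fixed lower limit apply.\<close>

lemma prim_eq:
  assumes g: "continuous_on UNIV g" and "a \<le> 0" "a \<le> x"
  shows "prim g x = integral {a..x} g - integral {a..0} g"
proof -
  have int: "g integrable_on {c..d}" for c d
    by (rule integrable_continuous_real) (rule continuous_on_subset[OF g], auto)
  show ?thesis
  proof (cases "0 \<le> x")
    case True
    have "integral {x..0} g = 0"
      using True by (cases "x = 0") auto
    then show ?thesis
      using Henstock_Kurzweil_Integration.integral_combine[OF \<open>a \<le> 0\<close> True int] by (simp add: prim_def)
  next
    case False
    then have "integral {a..x} g + integral {x..0} g = integral {a..0} g"
      using Henstock_Kurzweil_Integration.integral_combine[OF \<open>a \<le> x\<close> _ int, of 0] by simp
    then show ?thesis
      using False by (simp add: prim_def)
  qed
qed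

lemma prim_deriv:
  assumes g: "continuous_on UNIV g"
  shows "(prim g has_real_derivative g x) (at x)"
proof -
  define a where "a = - (\<bar>x\<bar> + 1)"
  have a: "a \<le> 0" "a < x" by (auto simp: a_def)
  have "((\<lambda>x. integral {a..x} g) has_real_derivative g x) (at x within {a..x + 1})"
    by (rule integral_has_real_derivative) (use a in \<open>auto intro: continuous_on_subset[OF g]\<close>)
  moreover have "at x within {a..x + 1} = at x"
    by (rule at_within_interior) (use a in auto)
  ultimately have "((\<lambda>x. integral {a..x} g - integral {a..0} g) has_real_derivative g x) (at x)"
    using DERIV_diff[OF _ DERIV_const] by fastforce
  then show ?thesis
  proof (rule has_field_derivative_transform_within_open)
    show "open {a<..}" "x \<in> {a<..}" using a by auto
    show "integral {a..w} g - integral {a..0} g = prim g w" if "w \<in> {a<..}" for w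
      using prim_eq[OF g a(1), of w] that by simp
  qed
qed

text \<open>The form is \<open>P du + Q dv\<close>, and \<open>\<delta>\<close> is the common value of \<open>\<partial>P/\<partial>v\<close> and \<open>\<partial>Q/\<partial>u\<close>.\<close>

lemma closed_form_primitive:
  fixes P Q :: "real \<Rightarrow> real \<Rightarrow> real"
  assumes contP: "continuous_on UNIV (\<lambda>(u, v). P u v)"
    and contQ: "continuous_on UNIV (\<lambda>(u, v). Q u v)"
    and contd: "continuous_on UNIV (\<lambda>(u, v). \<delta> u v)"
    and P: "\<And>u v. (P u has_real_derivative \<delta> u v) (at v)"
    and Q: "\<And>u v. ((\<lambda>u. Q u v) has_real_derivative \<delta> u v) (at u)"
  obtains f :: "real \<times> real \<Rightarrow> real" where
    "\<And>u v. (f has_derivative (\<lambda>(x, y). x * P u v + y * Q u v)) (at (u, v))"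
proof -
  have cont1: "continuous_on UNIV (h u)" if "continuous_on UNIV (\<lambda>(u, v). h u v)" for h :: "real \<Rightarrow> real \<Rightarrow> real" and u
    using continuous_on_compose2[OF that, of UNIV "\<lambda>t. (u, t)"] by (simp add: continuous_on_Pair)
  have cont2: "continuous_on UNIV (\<lambda>t. h t u)" if "continuous_on UNIV (\<lambda>(u, v). h u v)" for h :: "real \<Rightarrow> real \<Rightarrow> real" and u
    using continuous_on_compose2[OF that, of UNIV "\<lambda>t. (t, u)"] by (simp add: continuous_on_Pair)
  \<comment> \<open>The form integrated from the origin, along the u-axis and then in the
    v-direction.\<close>
  define f where "f u v = prim (\<lambda>s. P s 0) u + prim (Q u) v" for u v
  have FTC: "(\<delta> u has_integral (P u w - P u a)) {a..w}" if "a \<le> w" for u a w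
    using that P by (intro fundamental_theorem_of_calculus)
      (auto simp: has_real_derivative_iff_has_vector_derivative[symmetric] intro: DERIV_subset)
  \<comment> \<open>Differentiating under the integral turns Q into \<delta>, which is also the
    v-derivative of P and so integrates back to P.\<close>
  have leib: "((\<lambda>u. integral {a..w} (Q u)) has_real_derivative P u w - P u a) (at u)" if "a \<le> w" for a w u
  proof -
    have "((\<lambda>u. integral (cbox a w) (Q u)) has_real_derivative integral (cbox a w) (\<delta> u)) (at u within UNIV)"
      by (rule leibniz_rule_field_derivative)
        (use Q in \<open>auto intro: continuous_on_subset[OF contd] integrable_continuous_real
          continuous_on_subset[OF cont1[OF contQ]]\<close>)
    then show ?thesis
      using integral_unique[OF FTC[OF that]] by simp
  qed
  have fu: "((\<lambda>u. f u v) has_real_derivative P u v) (at u)" for u v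
  proof -
    define a where "a = - (\<bar>v\<bar> + 1)"
    have a: "a \<le> 0" "a \<le> v" by (auto simp: a_def)
    have eq: "(\<lambda>u. f u v) = (\<lambda>u. prim (\<lambda>s. P s 0) u + (integral {a..v} (Q u) - integral {a..0} (Q u)))"
      using prim_eq[OF cont1[OF contQ] a] by (auto simp: f_def)
    have "((\<lambda>u. prim (\<lambda>s. P s 0) u + (integral {a..v} (Q u) - integral {a..0} (Q u)))
        has_real_derivative P u 0 + ((P u v - P u a) - (P u 0 - P u a))) (at u)"
      by (intro DERIV_add DERIV_diff leib a prim_deriv[OF cont2[OF contP]])
    then show ?thesis
      unfolding eq by simp
  qed
  have fv: "(f u has_real_derivative Q u v) (at v)" for u v
    using DERIV_add[OF DERIV_const prim_deriv[OF cont1[OF contQ]]] by (simp add: f_def[abs_def])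
  have "((\<lambda>(u, v). f u v) has_derivative (\<lambda>(x, y). x * P u v + y * Q u v)) (at (u, v))" for u v
  proof -
    define q :: "real \<Rightarrow> real \<Rightarrow> real \<Rightarrow>\<^sub>L real" where "q u v = Q u v *\<^sub>R id_blinfun" for u v
    have q: "blinfun_apply (q u v) = (\<lambda>y. y * Q u v)" for u v
      by (auto simp: q_def blinfun.scaleR_left)
    have fu': "((\<lambda>u. f u v) has_derivative (\<lambda>x. x * P u v)) (at u within UNIV)"
      using fu by (simp add: has_field_derivative_def mult_commute_abs)
    have fv': "(f u has_derivative blinfun_apply (q u v)) (at v within UNIV)" for u v
      using fv[of u v] by (simp add: has_field_derivative_def q mult_commute_abs)
    have "continuous (at (u, v) within UNIV \<times> UNIV) (\<lambda>(u, v). Q u v)"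
      using contQ by (simp add: continuous_on_eq_continuous_at)
    then have "continuous (at (u, v) within UNIV \<times> UNIV) (\<lambda>(u, v). q u v)"
      unfolding case_prod_beta q_def by (intro continuous_intros)
    from has_derivative_partialsI[OF fu' fv' this] show ?thesis
      by (simp add: q)
  qed
  then show ?thesis
    using that by blast
qed

text \<open>Translation by a period does not change the derivative of f, so the increment of f is a
  constant: the period of the form.\<close>

lemma constant_period:
  fixes f :: "real \<times> real \<Rightarrow> real"
  assumes f: "\<And>u v. (f has_derivative (\<lambda>(x, y). x * P u v + y * Q u v)) (at (u, v))"
    and "\<And>u v. P (u + a) (v + b) = P u v" "\<And>u v. Q (u + a) (v + b) = Q u v"
  shows "f (u + a, v + b) = f (u, v) + (f (a, b) - f (0, 0))"
proof -
  have "((\<lambda>z. f (z + (a, b)) - f z) has_derivative (\<lambda>h. 0)) (at z within UNIV)" for z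
  proof -
    obtain u v where z: "z = (u, v)" by force
    have "((\<lambda>z. f (z + (a, b))) has_derivative (\<lambda>(x, y). x * P (u + a) (v + b) + y * Q (u + a) (v + b))) (at z)"
    proof (rule has_derivative_compose[of "\<lambda>z. z + (a, b)" "\<lambda>h. h"])
      show "((\<lambda>z. z + (a, b)) has_derivative (\<lambda>h. h)) (at z)"
        by (auto intro!: derivative_eq_intros)
    qed (use f[of "u + a" "v + b"] z in simp)
    from has_derivative_diff[OF this f[of u v, folded z]] show ?thesis
      using assms(2,3) by (simp add: case_prod_beta)
  qed
  then obtain c where c: "\<And>z. f (z + (a, b)) - f z = c"
    using has_derivative_zero_constant[of UNIV "\<lambda>z. f (z + (a, b)) - f z"] by auto
  show ?thesis
    using c[of "(u, v)"] c[of "(0, 0)"] by simp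
qed

text \<open>Integration by parts, from d(f \<beta>) = df \<and> \<beta> for the closed form \<beta>
  = R du + S dv. The function f is not periodic, so opposite edges of the square do not cancel: they
  differ by a period of f times the integral of \<beta> along an edge, which is a period of
  h.\<close>

lemma riemann_bilinear:
  fixes f h :: "real \<times> real \<Rightarrow> real"
  assumes f: "\<And>u v. (f has_derivative (\<lambda>(x, y). x * P u v + y * Q u v)) (at (u, v))"
    and h: "\<And>u v. (h has_derivative (\<lambda>(x, y). x * R u v + y * S u v)) (at (u, v))"
    and contP: "continuous_on UNIV (\<lambda>(u, v). P u v)"
    and contQ: "continuous_on UNIV (\<lambda>(u, v). Q u v)"
    and contd: "continuous_on UNIV (\<lambda>(u, v). \<delta> u v)"
    and R: "\<And>u v. (R u has_real_derivative \<delta> u v) (at v)"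
    and S: "\<And>u v. ((\<lambda>u. S u v) has_real_derivative \<delta> u v) (at u)"
    and contR: "continuous_on UNIV (\<lambda>(u, v). R u v)"
    and contS: "continuous_on UNIV (\<lambda>(u, v). S u v)"
    and L: "0 < L"
    and perR: "\<And>u. R u L = R u 0" and perS: "\<And>v. S L v = S 0 v"
    and fL1: "\<And>v. f (L, v) = f (0, v) + a\<^sub>1" and fL2: "\<And>u. f (u, L) = f (u, 0) + a\<^sub>2"
    and hL1: "h (L, 0) = h (0, 0) + b\<^sub>1" and hL2: "h (0, L) = h (0, 0) + b\<^sub>2"
  shows "integral (cbox (0, 0) (L, L)) (\<lambda>(u, v). P u v * S u v - Q u v * R u v) = a\<^sub>1 * b\<^sub>2 - a\<^sub>2 * b\<^sub>1"
proof -
  have partial_u: "((\<lambda>u. k (u, v)) has_real_derivative A u v) (at u)"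
    if "\<And>u v. (k has_derivative (\<lambda>(x, y). x * A u v + y * B u v)) (at (u, v))" for k A B u v
  proof -
    have "((\<lambda>u. (u, v)) has_derivative (\<lambda>x. (x, 0))) (at u)"
      by (auto intro!: derivative_eq_intros)
    from has_derivative_compose[OF this that[of u v]] show ?thesis
      by (simp add: has_field_derivative_def mult_commute_abs)
  qed
  have partial_v: "((\<lambda>v. k (u, v)) has_real_derivative B u v) (at v)"
    if "\<And>u v. (k has_derivative (\<lambda>(x, y). x * A u v + y * B u v)) (at (u, v))" for k A B u v
  proof -
    have "((\<lambda>v. (u, v)) has_derivative (\<lambda>x. (0, x))) (at v)"
      by (auto intro!: derivative_eq_intros)
    from has_derivative_compose[OF this that[of u v]] show ?thesis
      by (simp add: has_field_derivative_def mult_commute_abs)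
  qed
  have contf: "continuous_on UNIV f"
    using has_derivative_continuous[OF f] by (auto intro!: continuous_at_imp_continuous_on)
  have cont1: "continuous_on A (h u)" if "continuous_on UNIV (\<lambda>(u, v). h u v)" for h :: "real \<Rightarrow> real \<Rightarrow> real" and u A
    using continuous_on_compose2[OF that, of A "\<lambda>t. (u, t)"] by (simp add: continuous_on_Pair)
  have cont2: "continuous_on A (\<lambda>t. h t u)" if "continuous_on UNIV (\<lambda>(u, v). h u v)" for h :: "real \<Rightarrow> real \<Rightarrow> real" and u A
    using continuous_on_compose2[OF that, of A "\<lambda>t. (t, u)"] by (simp add: continuous_on_Pair)
  \<comment> \<open>\<open>T1\<close> is the u-derivative of f S and \<open>T2\<close> the
    v-derivative of f R; in the difference the terms with \<delta> cancel.\<close>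
  define T1 where "T1 = (\<lambda>u v. P u v * S u v + f (u, v) * \<delta> u v)"
  define T2 where "T2 = (\<lambda>u v. Q u v * R u v + f (u, v) * \<delta> u v)"
  have contT: "continuous_on UNIV (\<lambda>(u, v). T1 u v)" "continuous_on UNIV (\<lambda>(u, v). T2 u v)"
    using contP contQ contR contS contd contf unfolding T1_def T2_def case_prod_beta
    by (auto intro!: continuous_intros)
  have I1: "integral {0..L} (\<lambda>u. T1 u v) = f (L, v) * S L v - f (0, v) * S 0 v" for v
    using L unfolding T1_def
    by (intro integral_unique fundamental_theorem_of_calculus)
      (auto simp: has_real_derivative_iff_has_vector_derivative[symmetric] algebra_simps
        intro!: derivative_eq_intros DERIV_subset[OF partial_u[OF f]] DERIV_subset[OF S])
  have I2: "integral {0..L} (T2 u) = f (u, L) * R u L - f (u, 0) * R u 0" for u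
    using L unfolding T2_def
    by (intro integral_unique fundamental_theorem_of_calculus)
      (auto simp: has_real_derivative_iff_has_vector_derivative[symmetric] algebra_simps
        intro!: derivative_eq_intros DERIV_subset[OF partial_v[OF f]] DERIV_subset[OF R])
  have IS: "integral {0..L} (S 0) = b\<^sub>2"
    using L hL2 by (intro integral_unique) (rule has_integral_eq_rhs[OF fundamental_theorem_of_calculus],
        auto simp: has_real_derivative_iff_has_vector_derivative[symmetric]
        intro!: DERIV_subset[OF partial_v[OF h]])
  have IR: "integral {0..L} (\<lambda>u. R u 0) = b\<^sub>1"
    using L hL1 by (intro integral_unique) (rule has_integral_eq_rhs[OF fundamental_theorem_of_calculus],
        auto simp: has_real_derivative_iff_has_vector_derivative[symmetric]
        intro!: DERIV_subset[OF partial_u[OF h]])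
  have "integral (cbox (0, 0) (L, L)) (\<lambda>(u, v). T1 u v)
      = integral (cbox 0 L) (\<lambda>u. integral (cbox 0 L) (\<lambda>v. T1 u v))"
    using integral_prod_continuous[of 0 0 L L "\<lambda>(u, v). T1 u v"] continuous_on_subset[OF contT(1)]
    by simp
  also have "\<dots> = integral (cbox 0 L) (\<lambda>v. integral (cbox 0 L) (\<lambda>u. T1 u v))"
    by (rule integral_swap_continuous) (rule continuous_on_subset[OF contT(1)], auto)
  also have "\<dots> = a\<^sub>1 * b\<^sub>2"
    using IS by (simp add: I1 perS fL1 algebra_simps)
  finally have T1: "integral (cbox (0, 0) (L, L)) (\<lambda>(u, v). T1 u v) = a\<^sub>1 * b\<^sub>2" .
  have "integral (cbox (0, 0) (L, L)) (\<lambda>(u, v). T2 u v)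
      = integral (cbox 0 L) (\<lambda>u. integral (cbox 0 L) (\<lambda>v. T2 u v))"
    using integral_prod_continuous[of 0 0 L L "\<lambda>(u, v). T2 u v"] continuous_on_subset[OF contT(2)]
    by simp
  also have "\<dots> = a\<^sub>2 * b\<^sub>1"
    using IR by (simp add: I2 perR fL2 algebra_simps)
  finally have T2: "integral (cbox (0, 0) (L, L)) (\<lambda>(u, v). T2 u v) = a\<^sub>2 * b\<^sub>1" .
  have "integral (cbox (0, 0) (L, L)) (\<lambda>(u, v). P u v * S u v - Q u v * R u v)
      = integral (cbox (0, 0) (L, L)) (\<lambda>z. (\<lambda>(u, v). T1 u v) z - (\<lambda>(u, v). T2 u v) z)"
    by (rule arg_cong[where f = "integral _"]) (auto simp: T1_def T2_def)
  also have "\<dots> = a\<^sub>1 * b\<^sub>2 - a\<^sub>2 * b\<^sub>1"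
    unfolding T1[symmetric] T2[symmetric]
    by (intro integral_diff integrable_continuous) (auto intro: continuous_on_subset contT)
  finally show ?thesis .
qed

section \<open>Winding around the axis\<close>

definition planar :: "real^3 \<Rightarrow> complex" where
  "planar x = Complex (x $ 1) (x $ 2)"

text \<open>A continuous choice of logarithm is a continuous single-valued choice of the angle
  around the z-axis, since the modulus never causes trouble. It stands for exactness of d\<theta> on
  S and makes sense for sets without any smooth structure.\<close>

definition has_log :: "(real^3) set \<Rightarrow> bool" where
  "has_log S \<longleftrightarrow> (\<exists>g. continuous_on S g \<and> (\<forall>x\<in>S. planar x = exp (g x)))"

lemma continuous_on_planar [continuous_intros]:
  "continuous_on S f \<Longrightarrow> continuous_on S (\<lambda>x. planar (f x))"
  unfolding planar_def Complex_eq by (intro continuous_intros)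

lemma z_axis_iff: "x \<in> z_axis \<longleftrightarrow> planar x = 0"
proof -
  have "x = k *\<^sub>R vector [0, 0, 1] \<longleftrightarrow> x $ 1 = 0 \<and> x $ 2 = 0 \<and> x $ 3 = k" for k
    by (simp add: vec_eq_iff forall_3)
  then show ?thesis
    by (auto simp: z_axis_def span_singleton planar_def complex_eq_iff)
qed

lemma has_log_iff_inessential:
  "has_log S \<longleftrightarrow> (\<exists>a. homotopic_with_canon (\<lambda>h. True) S (- {0}) planar (\<lambda>t. a))"
  by (simp add: has_log_def inessential_eq_continuous_logarithm)

lemma has_log_subset: "has_log S \<Longrightarrow> T \<subseteq> S \<Longrightarrow> has_log T"
  unfolding has_log_def using continuous_on_subset by blast

subsection \<open>Homology of the complement of the axis\<close>

text \<open>Projection to the unit circle around the axis, in the coordinates of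
  \<open>nsphere 1\<close>, whose points are sequences that vanish from index 2 on.\<close>

definition radial :: "real^3 \<Rightarrow> nat \<Rightarrow> real" where
  "radial x = (\<lambda>i. if i = 0 then x $ 1 / norm (planar x)
     else if i = Suc 0 then x $ 2 / norm (planar x) else 0)"

lemma continuous_map_nsphere_1:
  assumes "\<And>x. x \<in> topspace X \<Longrightarrow> (f x)\<^sup>2 + (g x)\<^sup>2 = 1"
    and "continuous_map X euclideanreal f" "continuous_map X euclideanreal g"
  shows "continuous_map X (nsphere 1) (\<lambda>x i. if i = 0 then f x else if i = Suc 0 then g x else 0)"
  unfolding nsphere continuous_map_in_subtopology continuous_map_componentwise_UNIV
proof (intro conjI allI)
  show "continuous_map X euclideanreal (\<lambda>x. if i = 0 then f x else if i = Suc 0 then g x else 0)" for i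
    using assms(2,3) by auto
qed (use assms(1) in auto)

lemma continuous_map_radial: "continuous_map (top_of_set (UNIV - z_axis)) (nsphere 1) radial"
  unfolding radial_def
proof (rule continuous_map_nsphere_1)
  fix x assume "x \<in> topspace (top_of_set (UNIV - z_axis))"
  then have "planar x \<noteq> 0" by (simp add: z_axis_iff)
  then show "(x $ 1 / norm (planar x))\<^sup>2 + (x $ 2 / norm (planar x))\<^sup>2 = 1"
    by (simp add: power_divide cmod_def planar_def complex_eq_iff sum_power2_eq_zero_iff flip: add_divide_distrib)
qed (auto intro!: continuous_intros simp: z_axis_iff)

text \<open>The section \<open>j\<close> places the circle in the plane z = 0. A retraction is onto
  in homology, which is what the winding argument asks for, so no homotopy equivalence is
  built.\<close>

lemma retraction_map_radial: "retraction_map (top_of_set (UNIV - z_axis)) (nsphere 1) radial"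
proof -
  define j :: "(nat \<Rightarrow> real) \<Rightarrow> real^3" where "j y = vector [y 0, y (Suc 0), 0]" for y
  have planar_j: "norm (planar (j y)) = 1" if "y \<in> topspace (nsphere 1)" for y
    using that by (simp add: nsphere planar_def cmod_def j_def)
  have "continuous_map (nsphere 1) euclidean j"
  proof -
    have "j = (\<lambda>y. y 0 *\<^sub>R axis 1 1 + y (Suc 0) *\<^sub>R axis 2 1)"
      by (auto simp: j_def vec_eq_iff forall_3 axis_def)
    moreover have "continuous_map (nsphere 1) euclidean (\<lambda>y. y i *\<^sub>R (v :: real^3))" for i v
      unfolding nsphere
      by (intro continuous_map_from_subtopology continuous_map_compose[of _ euclideanreal "\<lambda>y. y i" _ "\<lambda>t. t *\<^sub>R v", unfolded o_def]
          continuous_map_product_projection) (auto intro!: continuous_intros)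
    ultimately show ?thesis
      by (simp add: continuous_map_add)
  qed
  then have "continuous_map (nsphere 1) (top_of_set (UNIV - z_axis)) j"
    using planar_j by (force simp: continuous_map_in_subtopology z_axis_iff)
  moreover have "radial (j y) = y" if "y \<in> topspace (nsphere 1)" for y
    using planar_j[OF that] that
    by (auto simp: radial_def j_def nsphere fun_eq_iff)
  ultimately show ?thesis
    unfolding retraction_map_def retraction_maps_def using continuous_map_radial by blast
qed

text \<open>A constant map factors through a point, whose homology vanishes in nonzero
  degree.\<close>

lemma hom_induced_const:
  assumes "a \<in> topspace Y" "p \<noteq> 0" "c \<in> carrier (homology_group p X)"
  shows "hom_induced p X {} Y {} (\<lambda>x. a) c = \<one>\<^bsub>homology_group p Y\<^esub>"
proof -
  let ?P = "subtopology Y {a}"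
  have top: "topspace ?P = {a}" using assms(1) by auto
  have maps: "continuous_map X ?P (\<lambda>x. a)" "continuous_map ?P Y id"
    using assms(1) by (auto simp: continuous_map_in_subtopology)
  have eq: "hom_induced p X {} Y {} (\<lambda>x. a) = hom_induced p ?P {} Y {} id \<circ> hom_induced p X {} ?P {} (\<lambda>x. a)"
    using hom_induced_compose_empty[OF maps, of p] by (simp add: o_def)
  have "carrier (homology_group p ?P) = {\<one>\<^bsub>homology_group p ?P\<^esub>}"
    using homology_dimension_axiom[OF top assms(2)] by (simp add: trivial_group_def)
  moreover have "hom_induced p X {} ?P {} (\<lambda>x. a) c \<in> carrier (homology_group p ?P)"
    by (metis hom_induced)
  ultimately show ?thesis
    using hom_one[OF hom_induced_empty_hom[of p ?P Y id]] by (simp add: eq)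
qed

text \<open>A logarithm contracts \<open>M\<close> inside the circle, while \<open>radial\<close> is onto in homology.\<close>

lemma no_log_if_H1_surjective:
  assumes surj: "hom_induced 1 (top_of_set M) {} (top_of_set (UNIV - z_axis)) {} id
           ` carrier (homology_group 1 (top_of_set M))
         = carrier (homology_group 1 (top_of_set (UNIV - z_axis)))"
    and M: "M \<inter> z_axis = {}"
  shows "\<not> has_log M"
proof
  assume "has_log M"
  then obtain g where g: "continuous_on M g" "\<And>x. x \<in> M \<Longrightarrow> planar x = exp (g x)"
    unfolding has_log_def by blast
  \<comment> \<open>Scaling the angle Im g from 0 to its full value deforms the constant map into
    \<open>radial\<close>.\<close>
  define h :: "real \<times> (real^3) \<Rightarrow> nat \<Rightarrow> real" where
    "h = (\<lambda>z i. if i = 0 then cos (fst z * Im (g (snd z)))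
       else if i = Suc 0 then sin (fst z * Im (g (snd z))) else 0)"
  define a :: "nat \<Rightarrow> real" where "a = (\<lambda>i. if i = 0 then 1 else 0)"
  let ?T = "prod_topology (top_of_set {0..1}) (top_of_set M)"
  have "continuous_map ?T (nsphere 1) h"
    unfolding h_def
  proof (rule continuous_map_nsphere_1)
    have "continuous_on ({0..1} \<times> M) (\<lambda>z. g (snd z))"
      by (rule continuous_on_compose2[OF g(1)]) (auto intro!: continuous_intros)
    then show "continuous_map ?T euclideanreal (\<lambda>z. cos (fst z * Im (g (snd z))))"
      "continuous_map ?T euclideanreal (\<lambda>z. sin (fst z * Im (g (snd z))))"
      unfolding subtopology_Times[symmetric] euclidean_product_topology
      by (auto intro!: continuous_intros)
  qed auto
  moreover have "h (0, x) = a" for x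
    by (auto simp: h_def a_def)
  moreover have "h (1, x) = radial x" if "x \<in> M" for x
  proof -
    have "norm (planar x) = exp (Re (g x))" "x $ 1 = Re (exp (g x))" "x $ 2 = Im (exp (g x))"
      using g(2)[OF that] by (simp_all add: planar_def complex_eq_iff)
    then show ?thesis
      by (auto simp: h_def radial_def Re_exp Im_exp)
  qed
  ultimately have "homotopic_with (\<lambda>h. True) (top_of_set M) (nsphere 1) (\<lambda>x. a) radial"
    by (subst homotopic_with) auto
  then have "hom_induced 1 (top_of_set M) {} (nsphere 1) {} radial
      = hom_induced 1 (top_of_set M) {} (nsphere 1) {} (\<lambda>x. a)"
    using homology_homotopy_empty by metis
  moreover have "a \<in> topspace (nsphere 1)"
    by (auto simp: a_def nsphere)
  ultimately have triv: "hom_induced 1 (top_of_set M) {} (nsphere 1) {} radial c = \<one>\<^bsub>homology_group 1 (nsphere 1)\<^esub>"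
    if "c \<in> carrier (homology_group 1 (top_of_set M))" for c
    using hom_induced_const[OF _ _ that] by simp
  have "continuous_map (top_of_set M) (top_of_set (UNIV - z_axis)) id"
    using M by (auto simp: continuous_map_in_subtopology)
  from hom_induced_compose_empty[OF this continuous_map_radial, of 1]
  have comp: "hom_induced 1 (top_of_set (UNIV - z_axis)) {} (nsphere 1) {} radial
      (hom_induced 1 (top_of_set M) {} (top_of_set (UNIV - z_axis)) {} id c)
      = hom_induced 1 (top_of_set M) {} (nsphere 1) {} radial c" for c
    by simp
  have "carrier (homology_group 1 (nsphere 1)) \<subseteq> {\<one>\<^bsub>homology_group 1 (nsphere 1)\<^esub>}"
    unfolding surj_hom_induced_retraction_map[OF retraction_map_radial] surj[symmetric]
    using comp triv by auto
  then have "trivial_group (homology_group 1 (nsphere 1))"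
    unfolding trivial_group_def
    using monoid.one_closed[OF group.is_monoid[OF group_relative_homology_group[of 1 "nsphere 1" "{}"]]]
    by (intro conjI subset_antisym) simp_all
  then show False
    using trivial_reduced_homology_group_nsphere[of 1 1] un_reduced_homology_group[of 1 "nsphere 1"] by simp
qed

subsection \<open>Logarithms on level sets\<close>

text \<open>Extend the logarithm to all of space by Tietze. The quotient of \<open>planar\<close> by
  the exponential of the extension is 1 on T, hence close to 1 nearby, and there the principal
  logarithm corrects the error.\<close>

lemma has_log_neighbourhood:
  assumes T: "closed T" and log: "has_log T"
  obtains N where "open N" "T \<subseteq> N" "has_log N"
proof -
  obtain g where g: "continuous_on T g" "\<And>x. x \<in> T \<Longrightarrow> planar x = exp (g x)"
    using log unfolding has_log_def by blast
  obtain g' where g': "continuous_on UNIV g'" "\<And>x. x \<in> T \<Longrightarrow> g' x = g x"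
    using Tietze_unbounded[OF g(1), of UNIV] T by auto
  define q where "q x = planar x * exp (- g' x)" for x
  have q: "continuous_on UNIV q"
    unfolding q_def by (intro continuous_intros g')
  define N where "N = q -` ball 1 1"
  show ?thesis
  proof
    show "open N"
      unfolding N_def using q by (intro open_vimage) auto
    show "T \<subseteq> N"
      using g g' by (auto simp: N_def q_def exp_minus)
    have ball: "z \<notin> \<real>\<^sub>\<le>\<^sub>0" if "z \<in> ball 1 1" for z :: complex
    proof
      assume "z \<in> \<real>\<^sub>\<le>\<^sub>0"
      then have "Re z \<le> 0" by (simp add: complex_nonpos_Reals_iff)
      then have "1 \<le> \<bar>Re (1 - z)\<bar>" by simp
      then show False
        using that abs_Re_le_cmod[of "1 - z"] by (simp add: dist_norm)
    qed
    have "continuous_on N (\<lambda>x. g' x + Ln (q x))"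
      using ball by (intro continuous_intros continuous_on_subset[OF g'(1)] continuous_on_subset[OF q])
        (auto simp: N_def)
    moreover have "planar x = exp (g' x + Ln (q x))" if "x \<in> N" for x
    proof -
      have "q x \<noteq> 0" using ball[of "q x"] that by (auto simp: N_def)
      then show ?thesis by (simp add: exp_add q_def exp_minus)
    qed
    ultimately show "has_log N"
      unfolding has_log_def by blast
  qed
qed

text \<open>Straight segments in the direction of the gradient replace its flow, so no differential
  equation is solved. On short segments p is strictly increasing at a uniform rate, and each nearby
  value is taken exactly once, at a parameter t that depends continuously on the starting
  point.\<close>

lemma level_set_push:
  fixes p :: "'a::euclidean_space \<Rightarrow> real"
  assumes W: "open W" and T: "compact T" "T \<subseteq> W"
    and p: "\<And>x. x \<in> W \<Longrightarrow> (p has_derivative (\<lambda>v. G x \<bullet> v)) (at x)"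
    and G: "continuous_on W G" "\<And>x. x \<in> T \<Longrightarrow> G x \<noteq> 0"
    and c: "\<And>x. x \<in> T \<Longrightarrow> p x = c"
  obtains \<epsilon> where "0 < \<epsilon>" "\<And>c'. \<bar>c' - c\<bar> < \<epsilon> \<Longrightarrow> \<exists>t. continuous_on T t \<and>
      (\<forall>x\<in>T. p (x + t x *\<^sub>R G x) = c' \<and> (\<forall>s\<in>{0..1}. x + (s * t x) *\<^sub>R G x \<in> W))"
proof (cases "T = {}")
  case True
  then show ?thesis using that[of 1] by auto
next
  case False
  obtain e where e: "0 < e" "(\<Union>x\<in>T. cball x e) \<subseteq> W"
    using compact_subset_open_imp_cball_epsilon_subset[OF T(1) W T(2)] by blast
  define K where "K = {x + y | x y. x \<in> T \<and> y \<in> cball 0 e}"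
  have K: "compact K" unfolding K_def by (rule compact_sums[OF T(1)]) auto
  have KW: "K \<subseteq> W" using e(2) by (fastforce simp: K_def dist_norm)
  have GT: "continuous_on T G" using G(1) T(2) continuous_on_subset by blast
  obtain x0 where x0: "x0 \<in> T" "\<And>x. x \<in> T \<Longrightarrow> norm (G x0) \<le> norm (G x)"
    using continuous_attains_inf[OF T(1) False, of "\<lambda>x. norm (G x)"] GT by (auto intro: continuous_intros)
  obtain x1 where x1: "x1 \<in> T" "\<And>x. x \<in> T \<Longrightarrow> norm (G x) \<le> norm (G x1)"
    using continuous_attains_sup[OF T(1) False, of "\<lambda>x. norm (G x)"] GT by (auto intro: continuous_intros)
  define m where "m = norm (G x0)"
  define R where "R = norm (G x1)"
  have m: "0 < m" using G(2) x0(1) by (simp add: m_def)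
  have R: "0 < R" using G(2) x1(1) by (simp add: R_def)
  have mR: "m \<le> norm (G x)" "norm (G x) \<le> R" if "x \<in> T" for x
    using x0 x1 that by (auto simp: m_def R_def)
  have "uniformly_continuous_on K G"
    using compact_uniformly_continuous[OF _ K] continuous_on_subset[OF G(1) KW] by blast
  then obtain d where d: "0 < d" "\<And>x y. x \<in> K \<Longrightarrow> y \<in> K \<Longrightarrow> dist y x < d \<Longrightarrow> dist (G y) (G x) < m / 2"
    using m unfolding uniformly_continuous_on_def by (meson half_gt_zero)
  \<comment> \<open>For parameters up to \<delta> the displacement is at most \<open>e\<close>, so
    the segment stays in \<open>K\<close>, and at most d/2, so G changes by less than m/2. Half of
    the squared gradient length then survives as slope.\<close>
  define \<delta> where "\<delta> = min e (d / 2) / R"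
  have \<delta>: "0 < \<delta>" using e d R by (simp add: \<delta>_def)
  have inK: "x + \<tau> *\<^sub>R G x \<in> K" and slope: "m\<^sup>2 / 2 \<le> G (x + \<tau> *\<^sub>R G x) \<bullet> G x"
    if "x \<in> T" "\<bar>\<tau>\<bar> \<le> \<delta>" for x \<tau>
  proof -
    have "norm (\<tau> *\<^sub>R G x) \<le> \<delta> * R"
      using that mR[OF that(1)] \<delta> by (simp add: mult_mono)
    then have small: "norm (\<tau> *\<^sub>R G x) \<le> min e (d / 2)" using R by (simp add: \<delta>_def)
    then show *: "x + \<tau> *\<^sub>R G x \<in> K"
      using that(1) unfolding K_def by (intro CollectI exI[of _ x] exI[of _ "\<tau> *\<^sub>R G x"]) auto
    have "x \<in> K"
      using that(1) e(1) unfolding K_def by (intro CollectI exI[of _ x] exI[of _ 0]) auto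
    then have "norm (G (x + \<tau> *\<^sub>R G x) - G x) \<le> m / 2"
      using d(2)[OF _ *, of x] small d(1) by (simp add: dist_norm)
    then have "norm (G (x + \<tau> *\<^sub>R G x) - G x) * norm (G x) \<le> norm (G x) / 2 * norm (G x)"
      using mR(1)[OF that(1)] by (intro mult_right_mono) auto
    then have "\<bar>(G (x + \<tau> *\<^sub>R G x) - G x) \<bullet> G x\<bar> \<le> (norm (G x))\<^sup>2 / 2"
      using Cauchy_Schwarz_ineq2[of "G (x + \<tau> *\<^sub>R G x) - G x" "G x"] by (simp add: power2_eq_square)
    then have "- ((G (x + \<tau> *\<^sub>R G x) - G x) \<bullet> G x) \<le> (norm (G x))\<^sup>2 / 2"
      by linarith
    then have "(norm (G x))\<^sup>2 / 2 \<le> G (x + \<tau> *\<^sub>R G x) \<bullet> G x"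
      by (simp add: inner_diff_left dot_square_norm)
    moreover have "m\<^sup>2 \<le> (norm (G x))\<^sup>2"
      using mR(1)[OF that(1)] m by (intro power_mono) auto
    ultimately show "m\<^sup>2 / 2 \<le> G (x + \<tau> *\<^sub>R G x) \<bullet> G x" by simp
  qed
  have deriv: "((\<lambda>\<tau>. p (x + \<tau> *\<^sub>R G x)) has_real_derivative G (x + \<tau> *\<^sub>R G x) \<bullet> G x) (at \<tau>)"
    if "x \<in> T" "\<bar>\<tau>\<bar> \<le> \<delta>" for x \<tau>
  proof -
    have "((\<lambda>\<tau>. x + \<tau> *\<^sub>R G x) has_derivative (\<lambda>h. h *\<^sub>R G x)) (at \<tau>)"
      by (auto intro!: derivative_eq_intros)
    from has_derivative_compose[OF this p] show ?thesis
      using inK[OF that] KW by (auto simp: has_field_derivative_def mult_commute_abs)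
  qed
  have incr: "p (x + \<sigma> *\<^sub>R G x) + m\<^sup>2 / 2 * (\<tau> - \<sigma>) \<le> p (x + \<tau> *\<^sub>R G x)"
    if "x \<in> T" "- \<delta> \<le> \<sigma>" "\<sigma> \<le> \<tau>" "\<tau> \<le> \<delta>" for x \<sigma> \<tau>
  proof -
    have "p (x + \<sigma> *\<^sub>R G x) - m\<^sup>2 / 2 * \<sigma> \<le> p (x + \<tau> *\<^sub>R G x) - m\<^sup>2 / 2 * \<tau>"
    proof (rule DERIV_nonneg_imp_nondecreasing[OF that(3)])
      fix z assume z: "\<sigma> \<le> z" "z \<le> \<tau>"
      have "((\<lambda>z. p (x + z *\<^sub>R G x) - m\<^sup>2 / 2 * z) has_real_derivative G (x + z *\<^sub>R G x) \<bullet> G x - m\<^sup>2 / 2) (at z)"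
        using that z by (auto intro!: derivative_eq_intros deriv)
      then show "\<exists>y. ((\<lambda>z. p (x + z *\<^sub>R G x) - m\<^sup>2 / 2 * z) has_real_derivative y) (at z) \<and> 0 \<le> y"
        using slope[of x z] that z by force
    qed
    then show ?thesis by (simp add: field_simps)
  qed
  show ?thesis
  proof
    \<comment> \<open>Along each segment p changes by at least this amount on either side of c, so
      every closer value c' is attained.\<close>
    show "0 < m\<^sup>2 / 2 * \<delta>" using m \<delta> by simp
  next
    fix c' assume c': "\<bar>c' - c\<bar> < m\<^sup>2 / 2 * \<delta>"
    have ex: "\<exists>\<tau>. \<bar>\<tau>\<bar> \<le> \<delta> \<and> p (x + \<tau> *\<^sub>R G x) = c'" if "x \<in> T" for x
    proof -
      have "\<exists>\<tau>\<ge>-\<delta>. \<tau> \<le> \<delta> \<and> p (x + \<tau> *\<^sub>R G x) = c'"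
      proof (rule IVT)
        show "p (x + (- \<delta>) *\<^sub>R G x) \<le> c'"
          using incr[OF that, of "- \<delta>" 0] \<delta> c[OF that] c' unfolding abs_less_iff by simp
        show "c' \<le> p (x + \<delta> *\<^sub>R G x)"
          using incr[OF that, of 0 \<delta>] \<delta> c[OF that] c' unfolding abs_less_iff by simp
        show "\<forall>\<tau>. - \<delta> \<le> \<tau> \<and> \<tau> \<le> \<delta> \<longrightarrow> isCont (\<lambda>\<tau>. p (x + \<tau> *\<^sub>R G x)) \<tau>"
          using deriv[OF that] DERIV_isCont by (metis abs_le_iff minus_le_iff)
      qed (use \<delta> in auto)
      then show ?thesis by (auto simp: abs_le_iff)
    qed
    then obtain t where t: "\<And>x. x \<in> T \<Longrightarrow> \<bar>t x\<bar> \<le> \<delta>" "\<And>x. x \<in> T \<Longrightarrow> p (x + t x *\<^sub>R G x) = c'"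
      by metis
    have uniq: "\<tau> = t x" if "x \<in> T" "\<bar>\<tau>\<bar> \<le> \<delta>" "p (x + \<tau> *\<^sub>R G x) = c'" for x \<tau>
    proof -
      have less: False if "\<bar>\<sigma>\<bar> \<le> \<delta>" "\<bar>\<rho>\<bar> \<le> \<delta>" "\<sigma> < \<rho>" "p (x + \<sigma> *\<^sub>R G x) = p (x + \<rho> *\<^sub>R G x)" for \<sigma> \<rho>
        using incr[OF \<open>x \<in> T\<close>, of \<sigma> \<rho>] that m by (auto simp: abs_le_iff mult_le_0_iff)
      show ?thesis
        using less[of \<tau> "t x"] less[of "t x" \<tau>] t that by fastforce
    qed
    have "continuous_on T t"
    \<comment> \<open>Uniqueness of the parameter identifies the graph of t with a closed set cut
      out by an equation, and the parameters lie in a compact interval.\<close>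
    proof (rule continuous_from_closed_graph[of "{- \<delta>..\<delta>}"])
      have contp: "continuous_on W p"
        using p has_derivative_continuous by (intro continuous_at_imp_continuous_on) blast
      have "continuous_on (T \<times> {- \<delta>..\<delta>}) (\<lambda>z. p (fst z + snd z *\<^sub>R G (fst z)))"
      proof (rule continuous_on_compose2[OF contp])
        show "continuous_on (T \<times> {- \<delta>..\<delta>}) (\<lambda>z. fst z + snd z *\<^sub>R G (fst z))"
          by (intro continuous_intros continuous_on_compose2[OF GT]) auto
      qed (use inK KW in \<open>fastforce simp: abs_le_iff\<close>)
      then have "closed ((T \<times> {- \<delta>..\<delta>}) \<inter> (\<lambda>z. p (fst z + snd z *\<^sub>R G (fst z))) -` {c'})"
        using T(1) by (intro continuous_closed_preimage) (auto intro: closed_Times compact_imp_closed)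
      moreover have "(\<lambda>x. (x, t x)) ` T = (T \<times> {- \<delta>..\<delta>}) \<inter> (\<lambda>z. p (fst z + snd z *\<^sub>R G (fst z))) -` {c'}"
      proof (intro subset_antisym subsetI)
        fix z assume "z \<in> (\<lambda>x. (x, t x)) ` T"
        then obtain x where "x \<in> T" "z = (x, t x)" by blast
        then show "z \<in> (T \<times> {- \<delta>..\<delta>}) \<inter> (\<lambda>z. p (fst z + snd z *\<^sub>R G (fst z))) -` {c'}"
          using t(1)[of x] t(2)[of x] by (simp add: abs_le_iff)
      next
        fix z assume z: "z \<in> (T \<times> {- \<delta>..\<delta>}) \<inter> (\<lambda>z. p (fst z + snd z *\<^sub>R G (fst z))) -` {c'}"
        then have "snd z = t (fst z)"
          by (intro uniq) (auto simp: abs_le_iff)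
        then show "z \<in> (\<lambda>x. (x, t x)) ` T"
          using z by (intro image_eqI[of _ _ "fst z"]) (auto simp: prod_eq_iff)
      qed
      ultimately show "closed ((\<lambda>x. Pair x (t x)) ` T)" by simp
    qed (use t(1) in \<open>auto simp: abs_le_iff minus_le_iff\<close>)
    moreover have "x + (s * t x) *\<^sub>R G x \<in> W" if "x \<in> T" "s \<in> {0..1}" for x s
    proof -
      have "\<bar>s * t x\<bar> \<le> \<delta>"
        using that t(1)[OF that(1)] mult_mono[of "\<bar>s\<bar>" 1 "\<bar>t x\<bar>" \<delta>] by (simp add: abs_mult)
      then show ?thesis using inK[OF that(1)] KW by blast
    qed
    ultimately show "\<exists>t. continuous_on T t \<and>
      (\<forall>x\<in>T. p (x + t x *\<^sub>R G x) = c' \<and> (\<forall>s\<in>{0..1}. x + (s * t x) *\<^sub>R G x \<in> W))"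
      using t(2) by blast
  qed
qed

text \<open>The logarithm on T pulls back along the final map of the homotopy. To have a logarithm
  is to be null-homotopic in the punctured plane, and this passes to \<open>planar\<close> along the
  homotopy because it avoids the axis.\<close>

lemma has_log_homotopy:
  assumes h: "continuous_on ({0..1::real} \<times> S) h" "h ` ({0..1} \<times> S) \<subseteq> - z_axis"
    and h0: "\<And>x. x \<in> S \<Longrightarrow> h (0, x) = x" and h1: "\<And>x. x \<in> S \<Longrightarrow> h (1, x) \<in> T"
    and T: "has_log T"
  shows "has_log S"
proof -
  obtain g where g: "continuous_on T g" "\<And>x. x \<in> T \<Longrightarrow> planar x = exp (g x)"
    using T unfolding has_log_def by blast
  have "continuous_on S (\<lambda>x. h (1, x))"
    by (rule continuous_on_compose2[OF h(1)]) (auto intro!: continuous_intros)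
  then have "continuous_on S (\<lambda>x. g (h (1, x)))"
    by (rule continuous_on_compose2[OF g(1)]) (use h1 in auto)
  then have "\<exists>g. continuous_on S g \<and> (\<forall>x\<in>S. planar (h (1, x)) = exp (g x))"
    using g(2) h1 by blast
  then obtain a where a: "homotopic_with_canon (\<lambda>h. True) S (- {0}) (\<lambda>x. planar (h (1, x))) (\<lambda>t. a)"
    using inessential_eq_continuous_logarithm[of S "\<lambda>x. planar (h (1, x))"] by blast
  have "continuous_on ({0..1} \<times> S) (\<lambda>z. planar (h z))"
    using h(1) by (intro continuous_intros)
  moreover have "planar (h z) \<noteq> 0" if "z \<in> {0..1} \<times> S" for z
    using h(2) z_axis_iff that by blast
  ultimately have "continuous_map (prod_topology (top_of_set {0..1}) (top_of_set S)) (top_of_set (- {0})) (\<lambda>z. planar (h z))"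
    unfolding subtopology_Times[symmetric] euclidean_product_topology continuous_map_in_subtopology
    by auto
  then have "homotopic_with_canon (\<lambda>h. True) S (- {0}) planar (\<lambda>x. planar (h (1, x)))"
    using h0 by (subst homotopic_with) (auto intro!: exI[of _ "\<lambda>z. planar (h z)"])
  from homotopic_with_trans[OF this a] show ?thesis
    unfolding has_log_iff_inessential by blast
qed

text \<open>Here \<open>V\<close> is the inner part of the solid torus, containing its core circle, and \<open>U\<close> the outer
  part, containing a longitude of the boundary.  Replacing \<open>planar\<close> on \<open>U\<close> by the exponential of an
  extension of the logarithm on \<open>V \<inter> U\<close> does not change the winding number of the core.\<close>

lemma has_log_solid_torus:
  fixes D :: "(real^2) \<times> (real^2) \<Rightarrow> real^3"
  assumes D: "homeomorphism (sphere 0 1 \<times> cball 0 1) M D D'"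
    and M: "M \<inter> z_axis = {}" "M = V \<union> U" "closed V" "closed U"
    and log: "has_log (V \<inter> U)"
    and core: "\<And>s. s \<in> sphere 0 1 \<Longrightarrow> D (s, 0) \<in> V"
    and e: "norm e = 1" and longitude: "\<And>s. s \<in> sphere 0 1 \<Longrightarrow> D (s, e) \<in> U"
  shows "has_log M"
proof -
  let ?X = "sphere (0::real^2) 1 \<times> cball (0::real^2) 1"
  have contD: "continuous_on ?X D" and DM: "D ` ?X = M"
    using D unfolding homeomorphism_def by auto
  obtain g where g: "continuous_on (V \<inter> U) g" "\<And>x. x \<in> V \<inter> U \<Longrightarrow> planar x = exp (g x)"
    using log unfolding has_log_def by blast
  obtain g' where g': "continuous_on UNIV g'" "\<And>x. x \<in> V \<inter> U \<Longrightarrow> g' x = g x"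
    using Tietze_unbounded[OF g(1), of UNIV] M by auto
  define \<phi> where "\<phi> x = (if x \<in> V then planar x else exp (g' x))" for x
  have \<phi>U: "\<phi> x = exp (g' x)" if "x \<in> U" for x
    using that g g' by (auto simp: \<phi>_def)
  have cont\<phi>: "continuous_on M \<phi>"
    unfolding M(2)
  proof (rule continuous_on_closed_Un[OF M(3,4)])
    show "continuous_on V \<phi>"
      by (subst continuous_on_cong[OF refl, of _ _ planar]) (auto simp: \<phi>_def intro!: continuous_intros)
    show "continuous_on U \<phi>"
      by (subst continuous_on_cong[OF refl, of _ _ "\<lambda>x. exp (g' x)"])
        (auto simp: \<phi>U intro!: continuous_intros continuous_on_subset[OF g'(1)])
  qed
  have \<phi>0: "\<phi> x \<noteq> 0" if "x \<in> M" for x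
    using that M(1) by (auto simp: \<phi>_def z_axis_iff)
  \<comment> \<open>The disk factor can be contracted to any of its points y, so a nowhere zero
    function on M is determined up to homotopy by its values on the circle over y.\<close>
  have hom: "homotopic_with_canon (\<lambda>h. True) ?X (- {0}) (k \<circ> D) (\<lambda>z. k (D (fst z, y)))"
    if k: "continuous_on M k" "\<And>x. x \<in> M \<Longrightarrow> k x \<noteq> 0" and y: "y \<in> cball 0 1" for k :: "real^3 \<Rightarrow> complex" and y
  proof -
    have "homotopic_with_canon (\<lambda>h. True) ?X ?X (\<lambda>z. z) (\<lambda>z. (fst z, y))"
    proof (rule homotopic_with_linear)
      show "closed_segment z (fst z, y) \<subseteq> ?X" if "z \<in> ?X" for z
      proof
        fix w assume "w \<in> closed_segment z (fst z, y)"
        then obtain u where u: "0 \<le> u" "u \<le> 1" "w = (1 - u) *\<^sub>R z + u *\<^sub>R (fst z, y)"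
          unfolding closed_segment_def by blast
        then have "fst w = (1 - u) *\<^sub>R fst z + u *\<^sub>R fst z" by simp
        then have "fst w = fst z" by (simp flip: scaleR_add_left)
        moreover have "snd w \<in> closed_segment (snd z) y"
          using u by (auto simp: closed_segment_def)
        then have "snd w \<in> cball 0 1"
          using that y closed_segment_subset[of "snd z" "cball 0 1" y] by (auto simp: mem_Times_iff)
        ultimately show "w \<in> ?X" using that by (auto simp: mem_Times_iff)
      qed
    qed (auto intro!: continuous_intros)
    moreover have "continuous_map (top_of_set ?X) (top_of_set (- {0})) (k \<circ> D)"
      using k DM continuous_on_compose2[OF k(1) contD]
      by (auto simp: continuous_map_in_subtopology o_def)
    ultimately show ?thesis
      using homotopic_with_compose_continuous_map_left[of _ "top_of_set ?X" "top_of_set ?X"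
          "\<lambda>z. z" "\<lambda>z. (fst z, y)" "top_of_set (- {0})" "k \<circ> D" "\<lambda>h. True"] by (simp add: o_def)
  qed
  have planar0: "planar x \<noteq> 0" if "x \<in> M" for x
    using that M(1) by (auto simp: z_axis_iff)
  have contp: "continuous_on M planar" by (intro continuous_intros)
  \<comment> \<open>Chain of homotopies: \<open>planar\<close> is moved to the core, where it equals
    \<phi>, and \<phi> is moved on to the longitude, where it is an exponential and hence
    null-homotopic.\<close>
  have "homotopic_with_canon (\<lambda>h. True) ?X (- {0}) (planar \<circ> D) (\<lambda>z. planar (D (fst z, 0)))"
    using hom[OF contp planar0] by simp
  moreover have "homotopic_with_canon (\<lambda>h. True) ?X (- {0}) (\<lambda>z. planar (D (fst z, 0))) (\<phi> \<circ> D)"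
  proof (rule homotopic_with_symD, rule homotopic_with_eq[OF hom[OF cont\<phi> \<phi>0, of 0]])
    show "planar (D (fst x, 0)) = \<phi> (D (fst x, 0))" if "x \<in> topspace (top_of_set ?X)" for x
      using core that by (auto simp: \<phi>_def)
  qed auto
  moreover have "homotopic_with_canon (\<lambda>h. True) ?X (- {0}) (\<phi> \<circ> D) (\<lambda>z. \<phi> (D (fst z, e)))"
    using hom[OF cont\<phi> \<phi>0, of e] e by simp
  moreover have "\<exists>a. homotopic_with_canon (\<lambda>h. True) ?X (- {0}) (\<lambda>z. \<phi> (D (fst z, e))) (\<lambda>t. a)"
  proof (subst inessential_eq_continuous_logarithm, intro exI conjI ballI)
    show "continuous_on ?X (\<lambda>z. g' (D (fst z, e)))"
      by (intro continuous_on_compose2[OF g'(1)] continuous_on_compose2[OF contD] continuous_intros)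
        (use e in auto)
    show "\<phi> (D (fst z, e)) = exp (g' (D (fst z, e)))" if "z \<in> ?X" for z
      using that longitude[of "fst z"] by (intro \<phi>U) auto
  qed
  ultimately have "\<exists>a. homotopic_with_canon (\<lambda>h. True) ?X (- {0}) (planar \<circ> D) (\<lambda>t. a)"
    by (meson homotopic_with_trans)
  then obtain l where l: "continuous_on ?X l" "\<And>z. z \<in> ?X \<Longrightarrow> planar (D z) = exp (l z)"
    unfolding inessential_eq_continuous_logarithm by auto
  have D': "continuous_on M D'" "D' ` M \<subseteq> ?X" "\<And>x. x \<in> M \<Longrightarrow> D (D' x) = x"
    using D unfolding homeomorphism_def by auto
  have "continuous_on M (\<lambda>x. l (D' x))"
    using continuous_on_compose2[OF l(1) D'(1,2)] .
  moreover have "planar x = exp (l (D' x))" if "x \<in> M" for x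
    using l(2)[of "D' x"] D' that by force
  ultimately show ?thesis
    unfolding has_log_def by blast
qed

section \<open>Regular domains\<close>

lemma half_space_chartE:
  assumes "half_space_chart M U \<phi>"
  obtains V \<psi> where "open U" "open V" "\<phi> ` U = V" "\<psi> ` V = U"
    "\<And>x. x \<in> U \<Longrightarrow> \<psi> (\<phi> x) = x" "\<And>y. y \<in> V \<Longrightarrow> \<phi> (\<psi> y) = y"
    "\<phi> ` (U \<inter> M) = V \<inter> {y. 0 \<le> y $ 3}" "\<And>k. Ck_on k U \<phi>" "\<And>k. Ck_on k V \<psi>"
proof -
  obtain V \<psi> where *: "open U" "open V" "diffeomorphism U V \<phi> \<psi>" "\<phi> ` (U \<inter> M) = V \<inter> {y. 0 \<le> y $ 3}"
    using assms unfolding half_space_chart_def by blast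
  have "Ck_on k U \<phi>" "Ck_on k V \<psi>" for k
    using smooth_on_interior_Ck[of U \<phi> k] smooth_on_interior_Ck[of V \<psi> k]
      interior_open[OF *(1)] interior_open[OF *(2)] *(3)
    unfolding diffeomorphism_def by simp_all
  with * show ?thesis
    using that[of V \<psi>] unfolding diffeomorphism_def by blast
qed

lemma chart_pos_interior:
  assumes chart: "half_space_chart M U \<phi>" and x: "x \<in> U" "0 < \<phi> x $ 3"
  shows "x \<in> interior M"
proof -
  obtain V \<psi> where c: "open U" "open V" "\<phi> ` U = V" "\<psi> ` V = U" "\<And>x. x \<in> U \<Longrightarrow> \<psi> (\<phi> x) = x"
    "\<And>y. y \<in> V \<Longrightarrow> \<phi> (\<psi> y) = y" "\<phi> ` (U \<inter> M) = V \<inter> {y. 0 \<le> y $ 3}"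
    "\<And>k. Ck_on k U \<phi>" "\<And>k. Ck_on k V \<psi>"
    by (fact half_space_chartE[OF chart])
  define W where "W = U \<inter> \<phi> -` {y. 0 < y $ 3}"
  have "open W"
    unfolding W_def using c(1) Ck_on_continuous[OF c(8)]
    by (intro continuous_open_preimage) (auto intro!: open_Collect_less continuous_intros)
  moreover have "W \<subseteq> M"
  proof
    fix z assume z: "z \<in> W"
    then have "\<phi> z \<in> \<phi> ` (U \<inter> M)" unfolding c(7) using c(3) by (auto simp: W_def)
    then obtain w where "w \<in> U" "w \<in> M" "\<phi> z = \<phi> w" by blast
    then show "z \<in> M" using c(5)[of z] c(5)[of w] z by (auto simp: W_def)
  qed
  ultimately show ?thesis
    using x by (intro interiorI[of W]) (auto simp: W_def)
qed

text \<open>A small step from the bounding plane to its negative side would stay in the chart image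
  of the interior, yet points of M have nonnegative third coordinate.\<close>

lemma chart_zero_not_interior:
  assumes chart: "half_space_chart M U \<phi>" and x: "x \<in> U" "\<phi> x $ 3 = 0"
  shows "x \<notin> interior M"
proof
  assume xM: "x \<in> interior M"
  obtain V \<psi> where c: "open U" "open V" "\<phi> ` U = V" "\<psi> ` V = U" "\<And>x. x \<in> U \<Longrightarrow> \<psi> (\<phi> x) = x"
    "\<And>y. y \<in> V \<Longrightarrow> \<phi> (\<psi> y) = y" "\<phi> ` (U \<inter> M) = V \<inter> {y. 0 \<le> y $ 3}"
    "\<And>k. Ck_on k U \<phi>" "\<And>k. Ck_on k V \<psi>"
    by (fact half_space_chartE[OF chart])
  define W where "W = V \<inter> \<psi> -` interior M"
  have "open W"
    unfolding W_def using c(2) Ck_on_continuous[OF c(9)] by (intro continuous_open_preimage) auto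
  moreover have "\<phi> x \<in> W"
    using xM x c by (auto simp: W_def)
  ultimately obtain e where e: "0 < e" "cball (\<phi> x) e \<subseteq> W"
    using open_contains_cball by blast
  define y where "y = \<phi> x - e *\<^sub>R axis 3 1"
  have "y \<in> cball (\<phi> x) e"
    using e(1) by (simp add: y_def dist_norm)
  then have "y \<in> W"
    using e(2) by blast
  then have y: "y \<in> V" "\<psi> y \<in> M"
    using interior_subset[of M] by (auto simp: W_def)
  then have "\<phi> (\<psi> y) \<in> \<phi> ` (U \<inter> M)"
    using c(4) by blast
  then have "0 \<le> y $ 3"
    unfolding c(7) using c(6)[OF y(1)] by simp
  then show False
    using e(1) x(2) by (simp add: y_def)
qed

text \<open>The sign of the third chart coordinate decides. With the boundary identified
  topologically, later arguments can speak of \<open>interior M\<close> instead of charts.\<close>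

lemma manifold_boundary_eq:
  assumes "regular_domain M"
  shows "manifold_boundary M = M - interior M"
proof (intro subset_antisym subsetI)
  fix x assume "x \<in> manifold_boundary M"
  then show "x \<in> M - interior M"
    using chart_zero_not_interior by (auto simp: manifold_boundary_def)
next
  fix x assume x: "x \<in> M - interior M"
  then obtain U \<phi> where U: "x \<in> U" "half_space_chart M U \<phi>"
    using assms unfolding regular_domain_def by blast
  obtain V \<psi> where c: "open U" "open V" "\<phi> ` U = V" "\<psi> ` V = U" "\<And>x. x \<in> U \<Longrightarrow> \<psi> (\<phi> x) = x"
    "\<And>y. y \<in> V \<Longrightarrow> \<phi> (\<psi> y) = y" "\<phi> ` (U \<inter> M) = V \<inter> {y. 0 \<le> y $ 3}"
    "\<And>k. Ck_on k U \<phi>" "\<And>k. Ck_on k V \<psi>"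
    by (fact half_space_chartE[OF U(2)])
  have "\<phi> x \<in> {y. 0 \<le> y $ 3}"
    using c(7) x U(1) by blast
  moreover have "\<not> 0 < \<phi> x $ 3"
    using chart_pos_interior[OF U(2,1)] x by blast
  ultimately show "x \<in> manifold_boundary M"
    using U x unfolding manifold_boundary_def by force
qed

text \<open>In a chart the question moves to the half-space, where every basis direction can be
  followed by positive steps, and this fixes a derivative. It ensures that
  \<open>frechet_derivative\<close> within M has the expected value at boundary points too.\<close>

lemma has_derivative_within_regular_domain_unique:
  fixes f :: "real^3 \<Rightarrow> 'b::real_normed_vector"
  assumes M: "regular_domain M" "x \<in> M"
    and A: "(f has_derivative A) (at x within M)" and B: "(f has_derivative B) (at x within M)"
  shows "A = B"
proof -
  obtain U \<phi> where U: "x \<in> U" "half_space_chart M U \<phi>"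
    using M unfolding regular_domain_def by blast
  obtain V \<psi> where c: "open U" "open V" "\<phi> ` U = V" "\<psi> ` V = U" "\<And>x. x \<in> U \<Longrightarrow> \<psi> (\<phi> x) = x"
    "\<And>y. y \<in> V \<Longrightarrow> \<phi> (\<psi> y) = y" "\<phi> ` (U \<inter> M) = V \<inter> {y. 0 \<le> y $ 3}"
    "\<And>k. Ck_on k U \<phi>" "\<And>k. Ck_on k V \<psi>"
    by (fact half_space_chartE[OF U(2)])
  define y where "y = \<phi> x"
  define H where "H = V \<inter> {y. 0 \<le> y $ 3}"
  have y: "y \<in> V" "\<psi> y = x" "0 \<le> y $ 3" using c U(1) M(2) by (auto simp: y_def)
  obtain P where P: "(\<psi> has_derivative P) (at y)"
    using c(9)[of 1] y by (auto simp: differentiable_def)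
  obtain Q where Q: "(\<phi> has_derivative Q) (at x)"
    using c(8)[of 1] U(1) by (auto simp: differentiable_def)
  have "((\<lambda>z. \<psi> (\<phi> z)) has_derivative (\<lambda>v. P (Q v))) (at x)"
    using has_derivative_compose[OF Q] P unfolding y_def by blast
  then have "((\<lambda>z. z) has_derivative (\<lambda>v. P (Q v))) (at x)"
    by (rule has_derivative_transform_within_open[OF _ c(1) U(1)]) (simp add: c(5))
  then have PQ: "P (Q v) = v" for v
    using has_derivative_unique[OF has_derivative_ident] by metis
  have D: "((\<lambda>z. 0) has_derivative (\<lambda>v. A v - B v)) (at x within M)"
    using has_derivative_diff[OF A B] by simp
  have "\<psi> ` H \<subseteq> M"
    unfolding H_def c(7)[symmetric] using c(5) by auto
  then have "((\<lambda>z. 0) has_derivative (\<lambda>v. A v - B v)) (at (\<psi> y) within \<psi> ` H)"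
    using has_derivative_subset[OF D] y(2) by simp
  from has_derivative_in_compose[OF has_derivative_at_withinI[OF P] this]
  have 1: "((\<lambda>z. 0) has_derivative (\<lambda>v. A (P v) - B (P v))) (at y within H)" .
  have "(\<lambda>v. A (P v) - B (P v)) = (\<lambda>v. 0)"
  proof (rule frechet_derivative_unique_within[OF 1 has_derivative_const])
    fix i :: "real^3" and e :: real
    assume i: "i \<in> Basis" and e: "0 < e"
    obtain r where r: "0 < r" "cball y r \<subseteq> V"
      using open_contains_cball c(2) y(1) by blast
    define d where "d = min r (e / 2)"
    have "d > 0" "d < e" using r e by (auto simp: d_def)
    moreover have "y + d *\<^sub>R i \<in> H"
    proof -
      have "y + d *\<^sub>R i \<in> cball y r"
        using i \<open>d > 0\<close> by (simp add: dist_norm d_def)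
      moreover have "0 \<le> (d *\<^sub>R i) $ 3"
        using i \<open>d > 0\<close> by (auto simp: Basis_vec_def axis_def)
      ultimately show ?thesis
        using r(2) y(3) by (auto simp: H_def)
    qed
    ultimately show "\<exists>d. 0 < \<bar>d\<bar> \<and> \<bar>d\<bar> < e \<and> y + d *\<^sub>R i \<in> H"
      by (intro exI[of _ d]) auto
  qed
  then show ?thesis
    using PQ by (auto simp: fun_eq_iff) (metis right_minus_eq)
qed

section \<open>The solid torus and its nested level sets\<close>

definition circ :: "real \<Rightarrow> real^2" where
  "circ t = vector [cos t, sin t]"

lemma circ_nth [simp]: "circ t $ 1 = cos t" "circ t $ 2 = sin t"
  by (simp_all add: circ_def)

lemma circ_in_sphere [simp]: "circ t \<in> sphere 0 1" "norm (circ t) = 1"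
  by (simp_all add: norm_eq_1 inner_vec_def sum_2 power2_eq_square[symmetric])

lemma sphere_circ: "s \<in> sphere (0::real^2) 1 \<Longrightarrow> \<exists>t. s = circ t"
proof -
  assume "s \<in> sphere (0::real^2) 1"
  then have "(s $ 1)\<^sup>2 + (s $ 2)\<^sup>2 = 1"
    by (simp add: norm_eq_1 inner_vec_def sum_2 power2_eq_square)
  then obtain t where "s $ 1 = cos t" "s $ 2 = sin t"
    using sincos_total_2pi by metis
  then show ?thesis
    by (auto simp: vec_eq_iff forall_2)
qed

lemma circ_eq_iff: "circ s = circ t \<longleftrightarrow> (\<exists>n::int. s = t + 2 * pi * of_int n)"
proof -
  have "circ s = circ t \<longleftrightarrow> sin s = sin t \<and> cos s = cos t"
    by (auto simp: vec_eq_iff forall_2)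
  then show ?thesis
    by (simp add: sin_cos_eq_iff)
qed

lemma continuous_on_circ [continuous_intros]:
  fixes f :: "'a::t2_space \<Rightarrow> real"
  assumes "continuous_on S f"
  shows "continuous_on S (\<lambda>x. circ (f x))"
proof -
  have eq: "circ t = cos t *\<^sub>R axis 1 1 + sin t *\<^sub>R axis 2 1" for t
    by (auto simp: vec_eq_iff forall_2 axis_def)
  show ?thesis
    unfolding eq by (intro continuous_intros assms)
qed

locale solid =
  fixes M :: "(real^3) set" and D :: "(real^2) \<times> (real^2) \<Rightarrow> real^3" and D' :: "real^3 \<Rightarrow> (real^2) \<times> (real^2)"
  assumes regular: "regular_domain M"
    and diffeo: "diffeomorphism (sphere 0 1 \<times> cball 0 1) M D D'"
begin

lemma homeo: "homeomorphism (sphere 0 1 \<times> cball 0 1) M D D'"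
  using diffeo unfolding diffeomorphism_def homeomorphism_def by (simp add: smooth_on_continuous)

lemma contD: "continuous_on (sphere 0 1 \<times> cball 0 1) D" and contD': "continuous_on M D'"
  and imageD: "D ` (sphere 0 1 \<times> cball 0 1) = M" and imageD': "D' ` M = sphere 0 1 \<times> cball 0 1"
  and D'D: "\<And>z. z \<in> sphere 0 1 \<times> cball 0 1 \<Longrightarrow> D' (D z) = z" and DD': "\<And>x. x \<in> M \<Longrightarrow> D (D' x) = x"
  using homeo unfolding homeomorphism_def by auto

lemma compactM: "compact M"
  unfolding imageD[symmetric] by (intro compact_continuous_image[OF contD] compact_Times) auto

lemma closedM: "closed M"
  using compactM by (rule compact_imp_closed)

lemma connectedM: "connected M"
  unfolding imageD[symmetric]
  by (intro connected_continuous_image[OF contD] connected_Times connected_sphere convex_connected) auto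

text \<open>On an angular window of length 2 pi the map (t, y) -> D (circ t, y) is injective and
  continuous from an open set of dimension 3 into space, so by invariance of domain its image is
  open.\<close>

lemma core_interior:
  assumes s: "s \<in> sphere 0 1" and y: "norm y < 1"
  shows "D (s, y) \<in> interior M"
proof -
  obtain t where t: "s = circ t" using sphere_circ[OF s] by blast
  define W where "W = {t - pi <..< t + pi} \<times> ball (0::real^2) 1"
  define E where "E z = D (circ (fst z), snd z)" for z
  have "open W" by (auto simp: W_def intro: open_Times)
  have "continuous_on W E"
    unfolding E_def
    by (rule continuous_on_compose2[OF contD]) (auto intro!: continuous_intros simp: W_def)
  moreover have "inj_on E W"
  proof (rule inj_onI)
    fix z w assume z: "z \<in> W" "w \<in> W" "E z = E w"
    then have X: "(circ (fst z), snd z) \<in> sphere 0 1 \<times> cball 0 1"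
      "(circ (fst w), snd w) \<in> sphere 0 1 \<times> cball 0 1"
      by (auto simp: W_def)
    have "(circ (fst z), snd z) = (circ (fst w), snd w)"
      using D'D[OF X(1)] D'D[OF X(2)] z(3) unfolding E_def by metis
    then have eq: "circ (fst z) = circ (fst w)" "snd z = snd w" by simp_all
    then obtain n :: int where n: "fst z = fst w + 2 * pi * of_int n"
      unfolding circ_eq_iff by blast
    have "\<bar>fst z - fst w\<bar> < 2 * pi"
      using z(1,2) by (auto simp: W_def)
    then have "2 * pi * \<bar>real_of_int n\<bar> < 2 * pi * 1"
      using n by (simp add: abs_mult)
    then have "\<bar>real_of_int n\<bar> < 1"
      using mult_less_cancel_left_pos[of "2 * pi"] by simp
    then have "n = 0" by linarith
    then show "z = w"
      using n eq(2) by (simp add: prod_eq_iff)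
  qed
  ultimately have "open (E ` W)"
    using \<open>open W\<close> by (intro invariance_of_domain_gen) auto
  moreover have "E ` W \<subseteq> M"
    unfolding imageD[symmetric] by (auto simp: E_def W_def)
  moreover have "D (s, y) \<in> E ` W"
    using y t by (intro image_eqI[of _ _ "(t, y)"]) (auto simp: E_def W_def)
  ultimately show ?thesis
    by (meson interiorI)
qed

text \<open>The model solid torus is embedded in \<open>\<real>\<^sup>3\<close> so that invariance of domain applies to \<open>D'\<close>.\<close>

lemma longitude_not_interior:
  assumes s: "s \<in> sphere 0 1" and e: "norm e = 1"
  shows "D (s, e) \<notin> interior M"
proof
  assume int: "D (s, e) \<in> interior M"
  \<comment> \<open>A solid torus of revolution: y moves in the half-plane spanned by s and the
    vertical. The offset 2 keeps the radius positive, so that s can be recovered.\<close>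
  define j :: "(real^2) \<times> (real^2) \<Rightarrow> (real^2) \<times> real" where
    "j z = ((2 + snd z $ 1) *\<^sub>R fst z, snd z $ 2)" for z
  have y1: "\<bar>snd z $ 1\<bar> \<le> 1" if "z \<in> sphere 0 1 \<times> cball 0 1" for z :: "(real^2) \<times> (real^2)"
    using that component_le_norm_cart[of "snd z" 1] by (auto simp: mem_Times_iff)
  have j_inj: "snd z = y" "fst z = s'"
    if "z \<in> sphere 0 1 \<times> cball 0 1" "norm s' = 1" "0 \<le> 2 + y $ 1" "j z = ((2 + y $ 1) *\<^sub>R s', y $ 2)" for z s' y
  proof -
    have 1: "(2 + snd z $ 1) *\<^sub>R fst z = (2 + y $ 1) *\<^sub>R s'" "snd z $ 2 = y $ 2"
      using that(4) by (auto simp: j_def)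
    have "norm (fst z) = 1" using that(1) by (auto simp: mem_Times_iff)
    have "norm ((2 + snd z $ 1) *\<^sub>R fst z) = norm ((2 + y $ 1) *\<^sub>R s')" using 1 by simp
    then have 2: "snd z $ 1 = y $ 1"
      using y1[OF that(1)] that(2,3) \<open>norm (fst z) = 1\<close> by simp
    then show "snd z = y" using 1(2) by (simp add: vec_eq_iff forall_2)
    show "fst z = s'" using 1(1) 2 y1[OF that(1)] by auto
  qed
  have cont: "continuous_on (interior M) (\<lambda>x. j (D' x))"
    unfolding j_def using continuous_on_subset[OF contD' interior_subset]
    by (intro continuous_intros)
  moreover have "inj_on (\<lambda>x. j (D' x)) (interior M)"
  proof (rule inj_onI)
    fix x w assume x: "x \<in> interior M" "w \<in> interior M" "j (D' x) = j (D' w)"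
    then have M: "x \<in> M" "w \<in> M" using interior_subset by auto
    then have X: "D' x \<in> sphere 0 1 \<times> cball 0 1" "D' w \<in> sphere 0 1 \<times> cball 0 1"
      using imageD' by auto
    have "D' x = D' w"
      using j_inj[OF X(1), of "fst (D' w)" "snd (D' w)"] X(2) y1[OF X(2)] x(3)
      by (auto simp: j_def prod_eq_iff mem_Times_iff)
    then show "x = w" using DD' M by metis
  qed
  ultimately have "open ((\<lambda>x. j (D' x)) ` interior M)"
    by (intro invariance_of_domain_gen) auto
  moreover have se: "(s, e) \<in> sphere 0 1 \<times> cball 0 1" using s e by auto
  have "j (s, e) \<in> (\<lambda>x. j (D' x)) ` interior M"
    using int D'D[OF se] by (intro image_eqI[of _ _ "D (s, e)"]) auto
  ultimately obtain r where r: "0 < r" "cball (j (s, e)) r \<subseteq> (\<lambda>x. j (D' x)) ` interior M"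
    using open_contains_cball by blast
  \<comment> \<open>The point with disk coordinate (1 + l) e lies outside the model. Each component
    of \<open>j\<close> moves by at most l, hence the factor 1/2; the cap 1 keeps the radius 2 + y$1
    nonnegative.\<close>
  define l where "l = min 1 (r / 2)"
  have l: "0 < l" "l \<le> 1" "l * 2 \<le> r" using r(1) by (auto simp: l_def)
  define y where "y = (1 + l) *\<^sub>R e"
  have e1: "\<bar>e $ 1\<bar> \<le> 1" "\<bar>e $ 2\<bar> \<le> 1" using component_le_norm_cart[of e] e by metis+
  have "dist (j (s, e)) ((2 + y $ 1) *\<^sub>R s, y $ 2) \<le> r"
  proof -
    have "j (s, e) - ((2 + y $ 1) *\<^sub>R s, y $ 2) = ((- (l * e $ 1)) *\<^sub>R s, - (l * e $ 2))"
      by (simp add: j_def y_def algebra_simps)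
    then have "dist (j (s, e)) ((2 + y $ 1) *\<^sub>R s, y $ 2) \<le> \<bar>l * e $ 1\<bar> * norm s + \<bar>l * e $ 2\<bar>"
      using norm_Pair_le[of "(- (l * e $ 1)) *\<^sub>R s" "- (l * e $ 2)"] by (simp add: dist_norm)
    also have "\<dots> \<le> l * 1 + l * 1"
      using e1 l s by (intro add_mono) (auto simp: abs_mult intro!: mult_left_le)
    finally show ?thesis using l by simp
  qed
  then obtain x where x: "x \<in> interior M" "j (D' x) = ((2 + y $ 1) *\<^sub>R s, y $ 2)"
    using r(2) by (auto simp: subset_iff image_iff) metis
  have "x \<in> M" using x(1) interior_subset by auto
  then have X: "D' x \<in> sphere 0 1 \<times> cball 0 1" using imageD' by auto
  have "\<bar>(1 + l) * e $ 1\<bar> \<le> 2 * 1"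
    unfolding abs_mult using l e1 by (intro mult_mono) auto
  then have "0 \<le> 2 + y $ 1" by (auto simp: y_def abs_le_iff)
  then have "snd (D' x) = y"
    using j_inj(1)[OF X _ _ x(2)] s by simp
  then have "norm y \<le> 1"
    using X by (auto simp: mem_Times_iff)
  then show False
    using l e by (simp add: y_def)
qed

lemma interior_eq: "interior M = D ` (sphere 0 1 \<times> ball 0 1)"
proof (intro subset_antisym subsetI)
  fix x assume x: "x \<in> interior M"
  then have "x \<in> M" using interior_subset by auto
  then have X: "D' x \<in> sphere 0 1 \<times> cball 0 1" "D (D' x) = x" using imageD' DD' by auto
  then have "norm (snd (D' x)) \<noteq> 1"
    using longitude_not_interior[of "fst (D' x)" "snd (D' x)"] x by (auto simp: mem_Times_iff)
  then show "x \<in> D ` (sphere 0 1 \<times> ball 0 1)"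
    using X by (intro image_eqI[of _ _ "D' x"]) (auto simp: mem_Times_iff)
qed (auto intro: core_interior)

lemma connected_interior: "connected (interior M)"
  unfolding interior_eq
  by (intro connected_continuous_image continuous_on_subset[OF contD] connected_Times connected_sphere
      convex_connected) auto

lemma closure_interior: "closure (interior M) = M"
proof
  show "closure (interior M) \<subseteq> M"
    by (intro closure_minimal interior_subset closedM)
  have "sphere 0 1 \<times> cball 0 1 = closure (sphere (0::real^2) 1 \<times> ball (0::real^2) 1)"
    by (simp add: closure_Times)
  then have "D ` (sphere 0 1 \<times> cball 0 1) \<subseteq> closure (D ` (sphere 0 1 \<times> ball 0 1))"
    using image_closure_subset[of "sphere 0 1 \<times> ball 0 1" D "closure (D ` (sphere 0 1 \<times> ball 0 1))"]
      contD closure_subset by (metis closed_closure)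
  then show "M \<subseteq> closure (interior M)"
    unfolding imageD interior_eq .
qed

lemma boundary_eq: "manifold_boundary M = M - interior M"
  by (rule manifold_boundary_eq[OF regular])

lemma manifold_interior_eq: "manifold_interior M = interior M"
  using interior_subset unfolding manifold_interior_def boundary_eq by blast

lemma boundary_nonempty: "manifold_boundary M \<noteq> {}"
proof -
  have "D (circ 0, circ 0) \<in> M - interior M"
    using longitude_not_interior[of "circ 0" "circ 0"] imageD by auto
  then show ?thesis unfolding boundary_eq by blast
qed

lemma interior_nonempty: "interior M \<noteq> {}"
  using core_interior[of "circ 0" 0] by auto

end

section \<open>Gradients at interior points\<close>

lemma grad_nth:
  "x \<in> interior M \<Longrightarrow> grad M p x $ i = frechet_derivative p (at x) (axis i 1)"
  by (simp add: grad_def partial_deriv_def at_within_interior[of x M])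

lemma grad_has_derivative:
  assumes p: "smooth_on M p" and x: "x \<in> interior M"
  shows "(p has_derivative (\<lambda>v. grad M p x \<bullet> v)) (at x)"
proof -
  have d: "(p has_derivative frechet_derivative p (at x)) (at x)"
    using Ck_on_has_derivative[OF smooth_on_interior_Ck[OF p] x] .
  interpret d: bounded_linear "frechet_derivative p (at x)"
    using d has_derivative_bounded_linear by blast
  have "frechet_derivative p (at x) v = grad M p x \<bullet> v" for v
  proof -
    have "frechet_derivative p (at x) v = frechet_derivative p (at x) (\<Sum>i\<in>UNIV. v $ i *\<^sub>R axis i 1)"
      using basis_expansion[of v] by (simp add: scalar_mult_eq_scaleR)
    also have "\<dots> = (\<Sum>i\<in>UNIV. v $ i * frechet_derivative p (at x) (axis i 1))"
      by (simp add: d.sum d.scaleR)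
    also have "\<dots> = grad M p x \<bullet> v"
      by (simp add: grad_nth[OF x] inner_vec_def mult.commute)
    finally show ?thesis .
  qed
  then show ?thesis using d by presburger
qed

lemma grad_eqI:
  assumes p: "smooth_on M p" and x: "x \<in> interior M" and g: "(p has_derivative (\<lambda>v. g \<bullet> v)) (at x)"
  shows "grad M p x = g"
  using has_derivative_unique[OF grad_has_derivative[OF p x] g]
  by (metis inner_commute vector_eq_ldot)

lemma Ck_grad:
  assumes p: "smooth_on M p"
  shows "Ck_on k (interior M) (grad M p)"
proof -
  have "Ck_on k (interior M) (\<lambda>x. \<Sum>i\<in>UNIV. frechet_derivative p (at x) (axis i 1) *\<^sub>R (axis i 1 :: real^3))"
    using smooth_on_interior_Ck[OF p, of "Suc k"]
    by (intro Ck_on_sum Ck_on_bounded_linear[OF bounded_linear_scaleR_left]) auto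
  moreover have "(\<Sum>i\<in>UNIV. frechet_derivative p (at x) (axis i 1) *\<^sub>R (axis i 1 :: real^3)) = grad M p x"
    if "x \<in> interior M" for x
    using basis_expansion[of "grad M p x"] by (simp add: grad_nth[OF that] scalar_mult_eq_scaleR)
  ultimately show ?thesis
    using Ck_on_cong[of "interior M" _ "grad M p" k] by (metis (no_types, lifting) open_interior)
qed

lemma interior_sphere_image_empty:
  fixes f :: "real^3 \<Rightarrow> real^2"
  assumes "continuous_on S f" "inj_on f S"
  shows "interior S = {}"
proof (rule ccontr)
  assume "interior S \<noteq> {}"
  then have "DIM(real^3) \<le> DIM(real^2)"
    using continuous_on_subset[OF assms(1) interior_subset] inj_on_subset[OF assms(2) interior_subset]
    by (intro invariance_of_dimension[of "interior S" f]) auto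
  then show False by simp
qed

text \<open>\<open>no_log\<close> is the form in which surjectivity on H_1 enters: the angle around
  the axis is not single-valued on M.\<close>

locale nested = solid M D D' for M D D' +
  fixes p :: "real^3 \<Rightarrow> real" and \<gamma> :: "(real^3) set"
  assumes nested: "toroidally_nested_with_axis M p \<gamma>"
    and off_axis: "M \<inter> z_axis = {}"
    and no_log: "\<not> has_log M"
begin

lemma smooth_p: "smooth_on M p" and gamma_interior: "\<gamma> \<subseteq> interior M"
  and gamma_circle: "\<gamma> diffeomorphic (sphere (0::real^2) 1)"
  and level_cases: "\<And>c. level_set M p c \<noteq> {} \<Longrightarrow> regular_level M p c \<and>
          level_set M p c diffeomorphic (sphere (0::real^2) 1 \<times> sphere (0::real^2) 1) \<or>
        level_set M p c = \<gamma>"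
  using nested unfolding toroidally_nested_with_axis_def manifold_interior_eq by blast+

lemma contp: "continuous_on M p"
  by (rule smooth_on_continuous[OF smooth_p])

definition c\<^sub>1 :: real where
  "c\<^sub>1 = (SOME c. manifold_boundary M = level_set M p c \<and> regular_level M p c)"

lemma boundary_level: "manifold_boundary M = level_set M p c\<^sub>1"
proof -
  have "\<exists>c. manifold_boundary M = level_set M p c \<and> regular_level M p c"
    using nested unfolding toroidally_nested_with_axis_def by blast
  from someI_ex[OF this] show ?thesis unfolding c\<^sub>1_def by blast
qed

lemma p_interior: "x \<in> interior M \<Longrightarrow> p x \<noteq> c\<^sub>1"
  using boundary_level interior_subset unfolding boundary_eq level_set_def by blast

lemma p_boundary: "x \<in> M \<Longrightarrow> p x \<noteq> c\<^sub>1 \<Longrightarrow> x \<in> interior M"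
  using boundary_level unfolding boundary_eq level_set_def by blast

text \<open>Invariance of dimension. It makes the points off \<gamma> dense in the interior of
  M.\<close>

lemma interior_gamma: "interior \<gamma> = {}"
proof -
  obtain f g where "diffeomorphism \<gamma> (sphere (0::real^2) 1) f g"
    using gamma_circle unfolding diffeomorphic_def by blast
  then have "continuous_on \<gamma> f" "inj_on f \<gamma>"
    unfolding diffeomorphism_def by (auto intro: smooth_on_continuous inj_on_inverseI)
  then show ?thesis by (rule interior_sphere_image_empty)
qed

lemma critical_level:
  assumes "x \<in> interior M" "grad M p x = 0"
  shows "level_set M p (p x) = \<gamma>"
proof -
  have "x \<in> level_set M p (p x)"
    using assms(1) interior_subset by (auto simp: level_set_def)
  then show ?thesis
    using level_cases[of "p x"] assms(2) unfolding regular_level_def by blast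
qed

text \<open>An interior extremum is a critical point, and a level with a critical point can only be
  \<gamma>.\<close>

lemma extremum_level:
  assumes x: "x \<in> interior M" and "(\<forall>y\<in>M. p x \<le> p y) \<or> (\<forall>y\<in>M. p y \<le> p x)"
  shows "level_set M p (p x) = \<gamma>"
proof (rule critical_level[OF x])
  have "(\<lambda>v. grad M p x \<bullet> v) = (\<lambda>v. 0)"
    using assms(2) interior_subset
    by (intro differential_zero_maxmin[OF x open_interior grad_has_derivative[OF smooth_p x]]) blast
  then show "grad M p x = 0"
    by (metis inner_eq_zero_iff)
qed

definition p_min :: real where "p_min = Inf (p ` M)"
definition p_max :: real where "p_max = Sup (p ` M)"

lemma p_range: "p ` M = {p_min..p_max}"
proof -
  have "M \<noteq> {}" using interior_nonempty interior_subset by auto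
  moreover have "compact (p ` M)" "connected (p ` M)"
    using compact_continuous_image[OF contp compactM] connected_continuous_image[OF contp connectedM] .
  ultimately obtain a b where "p ` M = {a..b}" "a \<le> b"
    using connected_compact_interval_1[of "p ` M"] by (metis atLeastatMost_empty_iff box_real(2) image_is_empty)
  then show ?thesis by (simp add: p_min_def p_max_def)
qed

lemma p_bounds: "x \<in> M \<Longrightarrow> p_min \<le> p x" "x \<in> M \<Longrightarrow> p x \<le> p_max"
  using p_range by (metis atLeastAtMost_iff image_eqI)+

lemma p_attained: "\<exists>x\<in>M. p x = p_min" "\<exists>x\<in>M. p x = p_max"
proof -
  obtain x where "x \<in> M" using interior_nonempty interior_subset by auto
  then have "p_min \<le> p_max" using p_bounds[of x] by simp
  then have "p_min \<in> p ` M" "p_max \<in> p ` M" unfolding p_range by auto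
  then show "\<exists>x\<in>M. p x = p_min" "\<exists>x\<in>M. p x = p_max" by auto
qed

text \<open>If neither extreme value were the boundary value, both would be attained in the interior
  and hence be the value of p on \<gamma>. Then p would be constant, and equal to its boundary value
  after all.\<close>

lemma c\<^sub>1_range: "c\<^sub>1 = p_min \<or> c\<^sub>1 = p_max"
proof (rule ccontr)
  assume ne: "\<not> ?thesis"
  obtain x y where xy: "x \<in> M" "p x = p_min" "y \<in> M" "p y = p_max"
    using p_attained by blast
  then have "x \<in> interior M" "y \<in> interior M"
    using p_boundary ne by metis+
  then have "level_set M p p_min = \<gamma>" "level_set M p p_max = \<gamma>"
    using extremum_level[of x] extremum_level[of y] xy p_bounds by metis+
  then have "x \<in> level_set M p p_max"
    using xy(1,2) by (auto simp: level_set_def)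
  then have "p_min = p_max"
    using xy(2) by (simp add: level_set_def)
  moreover obtain z where "z \<in> M" "p z = c\<^sub>1"
    using boundary_nonempty unfolding boundary_level level_set_def by blast
  ultimately show False
    using p_bounds[of z] ne by simp
qed

text \<open>Were such a level equal to \<gamma>, no interior point could attain an extremum, because
  an interior extremum has \<gamma> as its level too. Both extremes would then be taken on the
  boundary, where p has a single value.\<close>

lemma level_interior:
  assumes c: "p_min < c" "c < p_max"
  shows "level_set M p c \<subseteq> interior M" "regular_level M p c" "level_set M p c \<noteq> {}"
    "level_set M p c diffeomorphic (sphere (0::real^2) 1 \<times> sphere (0::real^2) 1)"
proof -
  have ne1: "c \<noteq> c\<^sub>1" using c c\<^sub>1_range by auto
  then show "level_set M p c \<subseteq> interior M"
    using p_boundary unfolding level_set_def by blast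
  have "c \<in> p ` M" using c p_range by auto
  then show ne: "level_set M p c \<noteq> {}" unfolding level_set_def by blast
  have "level_set M p c \<noteq> \<gamma>"
  proof
    assume eq: "level_set M p c = \<gamma>"
    obtain x y where xy: "x \<in> M" "p x = p_min" "y \<in> M" "p y = p_max"
      using p_attained by blast
    have "x \<notin> interior M"
      using extremum_level[of x] xy p_bounds c eq unfolding level_set_def by force
    moreover have "y \<notin> interior M"
      using extremum_level[of y] xy p_bounds c eq unfolding level_set_def by force
    ultimately show False
      using p_boundary xy c by (metis less_trans less_irrefl)
  qed
  then show "regular_level M p c"
    "level_set M p c diffeomorphic (sphere (0::real^2) 1 \<times> sphere (0::real^2) 1)"
    using level_cases[OF ne] by auto
qed

lemma interior_off_gamma:
  assumes x: "x \<in> interior M" "x \<notin> \<gamma>"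
  shows "p_min < p x" "p x < p_max"
proof -
  have M: "x \<in> M" using x interior_subset by auto
  have "p x \<noteq> p_min" "p x \<noteq> p_max"
    using extremum_level[OF x(1)] p_bounds x M unfolding level_set_def by force+
  then show "p_min < p x" "p x < p_max"
    using p_bounds[OF M] by auto
qed

lemma compact_level: "compact (level_set M p c)"
proof -
  have "level_set M p c = M \<inter> p -` {c}" by (auto simp: level_set_def)
  then show ?thesis
    using continuous_closed_preimage[OF contp closedM, of "{c}"] compactM
    by (metis closed_singleton compact_Int_closed inf.left_idem)
qed

text \<open>The logarithm exists on an open neighbourhood N of the level. The values of p on the
  part of M outside N form a compact set without c, so nearby levels lie in N.\<close>

lemma has_log_level_open:
  assumes c: "p_min < c" "c < p_max" and log: "has_log (level_set M p c)"
  shows "\<exists>e>0. \<forall>c'. \<bar>c' - c\<bar> < e \<longrightarrow> has_log (level_set M p c')"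
proof -
  obtain N where N: "open N" "level_set M p c \<subseteq> N" "has_log N"
    using has_log_neighbourhood[OF compact_imp_closed[OF compact_level] log] by blast
  have "compact (p ` (M - N))"
    by (intro compact_continuous_image continuous_on_subset[OF contp] compact_diff compactM N) auto
  then have "open (- p ` (M - N))" by (auto intro: compact_imp_closed)
  moreover have "c \<in> - p ` (M - N)" using N(2) by (auto simp: level_set_def)
  ultimately obtain e where e: "0 < e" "ball c e \<subseteq> - p ` (M - N)"
    using open_contains_ball by blast
  have "has_log (level_set M p c')" if "\<bar>c' - c\<bar> < e" for c'
  proof (rule has_log_subset[OF N(3)])
    have "c' \<notin> p ` (M - N)" using e(2) that by (auto simp: subset_iff dist_real_def abs_minus_commute)
    then show "level_set M p c' \<subseteq> N" by (auto simp: level_set_def)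
  qed
  then show ?thesis using e(1) by blast
qed

text \<open>Pushing the level of c along segments in gradient direction reaches each nearby level
  without leaving the interior of M, hence off the axis; a logarithm there would come back by
  homotopy.\<close>

lemma has_log_level_closed:
  assumes c: "p_min < c" "c < p_max" and log: "\<not> has_log (level_set M p c)"
  shows "\<exists>e>0. \<forall>c'. \<bar>c' - c\<bar> < e \<longrightarrow> \<not> has_log (level_set M p c')"
proof -
  obtain e where e: "0 < e" "\<And>c'. \<bar>c' - c\<bar> < e \<Longrightarrow> \<exists>t. continuous_on (level_set M p c) t \<and>
      (\<forall>x\<in>level_set M p c. p (x + t x *\<^sub>R grad M p x) = c' \<and> (\<forall>s\<in>{0..1}. x + (s * t x) *\<^sub>R grad M p x \<in> interior M))"
  proof (rule level_set_push[OF open_interior compact_level level_interior(1)[OF c]])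
    show "(p has_derivative (\<lambda>v. grad M p x \<bullet> v)) (at x)" if "x \<in> interior M" for x
      using grad_has_derivative[OF smooth_p that] .
    show "continuous_on (interior M) (grad M p)"
      using Ck_on_continuous[OF Ck_grad[OF smooth_p]] .
    show "grad M p x \<noteq> 0" if "x \<in> level_set M p c" for x
      using level_interior(2)[OF c] that unfolding regular_level_def by blast
  qed (auto simp: level_set_def)
  have "\<not> has_log (level_set M p c')" if c': "\<bar>c' - c\<bar> < e" for c'
  proof
    assume log': "has_log (level_set M p c')"
    obtain t where t: "continuous_on (level_set M p c) t"
      "\<And>x. x \<in> level_set M p c \<Longrightarrow> p (x + t x *\<^sub>R grad M p x) = c'"
      "\<And>x s. x \<in> level_set M p c \<Longrightarrow> s \<in> {0..1} \<Longrightarrow> x + (s * t x) *\<^sub>R grad M p x \<in> interior M"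
      using e(2)[OF c'] by blast
    define h where "h z = snd z + (fst z * t (snd z)) *\<^sub>R grad M p (snd z)" for z
    have "has_log (level_set M p c)"
    proof (rule has_log_homotopy[of _ h, OF _ _ _ _ log'])
      have G: "continuous_on (level_set M p c) (grad M p)"
        using Ck_on_continuous[OF Ck_grad[OF smooth_p]] level_interior(1)[OF c] continuous_on_subset by blast
      show "continuous_on ({0..1} \<times> level_set M p c) h"
        unfolding h_def
        by (intro continuous_intros continuous_on_compose2[OF t(1)] continuous_on_compose2[OF G]) auto
      show "h ` ({0..1} \<times> level_set M p c) \<subseteq> - z_axis"
        using t(3) off_axis interior_subset unfolding h_def by fastforce
      show "h (0, x) = x" for x by (simp add: h_def)
      show "h (1, x) \<in> level_set M p c'" if "x \<in> level_set M p c" for x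
        using t(2)[OF that] t(3)[OF that, of 1] interior_subset by (auto simp: h_def level_set_def)
    qed
    then show False using log by blast
  qed
  then show ?thesis using e(1) by blast
qed

text \<open>Choose c with all values on the core on one side, possibly at c, and the boundary value
  strictly on the other. Its level cuts M into a part with the core and a part with a boundary
  longitude, so a logarithm on it would produce one on M. There are two cases because p may be
  largest or smallest on the boundary.\<close>

lemma some_level_no_log:
  assumes ne: "p_min < p_max"
  shows "\<exists>c. p_min < c \<and> c < p_max \<and> \<not> has_log (level_set M p c)"
proof (rule ccontr)
  assume "\<not> ?thesis"
  then have log: "has_log (level_set M p c)" if "p_min < c" "c < p_max" for c
    using that by blast
  define K where "K = D ` (sphere 0 1 \<times> {0})"
  have K: "compact K" "K \<noteq> {}" "K \<subseteq> interior M"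
    using circ_in_sphere(1)[of 0] unfolding K_def
    by (auto intro!: compact_continuous_image continuous_on_subset[OF contD] compact_Times core_interior)
  have contK: "continuous_on K p" using contp K(3) interior_subset continuous_on_subset by blast
  have closed_le: "closed {x\<in>M. p x \<le> c}" "closed {x\<in>M. c \<le> p x}" for c
  proof -
    have "{x\<in>M. p x \<le> c} = M \<inter> p -` {..c}" "{x\<in>M. c \<le> p x} = M \<inter> p -` {c..}" by auto
    then show "closed {x\<in>M. p x \<le> c}" "closed {x\<in>M. c \<le> p x}"
      using continuous_closed_preimage[OF contp closedM] by auto
  qed
  have longitude: "D (s, circ 0) \<in> M" "p (D (s, circ 0)) = c\<^sub>1" if "s \<in> sphere 0 1" for s
  proof -
    show M: "D (s, circ 0) \<in> M" using imageD that by auto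
    show "p (D (s, circ 0)) = c\<^sub>1"
      using p_boundary[OF M] longitude_not_interior[OF that, of "circ 0"] by auto
  qed
  have core: "D (s, 0) \<in> K" if "s \<in> sphere 0 1" for s using that by (auto simp: K_def)
  have KM: "x \<in> K \<Longrightarrow> x \<in> M" for x using K(3) interior_subset by auto
  have int: "{x\<in>M. p x \<le> c} \<inter> {x\<in>M. c \<le> p x} = level_set M p c"
    "{x\<in>M. c \<le> p x} \<inter> {x\<in>M. p x \<le> c} = level_set M p c" for c by (auto simp: level_set_def)
  have un: "M = {x\<in>M. p x \<le> c} \<union> {x\<in>M. c \<le> p x}" "M = {x\<in>M. c \<le> p x} \<union> {x\<in>M. p x \<le> c}" for c by auto
  from c\<^sub>1_range show False
  proof
    assume c1: "c\<^sub>1 = p_max"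
    obtain x where x: "x \<in> K" "\<And>y. y \<in> K \<Longrightarrow> p y \<le> p x"
      using continuous_attains_sup[OF K(1,2) contK] by blast
    have "p x < p_max"
      using x(1) K(3) p_interior[of x] p_bounds(2)[OF KM[OF x(1)]] c1 by force
    moreover have "p_min \<le> p x" using p_bounds x KM by blast
    ultimately obtain c where c: "p_min < c" "p x \<le> c" "c < p_max"
      using dense by (metis order_less_imp_le order_le_less_trans)
    have "has_log M"
    proof (rule has_log_solid_torus[OF homeo off_axis un(1)[of c] closed_le])
      show "has_log ({x \<in> M. p x \<le> c} \<inter> {x \<in> M. c \<le> p x})" using log[OF c(1,3)] unfolding int .
      show "D (s, 0) \<in> {x \<in> M. p x \<le> c}" if "s \<in> sphere 0 1" for s
        using x(2)[OF core[OF that]] KM[OF core[OF that]] c(2) by auto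
      show "D (s, circ 0) \<in> {x \<in> M. c \<le> p x}" if "s \<in> sphere 0 1" for s
        using longitude[OF that] c c1 by auto
    qed simp
    then show False using no_log by blast
  next
    assume c1: "c\<^sub>1 = p_min"
    obtain x where x: "x \<in> K" "\<And>y. y \<in> K \<Longrightarrow> p x \<le> p y"
      using continuous_attains_inf[OF K(1,2) contK] by blast
    have "p_min < p x"
      using x(1) K(3) p_interior[of x] p_bounds(1)[OF KM[OF x(1)]] c1 by force
    moreover have "p x \<le> p_max" using p_bounds x KM by blast
    ultimately obtain c where c: "p_min < c" "c \<le> p x" "c < p_max"
      using dense by (metis order_less_imp_le order_less_le_trans)
    have "has_log M"
    proof (rule has_log_solid_torus[OF homeo off_axis un(2)[of c] closed_le(2,1)])
      show "has_log ({x \<in> M. c \<le> p x} \<inter> {x \<in> M. p x \<le> c})" using log[OF c(1,3)] unfolding int .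
      show "D (s, 0) \<in> {x \<in> M. c \<le> p x}" if "s \<in> sphere 0 1" for s
        using x(2)[OF core[OF that]] KM[OF core[OF that]] c(2) by auto
      show "D (s, circ 0) \<in> {x \<in> M. p x \<le> c}" if "s \<in> sphere 0 1" for s
        using longitude[OF that] c c1 by auto
    qed simp
    then show False using no_log by blast
  qed
qed

lemma level_no_log:
  assumes c: "p_min < c" "c < p_max"
  shows "\<not> has_log (level_set M p c)"
proof
  assume log: "has_log (level_set M p c)"
  define Z where "Z b = {c \<in> {p_min<..<p_max}. has_log (level_set M p c) = b}" for b
  have "open (Z b)" for b
    unfolding open_dist
  proof
    fix c assume cZ: "c \<in> Z b"
    then have c: "p_min < c" "c < p_max" "has_log (level_set M p c) = b" by (auto simp: Z_def)
    obtain e where e: "0 < e" "\<And>c'. \<bar>c' - c\<bar> < e \<Longrightarrow> has_log (level_set M p c') = b"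
      using has_log_level_open[OF c(1,2)] has_log_level_closed[OF c(1,2)] c(3) by (cases b) auto
    then show "\<exists>e>0. \<forall>c'. dist c' c < e \<longrightarrow> c' \<in> Z b"
      using c by (intro exI[of _ "min e (min (c - p_min) (p_max - c))"])
        (auto simp: Z_def dist_real_def abs_less_iff)
  qed
  moreover have "{p_min<..<p_max} \<subseteq> Z True \<union> Z False" "Z True \<inter> Z False \<inter> {p_min<..<p_max} = {}"
    by (auto simp: Z_def)
  moreover have "c \<in> Z True \<inter> {p_min<..<p_max}" using c log by (auto simp: Z_def)
  moreover obtain c' where "c' \<in> Z False \<inter> {p_min<..<p_max}"
    using some_level_no_log c by (auto simp: Z_def)
  ultimately show False
    using connectedD[of "{p_min<..<p_max}" "Z True" "Z False"] by (metis connected_Ioo empty_iff)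
qed

end

section \<open>Linear algebra of the curl\<close>

text \<open>The curl as a function of the derivative alone, so that product rules and conjugation by
  the half-turn become linear algebra.\<close>

definition curl_vec :: "(real^3 \<Rightarrow> real^3) \<Rightarrow> real^3" where
  "curl_vec L = vector [L (axis 2 1) $ 3 - L (axis 3 1) $ 2,
     L (axis 3 1) $ 1 - L (axis 1 1) $ 3, L (axis 1 1) $ 2 - L (axis 2 1) $ 1]"

definition div_sum :: "(real^3 \<Rightarrow> real^3) \<Rightarrow> real" where
  "div_sum L = (\<Sum>i\<in>UNIV. L (axis i 1) $ i)"

lemma curl_eq: "x \<in> interior M \<Longrightarrow> curl M W x = curl_vec (frechet_derivative W (at x))"
  by (simp add: curl_def partial_deriv_def curl_vec_def at_within_interior[of x M])

lemma divergence_eq: "x \<in> interior M \<Longrightarrow> divergence M W x = div_sum (frechet_derivative W (at x))"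
  by (simp add: divergence_def partial_deriv_def div_sum_def at_within_interior[of x M])

lemma linear_nth_3:
  assumes "linear (L :: real^3 \<Rightarrow> real^3)"
  shows "L X $ i = X $ 1 * L (axis 1 1) $ i + X $ 2 * L (axis 2 1) $ i + X $ 3 * L (axis 3 1) $ i"
proof -
  have "X = X $ 1 *\<^sub>R axis 1 1 + X $ 2 *\<^sub>R axis 2 1 + X $ 3 *\<^sub>R axis 3 1"
    by (simp add: vec_eq_iff forall_3 axis_def)
  then have "L X = X $ 1 *\<^sub>R L (axis 1 1) + X $ 2 *\<^sub>R L (axis 2 1) + X $ 3 *\<^sub>R L (axis 3 1)"
    using linear_add[OF assms] linear_cmul[OF assms] by metis
  then show ?thesis by simp
qed

text \<open>The antisymmetric part of a linear map of space is a cross product. For the one-form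
  \<omega> dual to a field W this is d\<omega>(X, Y) = curl W . (X x Y).\<close>

lemma curl_vec_inner_cross:
  assumes "linear L"
  shows "L X \<bullet> Y - L Y \<bullet> X = curl_vec L \<bullet> cross3 X Y"
  using linear_nth_3[OF assms, of X] linear_nth_3[OF assms, of Y]
  by (simp add: curl_vec_def cross3_def inner_vec_def sum_3 algebra_simps)

lemma curl_vec_add: "curl_vec (\<lambda>X. L X + K X) = curl_vec L + curl_vec K"
  by (simp add: curl_vec_def vec_eq_iff forall_3)

lemma div_sum_add: "div_sum (\<lambda>X. L X + K X) = div_sum L + div_sum K"
  by (simp add: div_sum_def sum.distrib)

text \<open>The identity for the curl of A x B at a point, with K and L in the place of the
  derivatives of A and B.\<close>

lemma curl_vec_cross:
  assumes K: "linear K" and L: "linear L"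
  shows "curl_vec (\<lambda>X. cross3 A (L X) + cross3 (K X) B)
    = div_sum L *\<^sub>R A - div_sum K *\<^sub>R B + K B - L A"
  using linear_nth_3[OF K, of B] linear_nth_3[OF L, of A]
  by (simp add: curl_vec_def div_sum_def cross3_def vec_eq_iff forall_3 sum_3 algebra_simps)

lemma cross_parallel:
  assumes "G \<noteq> 0" "X \<bullet> G = 0" "Y \<bullet> G = 0"
  obtains l where "cross3 X Y = l *\<^sub>R G"
proof -
  have "cross3 G (cross3 X Y) = 0"
    using assms(2,3) by (simp add: Lagrange inner_commute)
  then have "cross3 X Y = 0 \<or> (\<exists>l. cross3 X Y = l *\<^sub>R G)"
    unfolding cross_eq_0 collinear_lemma using assms(1) by blast
  then show ?thesis
    using that[of 0] that by auto
qed

text \<open>With \<open>G = \<nabla>p\<close> and \<open>X\<close>, \<open>Y\<close> tangent to the level set, the left-hand side is \<open>\<bar>\<nabla>p\<bar>\<^sup>2 (\<alpha> \<and> \<beta>)(X, Y)\<close>.\<close>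

lemma wedge_tangent:
  assumes "G \<noteq> 0" "X \<bullet> G = 0" "Y \<bullet> G = 0" "C \<bullet> G = 0"
  shows "(C \<bullet> X) * (cross3 G C \<bullet> Y) - (C \<bullet> Y) * (cross3 G C \<bullet> X) = (C \<bullet> C) * (cross3 X Y \<bullet> G)"
proof -
  obtain l where l: "cross3 X Y = l *\<^sub>R G" using cross_parallel assms by blast
  have "(C \<bullet> X) * (cross3 G C \<bullet> Y) - (C \<bullet> Y) * (cross3 G C \<bullet> X) = cross3 C (cross3 G C) \<bullet> cross3 X Y"
    by (simp add: dot_cross inner_commute)
  also have "cross3 C (cross3 G C) = (C \<bullet> C) *\<^sub>R G"
    using assms(4) by (simp add: Lagrange)
  finally show ?thesis by (simp add: l)
qed

lemma bounded_bilinear_cross3: "bounded_bilinear cross3"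
  using bilinear_cross bilinear_conv_bounded_bilinear by blast

section \<open>Parametrised tori\<close>

lemma circ_eq: "circ t = cos t *\<^sub>R axis 1 1 + sin t *\<^sub>R axis 2 1"
  by (auto simp: vec_eq_iff forall_2 axis_def)

lemma Ck_on_circ: "Ck_on k UNIV circ"
  unfolding circ_eq[abs_def] using Ck_on_sin_cos[of k]
  by (intro Ck_on_add Ck_on_bounded_linear[OF bounded_linear_scaleR_left]) auto

lemma circ_has_derivative: "(circ has_derivative (\<lambda>h. h *\<^sub>R vector [- sin t, cos t])) (at t)"
proof -
  have "((\<lambda>t. cos t *\<^sub>R axis 1 1 + sin t *\<^sub>R axis 2 1) has_derivative
      (\<lambda>h. (h * - sin t) *\<^sub>R axis 1 1 + (h * cos t) *\<^sub>R (axis 2 1 :: real^2))) (at t)"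
    by (auto intro!: derivative_eq_intros)
  moreover have "(h * - sin t) *\<^sub>R axis 1 1 + (h * cos t) *\<^sub>R axis 2 1 = h *\<^sub>R (vector [- sin t, cos t] :: real^2)" for h
    by (auto simp: vec_eq_iff forall_2 axis_def)
  ultimately show ?thesis by (simp only: circ_eq[abs_def])
qed

text \<open>\<open>S\<close> and \<open>K\<close> are the sine and cosine of the angle from
  \<open>circ u\<close> to w. Near the base point \<open>K\<close> is positive, so the arcsine
  recovers the angle, and it is differentiable wherever w is known to be, namely at that
  point.\<close>

lemma local_angle:
  fixes w :: "'a::real_normed_vector \<Rightarrow> real^2"
  assumes ev: "\<forall>\<^sub>F z in nhds z\<^sub>0. norm (w z) = 1" and w': "(w has_derivative w') (at z\<^sub>0)" and w0: "w z\<^sub>0 = circ u"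
  obtains \<sigma> \<sigma>' where "(\<sigma> has_derivative \<sigma>') (at z\<^sub>0)" "\<sigma> z\<^sub>0 = u" "\<forall>\<^sub>F z in nhds z\<^sub>0. circ (\<sigma> z) = w z"
proof -
  define S where "S z = cos u * w z $ 2 - sin u * w z $ 1" for z
  define K where "K z = cos u * w z $ 1 + sin u * w z $ 2" for z
  define \<sigma> where "\<sigma> z = u + arcsin (S z)" for z
  have rot: "(a * y - b * x)\<^sup>2 + (a * x + b * y)\<^sup>2 = (a\<^sup>2 + b\<^sup>2) * (x\<^sup>2 + y\<^sup>2)"
    "a * (a * x + b * y) - b * (a * y - b * x) = (a\<^sup>2 + b\<^sup>2) * x"
    "b * (a * x + b * y) + a * (a * y - b * x) = (a\<^sup>2 + b\<^sup>2) * y" for a b x y :: real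
    by (simp_all add: power2_eq_square algebra_simps)
  have S0: "S z\<^sub>0 = 0" by (simp add: S_def w0)
  have K0: "K z\<^sub>0 = 1" by (simp add: K_def w0 flip: power2_eq_square)
  have "(S has_derivative (\<lambda>h. cos u * w' h $ 2 - sin u * w' h $ 1)) (at z\<^sub>0)"
    unfolding S_def by (auto intro!: derivative_eq_intros bounded_linear.has_derivative[OF bounded_linear_vec_nth] w')
  moreover have "(arcsin has_derivative (\<lambda>h. h)) (at (S z\<^sub>0))"
    using DERIV_arcsin[of 0] by (simp add: S0 has_field_derivative_def mult.commute[of 1] fun_eq_iff[of "(*) 1" "\<lambda>h. h", THEN iffD2])
  ultimately have "((\<lambda>z. arcsin (S z)) has_derivative (\<lambda>h. cos u * w' h $ 2 - sin u * w' h $ 1)) (at z\<^sub>0)"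
    by (rule has_derivative_compose)
  from has_derivative_add[OF has_derivative_const[of u] this]
  have "(\<sigma> has_derivative (\<lambda>h. cos u * w' h $ 2 - sin u * w' h $ 1)) (at z\<^sub>0)"
    by (simp add: \<sigma>_def[abs_def])
  moreover have "\<sigma> z\<^sub>0 = u" by (simp add: \<sigma>_def S0)
  moreover have "\<forall>\<^sub>F z in nhds z\<^sub>0. circ (\<sigma> z) = w z"
  proof -
    have "isCont K z\<^sub>0"
      unfolding K_def using has_derivative_continuous[OF w'] by (intro continuous_intros)
    then have "\<forall>\<^sub>F z in nhds z\<^sub>0. 0 < K z"
      unfolding continuous_at tendsto_at_iff_tendsto_nhds using K0 order_tendstoD(1)[of K 1 _ 0] by auto
    with ev show ?thesis
    proof eventually_elim
      case (elim z)
      then have n: "(w z $ 1)\<^sup>2 + (w z $ 2)\<^sup>2 = 1"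
        by (simp add: norm_eq_1 inner_vec_def sum_2 power2_eq_square)
      have "(S z)\<^sup>2 + (K z)\<^sup>2 = ((cos u)\<^sup>2 + (sin u)\<^sup>2) * ((w z $ 1)\<^sup>2 + (w z $ 2)\<^sup>2)"
        unfolding S_def K_def by (rule rot(1))
      then have SK: "(S z)\<^sup>2 + (K z)\<^sup>2 = 1" using n by simp
      then have "(S z)\<^sup>2 \<le> 1" by (smt (verit) zero_le_power2)
      then have S: "- 1 \<le> S z" "S z \<le> 1" using abs_square_le_1[of "S z"] by auto
      have "1 - (S z)\<^sup>2 = (K z)\<^sup>2" using SK by simp
      then have c: "cos (arcsin (S z)) = K z"
        using cos_arcsin[OF S] elim by simp
      have s: "sin (arcsin (S z)) = S z" using S by simp
      have "cos (\<sigma> z) = ((cos u)\<^sup>2 + (sin u)\<^sup>2) * w z $ 1"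
        unfolding \<sigma>_def cos_add c s unfolding S_def K_def by (rule rot(2))
      moreover have "sin (\<sigma> z) = ((cos u)\<^sup>2 + (sin u)\<^sup>2) * w z $ 2"
        unfolding \<sigma>_def sin_add c s unfolding S_def K_def by (rule rot(3))
      ultimately show ?case by (simp add: vec_eq_iff forall_2)
    qed
  qed
  ultimately show ?thesis using that by blast
qed

section \<open>The plane as a covering of a level torus\<close>

definition circ2 :: "real \<times> real \<Rightarrow> (real^2) \<times> (real^2)" where
  "circ2 z = (circ (fst z), circ (snd z))"

lemma circ2_in [simp]: "circ2 z \<in> sphere 0 1 \<times> sphere 0 1"
  by (simp add: circ2_def)

lemma Ck_on_circ2: "Ck_on k UNIV circ2"
proof -
  have "Ck_on k UNIV (\<lambda>z :: real \<times> real. (circ (fst z), 0 :: real^2) + (0 :: real^2, circ (snd z)))"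
    by (intro Ck_on_add Ck_on_bounded_linear[where h = "\<lambda>s. (s, 0)"] Ck_on_bounded_linear[where h = "\<lambda>s. (0, s)"]
        Ck_on_compose[OF _ _ Ck_on_circ] Ck_on_linear bounded_linear_fst bounded_linear_snd
        bounded_linear_Pair bounded_linear_ident bounded_linear_zero) auto
  then show ?thesis by (simp add: circ2_def[abs_def])
qed

lemma circ2_has_derivative:
  "(circ2 has_derivative (\<lambda>h. (fst h *\<^sub>R vector [- sin (fst z), cos (fst z)], snd h *\<^sub>R vector [- sin (snd z), cos (snd z)]))) (at z)"
  unfolding circ2_def[abs_def]
  by (intro has_derivative_Pair has_derivative_compose[OF _ circ_has_derivative]) (auto intro!: derivative_eq_intros)

lemma circ2_surj:
  assumes "w \<in> sphere 0 1 \<times> sphere 0 1"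
  obtains z where "z \<in> cbox (0, 0) (2 * pi, 2 * pi)" "circ2 z = w"
proof -
  have *: "\<exists>t. 0 \<le> t \<and> t \<le> 2 * pi \<and> circ t = s" if "s \<in> sphere 0 1" for s
  proof -
    have "(s $ 1)\<^sup>2 + (s $ 2)\<^sup>2 = 1"
      using that by (simp add: norm_eq_1 inner_vec_def sum_2 power2_eq_square)
    then obtain t where "0 \<le> t" "t < 2 * pi" "s $ 1 = cos t" "s $ 2 = sin t"
      using sincos_total_2pi by metis
    then show ?thesis by (intro exI[of _ t]) (auto simp: vec_eq_iff forall_2)
  qed
  obtain t u where "0 \<le> t" "t \<le> 2 * pi" "circ t = fst w" "0 \<le> u" "u \<le> 2 * pi" "circ u = snd w"
    using *[of "fst w"] *[of "snd w"] assms by (auto simp: mem_Times_iff)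
  then show ?thesis
    using that[of "(t, u)"] by (simp add: circ2_def cbox_Pair_eq)
qed

locale torus_param =
  fixes T :: "(real^3) set" and f\<^sub>0 :: "(real^2) \<times> (real^2) \<Rightarrow> real^3" and g\<^sub>0 :: "real^3 \<Rightarrow> (real^2) \<times> (real^2)"
  assumes diffeo: "diffeomorphism (sphere 0 1 \<times> sphere 0 1) T f\<^sub>0 g\<^sub>0"
begin

text \<open>The covering map from the plane, 2 pi periodic in each variable. Through it, one-forms
  on T become doubly periodic forms on the plane.\<close>

definition F :: "real \<times> real \<Rightarrow> real^3" where "F z = f\<^sub>0 (circ2 z)"
definition DF :: "real \<times> real \<Rightarrow> real \<times> real \<Rightarrow> real^3" where "DF z = frechet_derivative F (at z)"

lemma smooth_f0: "smooth_on (sphere 0 1 \<times> sphere 0 1) f\<^sub>0" and smooth_g0: "smooth_on T g\<^sub>0"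
  and f0_image: "f\<^sub>0 ` (sphere 0 1 \<times> sphere 0 1) = T" and g0_image: "g\<^sub>0 ` T = sphere 0 1 \<times> sphere 0 1"
  and f0_g0: "\<And>x. x \<in> T \<Longrightarrow> f\<^sub>0 (g\<^sub>0 x) = x" and g0_f0: "\<And>w. w \<in> sphere 0 1 \<times> sphere 0 1 \<Longrightarrow> g\<^sub>0 (f\<^sub>0 w) = w"
  using diffeo unfolding diffeomorphism_def by (simp_all del: ball_simps split_paired_Ball_Sigma)

lemma F_in: "F z \<in> T"
  unfolding F_def f0_image[symmetric] by (rule imageI[OF circ2_in])

lemma g0_F: "g\<^sub>0 (F z) = circ2 z"
  unfolding F_def by (rule g0_f0[OF circ2_in])

lemma F_onto:
  assumes "x \<in> T"
  obtains z where "z \<in> cbox (0, 0) (2 * pi, 2 * pi)" "F z = x"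
proof -
  have "g\<^sub>0 x \<in> sphere 0 1 \<times> sphere 0 1"
    using imageI[OF assms, of g\<^sub>0] unfolding g0_image .
  then obtain z where "z \<in> cbox (0, 0) (2 * pi, 2 * pi)" "circ2 z = g\<^sub>0 x"
    by (rule circ2_surj)
  then show ?thesis using that[of z] f0_g0[OF assms] by (simp add: F_def)
qed

lemma F_eq_iff: "F z = F w \<longleftrightarrow> circ2 z = circ2 w"
  using g0_F by (metis F_def)

lemma Ck_F: "Ck_on k UNIV F"
proof (rule Ck_on_local)
  fix z
  obtain U g where U: "open U" "circ2 z \<in> U" "\<And>k. Ck_on k U g"
    "\<And>y. y \<in> sphere 0 1 \<times> sphere 0 1 \<Longrightarrow> y \<in> U \<Longrightarrow> g y = f\<^sub>0 y"
    by (fact smooth_onE[OF smooth_f0 circ2_in])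
  define V where "V = circ2 -` U"
  have V: "open V"
    unfolding V_def using U(1) Ck_on_continuous[OF Ck_on_circ2] by (rule open_vimage)
  have "Ck_on k V (\<lambda>z. g (circ2 z))"
    by (rule Ck_on_compose[OF V Ck_on_subset[OF Ck_on_circ2] U(3)]) (auto simp: V_def)
  moreover have "g (circ2 z) = F z" if "z \<in> V" for z
    using U(4)[OF circ2_in] that by (simp add: V_def F_def)
  ultimately have "Ck_on k V F"
    using Ck_on_cong[OF V, of "\<lambda>z. g (circ2 z)" F k] by simp
  then show "\<exists>V. open V \<and> z \<in> V \<and> Ck_on k V F"
    using V U(2) by (intro exI[of _ V]) (simp add: V_def)
qed

lemma F_has_derivative: "(F has_derivative DF z) (at z)"
  unfolding DF_def by (rule Ck_on_has_derivative[OF Ck_F]) simp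

lemma contF: "continuous_on S F"
  using Ck_on_continuous[OF Ck_F] continuous_on_subset by blast

lemma compactT: "compact T"
proof -
  have "T = F ` cbox (0, 0) (2 * pi, 2 * pi)"
  proof (intro subset_antisym subsetI)
    fix x assume "x \<in> T"
    then obtain z where "z \<in> cbox (0, 0) (2 * pi, 2 * pi)" "F z = x" by (rule F_onto)
    then show "x \<in> F ` cbox (0, 0) (2 * pi, 2 * pi)" by auto
  qed (auto simp: F_in)
  then show ?thesis
    using compact_continuous_image[OF contF compact_cbox] by simp
qed

text \<open>A smooth extension of \<open>g\<^sub>0\<close> composed with F is \<open>circ2\<close>
  near z, and \<open>circ2\<close> has injective derivative.\<close>

lemma DF_injective:
  assumes "DF z h = 0"
  shows "h = 0"
proof -
  obtain U g where U: "open U" "F z \<in> U" "\<And>k. Ck_on k U g" "\<And>y. y \<in> T \<Longrightarrow> y \<in> U \<Longrightarrow> g y = g\<^sub>0 y"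
    by (fact smooth_onE[OF smooth_g0 F_in])
  have "(g has_derivative frechet_derivative g (at (F z))) (at (F z))"
    using Ck_on_has_derivative[OF U(3) U(2)] .
  from has_derivative_compose[OF F_has_derivative this]
  have "((\<lambda>z. g (F z)) has_derivative (\<lambda>h. frechet_derivative g (at (F z)) (DF z h))) (at z)" .
  then have "(circ2 has_derivative (\<lambda>h. frechet_derivative g (at (F z)) (DF z h))) (at z)"
  proof (rule has_derivative_transform_within_open)
    show "open (F -` U)" using U(1) contF by (rule open_vimage)
    show "g (F w) = circ2 w" if "w \<in> F -` U" for w
      using U(4)[OF F_in] that g0_F by simp
  qed (use U(2) in auto)
  from has_derivative_unique[OF this circ2_has_derivative]
  have "frechet_derivative g (at (F z)) (DF z h)
      = (fst h *\<^sub>R vector [- sin (fst z), cos (fst z)], snd h *\<^sub>R vector [- sin (snd z), cos (snd z)])"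
    by metis
  moreover have "frechet_derivative g (at (F z)) 0 = 0"
    using Ck_on_has_derivative[OF U(3) U(2)] has_derivative_bounded_linear bounded_linear.linear linear_0 by blast
  ultimately have "fst h *\<^sub>R (vector [- sin (fst z), cos (fst z)] :: real^2) = 0"
    "snd h *\<^sub>R (vector [- sin (snd z), cos (snd z)] :: real^2) = 0"
    using assms by (simp_all add: zero_prod_def)
  moreover have "(vector [- sin t, cos t] :: real^2) \<noteq> 0" for t
    using sin_cos_squared_add[of t] by (auto simp: vec_eq_iff forall_2 simp del: sin_cos_squared_add)
  ultimately show ?thesis by (simp add: prod_eq_iff)
qed

lemma F_periodic: "F (u + 2 * pi, v) = F (u, v)" "F (u, v + 2 * pi) = F (u, v)"
  unfolding F_eq_iff by (simp_all add: circ2_def vec_eq_iff forall_2)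

lemma DF_eq:
  assumes "\<And>z. F (z + a) = F z"
  shows "DF (z + a) = DF z"
proof -
  have "((\<lambda>z. z + a) has_derivative (\<lambda>h. h)) (at z)"
    by (auto intro!: derivative_eq_intros)
  from has_derivative_compose[OF this F_has_derivative]
  have "(F has_derivative DF (z + a)) (at z)"
    using assms by simp
  then show ?thesis using F_has_derivative has_derivative_unique by blast
qed

lemma DF_periodic: "DF (u + 2 * pi, v) = DF (u, v)" "DF (u, v + 2 * pi) = DF (u, v)"
  using DF_eq[of "(2 * pi, 0)" "(u, v)"] DF_eq[of "(0, 2 * pi)" "(u, v)"] F_periodic
  by (simp_all add: split_paired_all)

lemma periodic_int:
  fixes k :: "real \<Rightarrow> 'b"
  assumes "\<And>u. k (u + a) = k u"
  shows "k (u + a * of_int n) = k u"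
proof (induction n rule: int_induct[where k = 0])
  case (step1 i)
  then show ?case using assms[of "u + a * of_int i"] by (simp add: algebra_simps)
next
  case (step2 i)
  then show ?case using assms[of "u + a * of_int (i - 1)"] by (simp add: algebra_simps)
qed simp

lemma periodic_factors:
  fixes k :: "real \<times> real \<Rightarrow> 'b"
  assumes k: "\<And>u v. k (u + 2 * pi, v) = k (u, v)" "\<And>u v. k (u, v + 2 * pi) = k (u, v)"
    and "F z = F w"
  shows "k z = k w"
proof -
  have "circ (fst z) = circ (fst w)" "circ (snd z) = circ (snd w)"
    using assms(3) unfolding F_eq_iff circ2_def by auto
  then obtain m n :: int where "fst z = fst w + 2 * pi * of_int m" "snd z = snd w + 2 * pi * of_int n"
    unfolding circ_eq_iff by blast
  then have z: "z = (fst w + 2 * pi * of_int m, snd w + 2 * pi * of_int n)" by (simp add: prod_eq_iff)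
  have "k z = k (fst w, snd w + 2 * pi * of_int n)"
    unfolding z using periodic_int[of "\<lambda>u. k (u, snd w + 2 * pi * of_int n)" "2 * pi"] k(1) by simp
  also have "\<dots> = k (fst w, snd w)"
    using periodic_int[of "\<lambda>v. k (fst w, v)" "2 * pi"] k(2) by simp
  finally show ?thesis by simp
qed

text \<open>A doubly periodic function is constant on the fibres of F. Continuity holds because F
  maps a compact square onto T, which makes the preimage under l of a closed set the image of a
  compact one.\<close>

lemma periodic_descends:
  fixes k :: "real \<times> real \<Rightarrow> real"
  assumes k: "\<And>u v. k (u + 2 * pi, v) = k (u, v)" "\<And>u v. k (u, v + 2 * pi) = k (u, v)"
    and cont: "continuous_on UNIV k"
  obtains l where "continuous_on T l" "\<And>z. l (F z) = k z"
proof -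
  define l where "l x = k (SOME z. F z = x)" for x
  have l: "l (F z) = k z" for z
    unfolding l_def by (rule periodic_factors[OF k]) (rule someI[of "\<lambda>w. F w = F z"], rule refl)
  have "continuous_on T l"
    unfolding continuous_on_closed_vimage[OF compact_imp_closed[OF compactT]]
  proof (intro allI impI)
    fix A :: "real set" assume "closed A"
    then have "closed (k -` A)" using cont by (simp add: closed_vimage)
    then have "compact (cbox (0, 0) (2 * pi, 2 * pi) \<inter> k -` A)" by (intro compact_Int_closed) auto
    then have "closed (F ` (cbox (0, 0) (2 * pi, 2 * pi) \<inter> k -` A))"
      by (intro compact_imp_closed compact_continuous_image[OF contF])
    moreover have "F ` (cbox (0, 0) (2 * pi, 2 * pi) \<inter> k -` A) = l -` A \<inter> T"
    proof (intro subset_antisym subsetI)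
      fix x assume "x \<in> l -` A \<inter> T"
      then have "x \<in> T" "l x \<in> A" by auto
      from this(1) obtain z where "z \<in> cbox (0, 0) (2 * pi, 2 * pi)" "F z = x" by (rule F_onto)
      then show "x \<in> F ` (cbox (0, 0) (2 * pi, 2 * pi) \<inter> k -` A)" using l[of z] \<open>l x \<in> A\<close> by auto
    qed (auto simp: l F_in)
    ultimately show "closed (l -` A \<inter> T)" by simp
  qed
  then show ?thesis using that l by blast
qed

text \<open>\<open>g\<^sub>0\<close> turns J (F z) into a pair of unit vectors, and each receives a
  local angle. Differentiability at the base point suffices to differentiate composites there, so no
  global lift to the covering is built.\<close>

lemma local_lift:
  assumes J: "bounded_linear J" "\<And>x. x \<in> T \<Longrightarrow> J x \<in> T" and z1: "F z\<^sub>1 = J (F z\<^sub>0)"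
  obtains \<sigma> \<sigma>' where "(\<sigma> has_derivative \<sigma>') (at z\<^sub>0)" "\<sigma> z\<^sub>0 = z\<^sub>1" "\<forall>\<^sub>F z in nhds z\<^sub>0. F (\<sigma> z) = J (F z)"
proof -
  obtain U g where U: "open U" "F z\<^sub>1 \<in> U" "\<And>k. Ck_on k U g" "\<And>y. y \<in> T \<Longrightarrow> y \<in> U \<Longrightarrow> g y = g\<^sub>0 y"
    by (fact smooth_onE[OF smooth_g0 F_in])
  define w where "w z = g (J (F z))" for z
  have JF: "((\<lambda>z. J (F z)) has_derivative (\<lambda>h. J (DF z\<^sub>0 h))) (at z\<^sub>0)"
    using bounded_linear.has_derivative[OF J(1) F_has_derivative] .
  have "(g has_derivative frechet_derivative g (at (J (F z\<^sub>0)))) (at (J (F z\<^sub>0)))"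
    using Ck_on_has_derivative[OF U(3) U(2)] unfolding z1 .
  from has_derivative_compose[OF JF this] obtain w' where w': "(w has_derivative w') (at z\<^sub>0)"
    unfolding w_def by blast
  have "\<forall>\<^sub>F z in nhds z\<^sub>0. J (F z) \<in> U"
  proof (rule topological_tendstoD[OF _ U(1)])
    show "((\<lambda>z. J (F z)) \<longlongrightarrow> J (F z\<^sub>0)) (nhds z\<^sub>0)"
      using has_derivative_continuous[OF JF] tendsto_at_iff_tendsto_nhds[of "\<lambda>z. J (F z)" z\<^sub>0]
      by (simp add: continuous_at)
  qed (use U(2) z1 in simp)
  then have w: "\<forall>\<^sub>F z in nhds z\<^sub>0. w z = g\<^sub>0 (J (F z)) \<and> w z \<in> sphere 0 1 \<times> sphere 0 1"
  proof eventually_elim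
    case (elim z)
    have "J (F z) \<in> T" using J(2) F_in by blast
    then show ?case using elim U(4) g0_image unfolding w_def by (metis image_eqI)
  qed
  have w0: "w z\<^sub>0 = circ2 z\<^sub>1"
    using U(2,4) F_in g0_F z1 unfolding w_def by metis
  obtain \<sigma>1 \<sigma>1' where 1: "(\<sigma>1 has_derivative \<sigma>1') (at z\<^sub>0)" "\<sigma>1 z\<^sub>0 = fst z\<^sub>1" "\<forall>\<^sub>F z in nhds z\<^sub>0. circ (\<sigma>1 z) = fst (w z)"
  proof (rule local_angle)
    show "\<forall>\<^sub>F z in nhds z\<^sub>0. norm (fst (w z)) = 1"
      using w by eventually_elim (auto simp: mem_Times_iff)
    show "((\<lambda>z. fst (w z)) has_derivative (\<lambda>h. fst (w' h))) (at z\<^sub>0)" using w' by (rule has_derivative_fst)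
    show "fst (w z\<^sub>0) = circ (fst z\<^sub>1)" by (simp add: w0 circ2_def)
  qed
  obtain \<sigma>2 \<sigma>2' where 2: "(\<sigma>2 has_derivative \<sigma>2') (at z\<^sub>0)" "\<sigma>2 z\<^sub>0 = snd z\<^sub>1" "\<forall>\<^sub>F z in nhds z\<^sub>0. circ (\<sigma>2 z) = snd (w z)"
  proof (rule local_angle)
    show "\<forall>\<^sub>F z in nhds z\<^sub>0. norm (snd (w z)) = 1"
      using w by eventually_elim (auto simp: mem_Times_iff)
    show "((\<lambda>z. snd (w z)) has_derivative (\<lambda>h. snd (w' h))) (at z\<^sub>0)" using w' by (rule has_derivative_snd)
    show "snd (w z\<^sub>0) = circ (snd z\<^sub>1)" by (simp add: w0 circ2_def)
  qed
  show ?thesis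
  proof
    show "((\<lambda>z. (\<sigma>1 z, \<sigma>2 z)) has_derivative (\<lambda>h. (\<sigma>1' h, \<sigma>2' h))) (at z\<^sub>0)"
      using 1(1) 2(1) by (rule has_derivative_Pair)
    show "(\<sigma>1 z\<^sub>0, \<sigma>2 z\<^sub>0) = z\<^sub>1" using 1(2) 2(2) by simp
    show "\<forall>\<^sub>F z in nhds z\<^sub>0. F (\<sigma>1 z, \<sigma>2 z) = J (F z)"
      using 1(3) 2(3) w
    proof eventually_elim
      case (elim z)
      then have "circ2 (\<sigma>1 z, \<sigma>2 z) = g\<^sub>0 (J (F z))" by (simp add: circ2_def prod_eq_iff)
      then show ?case using f0_g0 J(2) F_in unfolding F_def[of "(\<sigma>1 z, \<sigma>2 z)"] by metis
    qed
  qed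
qed

text \<open>\<open>pull1\<close> du + \<open>pull2\<close> dv is the pullback under F of the
  one-form dual to W. \<open>dpull\<close> is the v-derivative of the first coefficient and, for a
  closed form, also the u-derivative of the second.\<close>

definition pull1 :: "(real^3 \<Rightarrow> real^3) \<Rightarrow> real \<Rightarrow> real \<Rightarrow> real" where
  "pull1 W u v = W (F (u, v)) \<bullet> DF (u, v) (1, 0)"
definition pull2 :: "(real^3 \<Rightarrow> real^3) \<Rightarrow> real \<Rightarrow> real \<Rightarrow> real" where
  "pull2 W u v = W (F (u, v)) \<bullet> DF (u, v) (0, 1)"
definition dpull :: "(real^3 \<Rightarrow> real^3) \<Rightarrow> real \<Rightarrow> real \<Rightarrow> real" where
  "dpull W u v = frechet_derivative (\<lambda>z. W (F z) \<bullet> DF z (1, 0)) (at (u, v)) (0, 1)"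

lemma pull_eq: "x * pull1 W u v + y * pull2 W u v = W (F (u, v)) \<bullet> DF (u, v) (x, y)"
proof -
  interpret D: bounded_linear "DF (u, v)"
    using F_has_derivative has_derivative_bounded_linear by blast
  have "DF (u, v) (x, y) = x *\<^sub>R DF (u, v) (1, 0) + y *\<^sub>R DF (u, v) (0, 1)"
    by (simp flip: D.scaleR D.add)
  then show ?thesis by (simp add: pull1_def pull2_def inner_add_right)
qed

lemma pull_periodic:
  "pull1 W (u + 2 * pi) v = pull1 W u v" "pull1 W u (v + 2 * pi) = pull1 W u v"
  "pull2 W (u + 2 * pi) v = pull2 W u v" "pull2 W u (v + 2 * pi) = pull2 W u v"
  by (simp_all add: pull1_def pull2_def F_periodic DF_periodic)

text \<open>Exterior derivative commutes with pullback: the second derivatives of F cancel by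
  symmetry, and what is left is curl W . (F_u x F_v).\<close>

lemma pullback_closed:
  assumes X: "open X" "T \<subseteq> X" and W: "Ck_on 1 X W"
    and curl: "\<And>z. curl_vec (frechet_derivative W (at (F z))) \<bullet> cross3 (DF z (1, 0)) (DF z (0, 1)) = 0"
  shows "continuous_on UNIV (\<lambda>(u, v). pull1 W u v)" "continuous_on UNIV (\<lambda>(u, v). pull2 W u v)"
    "continuous_on UNIV (\<lambda>(u, v). dpull W u v)"
    "(pull1 W u has_real_derivative dpull W u v) (at v)"
    "((\<lambda>u. pull2 W u v) has_real_derivative dpull W u v) (at u)"
proof -
  have dW: "(W has_derivative frechet_derivative W (at (F z))) (at (F z))" for z
    using Ck_on_has_derivative[OF W[unfolded One_nat_def]] F_in X(2) by blast
  have DF1: "Ck_on 1 UNIV (\<lambda>z. DF z e)" for e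
    using Ck_F[of "Suc 1"] unfolding DF_def Ck_on.simps(2)[of 1] by blast
  have WF: "Ck_on 1 UNIV (\<lambda>z. W (F z))"
    by (rule Ck_on_compose[OF open_UNIV Ck_F W]) (use F_in X(2) in auto)
  have C1: "Ck_on 1 UNIV (\<lambda>z. W (F z) \<bullet> DF z e)" for e
    by (rule Ck_on_bilinear[OF bounded_bilinear_inner open_UNIV WF DF1])
  have dC: "((\<lambda>z. W (F z) \<bullet> DF z e) has_derivative (\<lambda>h. W (F z) \<bullet> frechet_derivative (\<lambda>z. DF z e) (at z) h
      + frechet_derivative W (at (F z)) (DF z h) \<bullet> DF z e)) (at z)" for e z
  proof (rule has_derivative_inner)
    from has_derivative_compose[OF F_has_derivative dW]
    show "((\<lambda>z. W (F z)) has_derivative (\<lambda>h. frechet_derivative W (at (F z)) (DF z h))) (at z)" .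
    show "((\<lambda>z. DF z e) has_derivative frechet_derivative (\<lambda>z. DF z e) (at z)) (at z)"
      by (rule Ck_on_has_derivative[OF DF1[unfolded One_nat_def]]) simp
  qed
  have mixed: "frechet_derivative (\<lambda>z. DF z (1, 0)) (at z) (0, 1) = frechet_derivative (\<lambda>z. DF z (0, 1)) (at z) (1, 0)" for z
    unfolding DF_def by (rule second_derivative_symmetric[OF open_UNIV UNIV_I Ck_F])
  have closed: "frechet_derivative (\<lambda>z. W (F z) \<bullet> DF z (0, 1)) (at z) (1, 0)
      = frechet_derivative (\<lambda>z. W (F z) \<bullet> DF z (1, 0)) (at z) (0, 1)" for z
  proof -
    have "linear (frechet_derivative W (at (F z)))"
      using has_derivative_bounded_linear[OF dW] by (rule bounded_linear.linear)
    from curl_vec_inner_cross[OF this, of "DF z (1, 0)" "DF z (0, 1)"] curl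
    show ?thesis
      unfolding frechet_derivative_at[OF dC, symmetric] by (simp add: mixed)
  qed
  show "continuous_on UNIV (\<lambda>(u, v). pull1 W u v)" "continuous_on UNIV (\<lambda>(u, v). pull2 W u v)"
    using Ck_on_continuous[OF C1] by (simp_all add: pull1_def pull2_def case_prod_beta)
  have "continuous_on UNIV (\<lambda>z. frechet_derivative (\<lambda>z. W (F z) \<bullet> DF z (1, 0)) (at z) (0, 1))"
    using C1[of "(1, 0)"] unfolding One_nat_def Ck_on.simps by blast
  then show "continuous_on UNIV (\<lambda>(u, v). dpull W u v)"
    by (simp add: dpull_def case_prod_beta)
  have d: "((\<lambda>z. W (F z) \<bullet> DF z e) has_derivative frechet_derivative (\<lambda>z. W (F z) \<bullet> DF z e) (at z)) (at z)" for e z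
    by (rule Ck_on_has_derivative[OF C1[unfolded One_nat_def]]) simp
  have "((\<lambda>s. W (F ((u, 0) + s *\<^sub>R (0, 1))) \<bullet> DF ((u, 0) + s *\<^sub>R (0, 1)) (1, 0)) has_derivative
      (\<lambda>h. h *\<^sub>R frechet_derivative (\<lambda>z. W (F z) \<bullet> DF z (1, 0)) (at (u, v)) (0, 1))) (at v)"
    by (rule has_derivative_along_line) (use d[of "(1, 0)" "(u, v)"] in simp)
  then show "(pull1 W u has_real_derivative dpull W u v) (at v)"
    by (simp add: pull1_def[abs_def] dpull_def has_field_derivative_def mult_commute_abs)
  have "((\<lambda>s. W (F ((0, v) + s *\<^sub>R (1, 0))) \<bullet> DF ((0, v) + s *\<^sub>R (1, 0)) (0, 1)) has_derivative
      (\<lambda>h. h *\<^sub>R frechet_derivative (\<lambda>z. W (F z) \<bullet> DF z (0, 1)) (at (u, v)) (1, 0))) (at u)"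
    by (rule has_derivative_along_line) (use d[of "(0, 1)" "(u, v)"] in simp)
  then show "((\<lambda>u. pull2 W u v) has_real_derivative dpull W u v) (at u)"
    by (simp add: pull2_def[abs_def] dpull_def has_field_derivative_def mult_commute_abs closed)
qed

end

section \<open>Symmetric fields on an invariant torus\<close>

lemma half_turn_nth [simp]: "half_turn x $ 1 = x $ 1" "half_turn x $ 2 = - x $ 2" "half_turn x $ 3 = - x $ 3"
  by (simp_all add: half_turn_def)

lemma half_turn_half_turn [simp]: "half_turn (half_turn x) = x"
  by (simp add: vec_eq_iff forall_3)

lemma linear_half_turn: "linear half_turn"
  by (rule linearI) (simp_all add: vec_eq_iff forall_3)

lemma bounded_linear_half_turn: "bounded_linear half_turn"
  using linear_half_turn by (rule linear_conv_bounded_linear[THEN iffD1])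

lemma inner_half_turn: "half_turn x \<bullet> half_turn y = x \<bullet> y"
  by (simp add: inner_vec_def sum_3)

lemma cross3_half_turn: "cross3 (half_turn x) (half_turn y) = half_turn (cross3 x y)"
  by (simp add: vec_eq_iff forall_3 cross3_def)

lemma planar_half_turn: "planar (half_turn x) = cnj (planar x)"
  by (simp add: planar_def complex_eq_iff)

lemma bounded_linear_planar: "bounded_linear planar"
proof -
  have "linear planar"
    by (rule linearI) (simp_all add: planar_def complex_eq_iff)
  then show ?thesis by (rule linear_conv_bounded_linear[THEN iffD1])
qed

lemma continuous_log_has_derivative:
  fixes L :: "'a::real_normed_vector \<Rightarrow> complex"
  assumes L: "isCont L z" and h: "\<And>z. h z = exp (L z)" and h': "(h has_derivative h') (at z)"
  shows "(L has_derivative (\<lambda>v. h' v / h z)) (at z)"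
proof -
  have hz: "h z \<noteq> 0" by (simp add: h)
  have "((\<lambda>w. h w / h z) has_derivative (\<lambda>v. h' v / h z)) (at z)"
    using bounded_linear.has_derivative[OF bounded_linear_divide h'] .
  moreover have "(Ln has_derivative (\<lambda>v. v)) (at (h z / h z))"
    using has_field_derivative_Ln[of 1] hz by (simp add: has_field_derivative_def fun_eq_iff[of "(*) 1" "\<lambda>v. v", THEN iffD2])
  ultimately have "((\<lambda>w. Ln (h w / h z)) has_derivative (\<lambda>v. h' v / h z)) (at z)"
    by (rule has_derivative_compose)
  from has_derivative_add[OF has_derivative_const[of "L z"] this]
  have 1: "((\<lambda>w. L z + Ln (h w / h z)) has_derivative (\<lambda>v. h' v / h z)) (at z)" by simp
  have "\<forall>\<^sub>F w in at z. dist (L w) (L z) < 1"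
    using L unfolding isCont_def by (intro tendstoD) auto
  then have "\<forall>\<^sub>F w in at z. L z + Ln (h w / h z) = L w"
  proof eventually_elim
    case (elim w)
    have "\<bar>Im (L w - L z)\<bar> < 1"
      using elim abs_Im_le_cmod[of "L w - L z"] by (simp add: dist_norm)
    then have "- pi < Im (L w - L z)" "Im (L w - L z) \<le> pi"
      using pi_gt3 unfolding abs_less_iff by linarith+
    then have "Ln (exp (L w - L z)) = L w - L z" by (rule Ln_exp)
    then show ?case by (simp add: h exp_diff)
  qed
  then show ?thesis
    by (rule has_derivative_transform_eventually[OF 1]) (use hz in auto)
qed

text \<open>X is a neighbourhood of T on which the gradient G does not vanish. The differential
  conditions need this room around T, while the symmetry is asked for on T alone.\<close>

locale torus_field = torus_param T f\<^sub>0 g\<^sub>0 for T f\<^sub>0 g\<^sub>0 +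
  fixes X :: "(real^3) set" and p :: "real^3 \<Rightarrow> real" and G C :: "real^3 \<Rightarrow> real^3" and c :: real
  assumes openX: "open X" and TX: "T \<subseteq> X" and off_axis: "T \<inter> z_axis = {}"
    and p: "\<And>x. x \<in> X \<Longrightarrow> (p has_derivative (\<lambda>v. G x \<bullet> v)) (at x)" and Ckp: "Ck_on 2 X p"
    and level: "\<And>x. x \<in> T \<Longrightarrow> p x = c"
    and CkG: "Ck_on 1 X G" and Gnz: "\<And>x. x \<in> X \<Longrightarrow> G x \<noteq> 0"
    and CkC: "Ck_on 1 X C" and orth: "\<And>x. x \<in> X \<Longrightarrow> C x \<bullet> G x = 0"
    and curlC: "\<And>x. x \<in> X \<Longrightarrow> curl_vec (frechet_derivative C (at x)) \<bullet> G x = 0"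
    and divC: "\<And>x. x \<in> X \<Longrightarrow> div_sum (frechet_derivative C (at x)) = 0"
    and symT: "\<And>x. x \<in> T \<Longrightarrow> half_turn x \<in> T"
    and symG: "\<And>x. x \<in> T \<Longrightarrow> G (half_turn x) = half_turn (G x)"
    and symC: "\<And>x. x \<in> T \<Longrightarrow> C (half_turn x) = half_turn (C x)"
begin

lemma FX: "F z \<in> X"
  using F_in TX by blast

lemma tangent: "G (F z) \<bullet> DF z h = 0"
proof -
  have "((\<lambda>z. p (F z)) has_derivative (\<lambda>h. G (F z) \<bullet> DF z h)) (at z)"
    by (rule has_derivative_compose[OF F_has_derivative p[OF FX]])
  moreover have "(\<lambda>z. p (F z)) = (\<lambda>z. c)" using level F_in by auto
  ultimately have "((\<lambda>z. c) has_derivative (\<lambda>h. G (F z) \<bullet> DF z h)) (at z)" by simp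
  from has_derivative_unique[OF this has_derivative_const] show ?thesis by metis
qed

definition N :: "real^3 \<Rightarrow> real^3" where "N x = G x /\<^sub>R (G x \<bullet> G x)"
text \<open>The field dual to \<beta>: C turned by a right angle within the level surface and
  divided by the length of the gradient.\<close>

definition E :: "real^3 \<Rightarrow> real^3" where "E x = cross3 (N x) (C x)"

lemma CkN: "Ck_on 1 X N"
  unfolding N_def[abs_def]
  by (rule Ck_on_divide[OF openX CkG Ck_on_bilinear[OF bounded_bilinear_inner openX CkG CkG]])
    (use Gnz in simp)

lemma CkE: "Ck_on 1 X E"
  unfolding E_def[abs_def] by (rule Ck_on_bilinear[OF bounded_bilinear_cross3 openX CkN CkC])

lemma C1_has_derivative:
  assumes "Ck_on 1 X W" "x \<in> X"
  shows "(W has_derivative frechet_derivative W (at x)) (at x)"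
  by (rule Ck_on_has_derivative[OF assms(1)[unfolded One_nat_def] assms(2)])

lemma C1_linear:
  assumes "Ck_on 1 X W" "x \<in> X"
  shows "linear (frechet_derivative W (at x))"
  using has_derivative_bounded_linear[OF C1_has_derivative[OF assms]] by (rule bounded_linear.linear)

lemma hessian_symmetric:
  assumes x: "x \<in> X"
  shows "frechet_derivative G (at x) v \<bullet> w = frechet_derivative G (at x) w \<bullet> v"
proof -
  have "frechet_derivative (\<lambda>z. frechet_derivative p (at z) v) (at x) w = frechet_derivative G (at x) w \<bullet> v" for v w
  proof -
    have "((\<lambda>z. G z \<bullet> v) has_derivative (\<lambda>w. frechet_derivative G (at x) w \<bullet> v)) (at x)"
      by (rule has_derivative_inner_left[OF C1_has_derivative[OF CkG x]])
    then have "((\<lambda>z. frechet_derivative p (at z) v) has_derivative (\<lambda>w. frechet_derivative G (at x) w \<bullet> v)) (at x)"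
    proof (rule has_derivative_transform_within_open[OF _ openX x])
      show "G z \<bullet> v = frechet_derivative p (at z) v" if "z \<in> X" for z
        using frechet_derivative_at[OF p[OF that]] by metis
    qed
    then show ?thesis using frechet_derivative_at by metis
  qed
  then show ?thesis
    using second_derivative_symmetric_real[OF openX x Ckp, of v w] by simp
qed

text \<open>The identity \<open>curl (N \<times> C) = (div C) N - (div N) C + (C\<cdot>\<nabla>) N - (N\<cdot>\<nabla>) C\<close>, paired with \<open>\<nabla>p\<close>: the last
  two terms cancel by symmetry of the Hessian of \<open>p\<close>, since \<open>C\<cdot>\<nabla>p = 0\<close> and \<open>N\<cdot>\<nabla>p = 1\<close>.\<close>

lemma curlE:
  assumes x: "x \<in> X"
  shows "curl_vec (frechet_derivative E (at x)) \<bullet> G x = 0"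
proof -
  let ?K = "frechet_derivative N (at x)" and ?L = "frechet_derivative C (at x)" and ?H = "frechet_derivative G (at x)"
  have "(E has_derivative (\<lambda>v. cross3 (N x) (?L v) + cross3 (?K v) (C x))) (at x)"
    unfolding E_def[abs_def]
    by (rule bounded_bilinear.FDERIV[OF bounded_bilinear_cross3 C1_has_derivative[OF CkN x] C1_has_derivative[OF CkC x]])
  then have DE: "frechet_derivative E (at x) = (\<lambda>v. cross3 (N x) (?L v) + cross3 (?K v) (C x))"
    by (rule frechet_derivative_at[symmetric])
  have "((\<lambda>z. C z \<bullet> G z) has_derivative (\<lambda>v. C x \<bullet> ?H v + ?L v \<bullet> G x)) (at x)"
    by (rule has_derivative_inner[OF C1_has_derivative[OF CkC x] C1_has_derivative[OF CkG x]])
  then have "((\<lambda>z. 0) has_derivative (\<lambda>v. C x \<bullet> ?H v + ?L v \<bullet> G x)) (at x)"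
    by (rule has_derivative_transform_within_open[OF _ openX x]) (use orth in simp)
  from has_derivative_unique[OF this has_derivative_const]
  have C: "C x \<bullet> ?H v + ?L v \<bullet> G x = 0" for v by metis
  have NG: "N z \<bullet> G z = 1" if "z \<in> X" for z using Gnz[OF that] by (simp add: N_def)
  have "((\<lambda>z. N z \<bullet> G z) has_derivative (\<lambda>v. N x \<bullet> ?H v + ?K v \<bullet> G x)) (at x)"
    by (rule has_derivative_inner[OF C1_has_derivative[OF CkN x] C1_has_derivative[OF CkG x]])
  then have "((\<lambda>z. 1) has_derivative (\<lambda>v. N x \<bullet> ?H v + ?K v \<bullet> G x)) (at x)"
    by (rule has_derivative_transform_within_open[OF _ openX x]) (use NG in simp)
  from has_derivative_unique[OF this has_derivative_const]
  have N: "N x \<bullet> ?H v + ?K v \<bullet> G x = 0" for v by metis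
  have "?K (C x) \<bullet> G x - ?L (N x) \<bullet> G x = 0"
    using N[of "C x"] C[of "N x"] hessian_symmetric[OF x, of "C x" "N x"] by (simp add: inner_commute)
  then show ?thesis
    unfolding DE curl_vec_cross[OF C1_linear[OF CkN x] C1_linear[OF CkC x]]
    using divC[OF x] orth[OF x] by (simp add: inner_add_left inner_diff_left)
qed

text \<open>Vectors tangent to the level have a cross product along the gradient, so the normal
  component of the curl is the only obstruction to closedness.\<close>

lemma pull_closed:
  assumes W: "Ck_on 1 X W" and curl: "\<forall>x\<in>X. curl_vec (frechet_derivative W (at x)) \<bullet> G x = 0"
  shows "continuous_on UNIV (\<lambda>(u, v). pull1 W u v)" "continuous_on UNIV (\<lambda>(u, v). pull2 W u v)"
    "continuous_on UNIV (\<lambda>(u, v). dpull W u v)"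
    "(pull1 W u has_real_derivative dpull W u v) (at v)"
    "((\<lambda>u. pull2 W u v) has_real_derivative dpull W u v) (at u)"
proof -
  have "curl_vec (frechet_derivative W (at (F z))) \<bullet> cross3 (DF z (1, 0)) (DF z (0, 1)) = 0" for z
  proof -
    obtain l where l: "cross3 (DF z (1, 0)) (DF z (0, 1)) = l *\<^sub>R G (F z)"
      using cross_parallel[OF Gnz[OF FX]] tangent by (metis inner_commute)
    show ?thesis unfolding l using bspec[OF curl FX] by simp
  qed
  note * = pullback_closed[OF openX TX W this]
  show "continuous_on UNIV (\<lambda>(u, v). pull1 W u v)" "continuous_on UNIV (\<lambda>(u, v). pull2 W u v)"
    "continuous_on UNIV (\<lambda>(u, v). dpull W u v)"
    "(pull1 W u has_real_derivative dpull W u v) (at v)"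
    "((\<lambda>u. pull2 W u v) has_real_derivative dpull W u v) (at u)"
    by (fact *)+
qed

text \<open>Up to sign, the area density of F times the length of the gradient.\<close>

definition jac :: "real \<times> real \<Rightarrow> real" where
  "jac z = cross3 (DF z (1, 0)) (DF z (0, 1)) \<bullet> G (F z)"

lemma jac_nonzero: "jac z \<noteq> 0"
proof
  assume jac: "jac z = 0"
  obtain l where l: "cross3 (DF z (1, 0)) (DF z (0, 1)) = l *\<^sub>R G (F z)"
    using cross_parallel[OF Gnz[OF FX]] tangent by (metis inner_commute)
  then have "l = 0" using jac Gnz[OF FX] by (simp add: jac_def)
  then have "collinear {0, DF z (1, 0), DF z (0, 1)}"
    using l by (simp flip: cross_eq_0)
  then have "DF z (1, 0) = 0 \<or> DF z (0, 1) = 0 \<or> (\<exists>a. DF z (0, 1) = a *\<^sub>R DF z (1, 0))"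
    by (simp add: collinear_lemma)
  moreover interpret D: bounded_linear "DF z"
    using F_has_derivative has_derivative_bounded_linear by blast
  have "(a, - 1 :: real) = 0" if "DF z (0, 1) = a *\<^sub>R DF z (1, 0)" for a :: real
  proof (rule DF_injective)
    have "DF z (a, - 1) = a *\<^sub>R DF z (1, 0) - DF z (0, 1)"
      by (simp flip: D.scaleR D.diff)
    then show "DF z (a, - 1) = 0" using that by simp
  qed
  ultimately show False
    using DF_injective[of z "(1, 0)"] DF_injective[of z "(0, 1)"] by (auto simp: zero_prod_def)
qed

lemma continuous_jac: "continuous_on UNIV jac"
proof -
  have "Ck_on 0 UNIV (\<lambda>z. DF z e)" for e
    using Ck_F[of "Suc 0"] unfolding DF_def Ck_on.simps(2) by blast
  then have "continuous_on UNIV (\<lambda>z. DF z e)" for e by simp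
  moreover have "continuous_on UNIV (\<lambda>z. G (F z))"
    by (rule continuous_on_compose2[OF Ck_on_continuous[OF CkG] contF]) (use FX in auto)
  ultimately show ?thesis
    unfolding jac_def[abs_def] by (intro continuous_on_inner continuous_on_cross)
qed

text \<open>A continuous nowhere zero function on the plane keeps its sign. The product form avoids
  the choice of an orientation of T.\<close>

lemma jac_sign: "0 < jac z * jac w"
proof (rule ccontr)
  assume "\<not> ?thesis"
  then have neg: "jac z * jac w < 0" using jac_nonzero[of z] jac_nonzero[of w] by (simp add: not_less le_less)
  have "connected (jac ` UNIV)"
    by (intro connected_continuous_image continuous_jac connected_UNIV)
  then have "is_interval (range jac)" by (simp add: is_interval_connected_1)
  moreover have "(jac z \<le> 0 \<and> 0 \<le> jac w) \<or> (jac w \<le> 0 \<and> 0 \<le> jac z)"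
    using neg by (auto simp: mult_less_0_iff)
  ultimately have "0 \<in> range jac"
    unfolding is_interval_1 by (meson rangeI)
  then show False using jac_nonzero by auto
qed

lemma wedge: "pull1 C u v * pull2 E u v - pull2 C u v * pull1 E u v
    = (C (F (u, v)) \<bullet> C (F (u, v))) * jac (u, v) / (G (F (u, v)) \<bullet> G (F (u, v)))"
proof -
  let ?x = "F (u, v)"
  have E: "E ?x = cross3 (G ?x) (C ?x) /\<^sub>R (G ?x \<bullet> G ?x)"
    by (simp add: E_def N_def cross_mult_left)
  have "(C ?x \<bullet> DF (u, v) (1, 0)) * (cross3 (G ?x) (C ?x) \<bullet> DF (u, v) (0, 1))
      - (C ?x \<bullet> DF (u, v) (0, 1)) * (cross3 (G ?x) (C ?x) \<bullet> DF (u, v) (1, 0))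
      = (C ?x \<bullet> C ?x) * jac (u, v)"
    unfolding jac_def using tangent
    by (intro wedge_tangent Gnz FX orth) (simp_all add: inner_commute)
  then show ?thesis
    unfolding pull1_def pull2_def E by (simp add: divide_inverse algebra_simps flip: distrib_left)
qed

lemma symE: "x \<in> T \<Longrightarrow> E (half_turn x) = half_turn (E x)"
  by (simp add: E_def N_def symG symC inner_half_turn cross3_half_turn linear_cmul[OF linear_half_turn]
      flip: linear_cmul[OF linear_half_turn])

lemma periods:
  assumes W: "Ck_on 1 X W" and curl: "\<forall>x\<in>X. curl_vec (frechet_derivative W (at x)) \<bullet> G x = 0"
  obtains f a\<^sub>1 a\<^sub>2 where "\<And>u v. (f has_derivative (\<lambda>(x, y). x * pull1 W u v + y * pull2 W u v)) (at (u, v))"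
    "\<And>z. (f has_derivative (\<lambda>h. W (F z) \<bullet> DF z h)) (at z)"
    "\<And>u v. f (u + 2 * pi, v) = f (u, v) + a\<^sub>1" "\<And>u v. f (u, v + 2 * pi) = f (u, v) + a\<^sub>2"
proof -
  obtain f where f: "\<And>u v. (f has_derivative (\<lambda>(x, y). x * pull1 W u v + y * pull2 W u v)) (at (u, v))"
    using closed_form_primitive[OF pull_closed[OF W curl]] by metis
  have "(f has_derivative (\<lambda>h. W (F z) \<bullet> DF z h)) (at z)" for z
  proof -
    have "(\<lambda>(x, y). x * pull1 W (fst z) (snd z) + y * pull2 W (fst z) (snd z)) = (\<lambda>h. W (F z) \<bullet> DF z h)"
      by (auto simp: pull_eq fun_eq_iff)
    then show ?thesis using f[of "fst z" "snd z"] by simp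
  qed
  moreover have "f (u + 2 * pi, v + 0) = f (u, v) + (f (2 * pi, 0) - f (0, 0))" for u v
    by (rule constant_period[OF f]) (simp_all add: pull_periodic)
  moreover have "f (u + 0, v + 2 * pi) = f (u, v) + (f (0, 2 * pi) - f (0, 0))" for u v
    by (rule constant_period[OF f]) (simp_all add: pull_periodic)
  ultimately show ?thesis using that[of f] f by simp
qed

lemma field_zero_or_log: "has_log T \<or> (\<forall>x\<in>T. C x = 0)"
proof (rule disjCI)
  assume "\<not> (\<forall>x\<in>T. C x = 0)"
  then obtain x\<^sub>0 where x0: "x\<^sub>0 \<in> T" "C x\<^sub>0 \<noteq> 0" by blast
  have curlC': "\<forall>x\<in>X. curl_vec (frechet_derivative C (at x)) \<bullet> G x = 0"
    and curlE': "\<forall>x\<in>X. curl_vec (frechet_derivative E (at x)) \<bullet> G x = 0"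
    using curlC curlE by blast+
  obtain f a\<^sub>1 a\<^sub>2 where f: "\<And>u v. (f has_derivative (\<lambda>(x, y). x * pull1 C u v + y * pull2 C u v)) (at (u, v))"
    "\<And>z. (f has_derivative (\<lambda>h. C (F z) \<bullet> DF z h)) (at z)"
    "\<And>u v. f (u + 2 * pi, v) = f (u, v) + a\<^sub>1" "\<And>u v. f (u, v + 2 * pi) = f (u, v) + a\<^sub>2"
    by (fact periods[OF CkC curlC'])
  obtain h b\<^sub>1 b\<^sub>2 where h: "\<And>u v. (h has_derivative (\<lambda>(x, y). x * pull1 E u v + y * pull2 E u v)) (at (u, v))"
    "\<And>z. (h has_derivative (\<lambda>w. E (F z) \<bullet> DF z w)) (at z)"
    "\<And>u v. h (u + 2 * pi, v) = h (u, v) + b\<^sub>1" "\<And>u v. h (u, v + 2 * pi) = h (u, v) + b\<^sub>2"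
    by (fact periods[OF CkE curlE'])
  note clC = pull_closed[OF CkC curlC'] and clE = pull_closed[OF CkE curlE']
  let ?I = "\<lambda>(u, v). pull1 C u v * pull2 E u v - pull2 C u v * pull1 E u v"
  let ?Q = "cbox (0, 0) (2 * pi, 2 * pi) :: (real \<times> real) set"
  have int: "integral ?Q ?I = a\<^sub>1 * b\<^sub>2 - a\<^sub>2 * b\<^sub>1"
    by (rule riemann_bilinear[OF f(1) h(1) clC(1,2) clE(3,4,5,1,2)])
      (use pull_periodic[of E 0] pull_periodic[of E _ 0] pull_periodic(2)[of E _ 0] pull_periodic(3)[of E 0]
        f(3)[of 0] f(4)[of _ 0] h(3)[of 0 0] h(4)[of 0 0] in auto)
  have det: "a\<^sub>1 * b\<^sub>2 - a\<^sub>2 * b\<^sub>1 \<noteq> 0"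
  proof
    assume 0: "a\<^sub>1 * b\<^sub>2 - a\<^sub>2 * b\<^sub>1 = 0"
    obtain z where z: "z \<in> ?Q" "F z = x\<^sub>0" using x0(1) by (rule F_onto)
    \<comment> \<open>The integrand has the sign of \<open>jac\<close> or vanishes. That sign is
      constant but unknown, and the factor \<open>jac z\<close> makes the product nonnegative. A
      continuous nonnegative function with integral zero vanishes on the whole closed square, in
      particular at z.\<close>
    let ?J = "\<lambda>w. ?I w * jac z"
    have contI: "continuous_on ?Q ?I"
      using clC(1,2) clE(1,2) unfolding case_prod_beta
      by (auto intro!: continuous_intros intro: continuous_on_subset)
    have "(?I has_integral 0) ?Q"
      using integrable_integral[OF integrable_continuous[OF contI]] unfolding int 0 .
    from has_integral_mult_left[OF this, of "jac z"]
    have "(?J has_integral 0) ?Q" by simp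
    moreover have J: "?J w = (C (F w) \<bullet> C (F w)) * (jac w * jac z) / (G (F w) \<bullet> G (F w))" for w
      using wedge[of "fst w" "snd w"] by (simp add: case_prod_beta)
    have "0 \<le> ?J w" for w
      unfolding J by (rule divide_nonneg_nonneg[OF mult_nonneg_nonneg[OF inner_ge_zero less_imp_le[OF jac_sign]] inner_ge_zero])
    moreover have "continuous_on ?Q ?J"
      by (rule continuous_on_mult_right[OF contI])
    moreover have "box (0, 0) (2 * pi, 2 * pi :: real) \<noteq> {}"
      by (auto simp: box_ne_empty Basis_prod_def)
    ultimately have "?J z = 0"
      using has_integral_0_cbox_imp_0[of "(0, 0)" "(2 * pi, 2 * pi)" ?J z] z(1) by blast
    then have "C x\<^sub>0 = 0"
      unfolding J z(2) using jac_nonzero[of z] Gnz TX x0(1) by auto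
    then show False using x0(2) by simp
  qed
  have planar0: "planar x \<noteq> 0" if "x \<in> T" for x
    using that off_axis z_axis_iff by blast
  have "continuous_on UNIV (\<lambda>z. planar (F z))" by (intro continuous_intros contF)
  moreover have "contractible (UNIV :: (real \<times> real) set)" by (simp add: convex_imp_contractible)
  ultimately obtain L where L: "continuous_on UNIV L" "\<And>z. planar (F z) = exp (L z)"
    using continuous_logarithm_on_contractible[of UNIV "\<lambda>z. planar (F z)"] planar0 F_in by auto
  \<comment> \<open>The form d\<theta> at x applied to v, as the imaginary part of dw / w for the
    planar coordinate w.\<close>
  define e where "e x v = Im (planar v / planar x)" for x v
  have ImL: "((\<lambda>z. Im (L z)) has_derivative (\<lambda>v. e (F z) (DF z v))) (at z)" for z
  proof -
    have "isCont L z" using L(1) unfolding continuous_on_eq_continuous_at[OF open_UNIV] by blast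
    moreover have "((\<lambda>z. planar (F z)) has_derivative (\<lambda>v. planar (DF z v))) (at z)"
      by (rule bounded_linear.has_derivative[OF bounded_linear_planar F_has_derivative])
    ultimately have "(L has_derivative (\<lambda>v. planar (DF z v) / planar (F z))) (at z)"
      by (rule continuous_log_has_derivative[OF _ L(2)])
    then show ?thesis
      unfolding e_def by (rule bounded_linear.has_derivative[OF bounded_linear_Im])
  qed
  define P where "P u v = e (F (u, v)) (DF (u, v) (1, 0))" for u v
  define Q where "Q u v = e (F (u, v)) (DF (u, v) (0, 1))" for u v
  have ImL': "((\<lambda>z. Im (L z)) has_derivative (\<lambda>(x, y). x * P u v + y * Q u v)) (at (u, v))" for u v
  proof -
    interpret D: bounded_linear "\<lambda>w. e (F (u, v)) (DF (u, v) w)"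
      using ImL has_derivative_bounded_linear by blast
    have "e (F (u, v)) (DF (u, v) (x, y)) = x * P u v + y * Q u v" for x y
    proof -
      have "(x, y) = x *\<^sub>R (1, 0) + y *\<^sub>R (0, 1)" by simp
      then show ?thesis unfolding P_def Q_def by (metis D.add D.scaleR real_scaleR_def)
    qed
    then have "(\<lambda>(x, y). x * P u v + y * Q u v) = (\<lambda>w. e (F (u, v)) (DF (u, v) w))"
      by (auto simp: fun_eq_iff)
    then show ?thesis using ImL[of "(u, v)"] by simp
  qed
  define w\<^sub>1 w\<^sub>2 where "w\<^sub>1 = Im (L (2 * pi, 0)) - Im (L (0, 0))" and "w\<^sub>2 = Im (L (0, 2 * pi)) - Im (L (0, 0))"
  have "Im (L (u + 2 * pi, v + 0)) = Im (L (u, v)) + w\<^sub>1" for u v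
    unfolding w\<^sub>1_def by (rule constant_period[OF ImL']) (simp_all add: P_def Q_def F_periodic DF_periodic)
  then have L1: "Im (L (u + 2 * pi, v)) = Im (L (u, v)) + w\<^sub>1" for u v by simp
  have "Im (L (u + 0, v + 2 * pi)) = Im (L (u, v)) + w\<^sub>2" for u v
    unfolding w\<^sub>2_def by (rule constant_period[OF ImL']) (simp_all add: P_def Q_def F_periodic DF_periodic)
  then have L2: "Im (L (u, v + 2 * pi)) = Im (L (u, v)) + w\<^sub>2" for u v by simp
  define d where "d = a\<^sub>1 * b\<^sub>2 - a\<^sub>2 * b\<^sub>1"
  \<comment> \<open>Cramer's rule: s and t are the coefficients for which s f + t h has the same
    periods as the angle.\<close>
  define s where "s = (w\<^sub>1 * b\<^sub>2 - w\<^sub>2 * b\<^sub>1) / d"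
  define t where "t = (a\<^sub>1 * w\<^sub>2 - a\<^sub>2 * w\<^sub>1) / d"
  have d: "d \<noteq> 0" using det by (simp add: d_def)
  have st: "s * a\<^sub>1 + t * b\<^sub>1 = w\<^sub>1" "s * a\<^sub>2 + t * b\<^sub>2 = w\<^sub>2"
  proof -
    have "(w\<^sub>1 * b\<^sub>2 - w\<^sub>2 * b\<^sub>1) * a\<^sub>1 + (a\<^sub>1 * w\<^sub>2 - a\<^sub>2 * w\<^sub>1) * b\<^sub>1 = w\<^sub>1 * d"
      "(w\<^sub>1 * b\<^sub>2 - w\<^sub>2 * b\<^sub>1) * a\<^sub>2 + (a\<^sub>1 * w\<^sub>2 - a\<^sub>2 * w\<^sub>1) * b\<^sub>2 = w\<^sub>2 * d"
      by (simp_all add: d_def algebra_simps)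
    then show "s * a\<^sub>1 + t * b\<^sub>1 = w\<^sub>1" "s * a\<^sub>2 + t * b\<^sub>2 = w\<^sub>2"
      using d by (simp_all add: s_def t_def add_divide_distrib[symmetric])
  qed
  \<comment> \<open>A primitive of s \<alpha> + t \<beta> - d\<theta>, pulled back to the plane. Its
    periods vanish, so it descends to a function \<open>l\<close> on T.\<close>
  define k where "k z = s * f z + t * h z - Im (L z)" for z
  define W where "W x = s *\<^sub>R C x + t *\<^sub>R E x" for x
  have k': "(k has_derivative (\<lambda>v. W (F z) \<bullet> DF z v - e (F z) (DF z v))) (at z)" for z
  proof -
    have "((\<lambda>z. s * f z + t * h z - Im (L z)) has_derivative
        (\<lambda>v. s * (C (F z) \<bullet> DF z v) + t * (E (F z) \<bullet> DF z v) - e (F z) (DF z v))) (at z)"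
      by (intro has_derivative_diff has_derivative_add has_derivative_mult_right f(2) h(2) ImL)
    then show ?thesis by (simp add: k_def[abs_def] W_def inner_add_left)
  qed
  have k1: "k (u + 2 * pi, v) = k (u, v)" and k2: "k (u, v + 2 * pi) = k (u, v)" for u v
    using st by (simp_all add: k_def f(3,4) h(3,4) L1 L2 distrib_left flip: add.assoc)
  have "continuous_on UNIV k"
    using has_derivative_continuous[OF k'] by (auto intro!: continuous_at_imp_continuous_on)
  then obtain l where l: "continuous_on T l" "\<And>z. l (F z) = k z"
    using periodic_descends[OF k1 k2] by blast
  have symW: "W (half_turn x) = half_turn (W x)" if "x \<in> T" for x
    using that by (simp add: W_def symC symE linear_add[OF linear_half_turn] linear_cmul[OF linear_half_turn])
  have sym_e: "e (half_turn x) (half_turn v) = - e x v" for x v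
    unfolding e_def planar_half_turn by (simp flip: complex_cnj_divide)
  \<comment> \<open>After the half-turn the field part of the derivative keeps its sign and the
    angle part reverses it. Since \<open>l\<close> is known only to be continuous on T, a local lift
    expresses the composite through the differentiable \<open>k\<close>.\<close>
  have lift: "((\<lambda>z. l (half_turn (F z))) has_derivative (\<lambda>v. W (F z) \<bullet> DF z v + e (F z) (DF z v))) (at z)" for z
  proof -
    have "half_turn (F z) \<in> T" using symT F_in by blast
    then obtain z' where z': "F z' = half_turn (F z)" by (rule F_onto)
    obtain \<sigma> \<sigma>' where \<sigma>: "(\<sigma> has_derivative \<sigma>') (at z)" "\<sigma> z = z'" "\<forall>\<^sub>F w in nhds z. F (\<sigma> w) = half_turn (F w)"
      by (rule local_lift[OF bounded_linear_half_turn symT z'])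
    have ev: "\<forall>\<^sub>F w in at z. F (\<sigma> w) = half_turn (F w)"
      using \<sigma>(3) unfolding eventually_nhds_conv_at by blast
    have "(F has_derivative DF z') (at (\<sigma> z))" unfolding \<sigma>(2) by (rule F_has_derivative)
    from has_derivative_compose[OF \<sigma>(1) this]
    have "((\<lambda>w. half_turn (F w)) has_derivative (\<lambda>v. DF z' (\<sigma>' v))) (at z)"
      by (rule has_derivative_transform_eventually[OF _ ev]) (simp_all add: \<sigma>(2) z')
    from has_derivative_unique[OF this bounded_linear.has_derivative[OF bounded_linear_half_turn F_has_derivative]]
    have D: "DF z' (\<sigma>' v) = half_turn (DF z v)" for v by metis
    have "(k has_derivative (\<lambda>v. W (F z') \<bullet> DF z' v - e (F z') (DF z' v))) (at (\<sigma> z))"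
      unfolding \<sigma>(2) by (rule k')
    from has_derivative_compose[OF \<sigma>(1) this]
    have "((\<lambda>w. k (\<sigma> w)) has_derivative (\<lambda>v. W (F z) \<bullet> DF z v + e (F z) (DF z v))) (at z)"
      unfolding D z' symW[OF F_in] inner_half_turn sym_e by simp
    moreover have "\<forall>\<^sub>F w in at z. k (\<sigma> w) = l (half_turn (F w))"
      using ev by eventually_elim (metis l(2))
    moreover have "k (\<sigma> z) = l (half_turn (F z))" unfolding \<sigma>(2) z'[symmetric] l(2) ..
    ultimately show ?thesis by (rule has_derivative_transform_eventually) auto
  qed
  \<comment> \<open>In the difference the field part cancels, and half of it has derivative
    d\<theta> along F.\<close>
  define q where "q x = (l (half_turn x) - l x) / 2" for x
  have "((\<lambda>z. Im (L z) - q (F z)) has_derivative (\<lambda>v. 0)) (at z within UNIV)" for z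
  proof -
    have "((\<lambda>z. Im (L z) - (1 / 2) * (l (half_turn (F z)) - k z)) has_derivative
        (\<lambda>v. e (F z) (DF z v) - (1 / 2) * ((W (F z) \<bullet> DF z v + e (F z) (DF z v)) - (W (F z) \<bullet> DF z v - e (F z) (DF z v))))) (at z)"
      by (intro has_derivative_diff has_derivative_mult_right ImL lift k')
    then show ?thesis by (simp add: q_def l(2))
  qed
  then obtain \<kappa> where \<kappa>: "\<And>z. Im (L z) - q (F z) = \<kappa>"
    using has_derivative_zero_constant[of UNIV "\<lambda>z. Im (L z) - q (F z)"] by auto
  define g where "g x = Complex (ln (norm (planar x))) (q x + \<kappa>)" for x
  have "continuous_on T g"
  proof -
    have "continuous_on T (\<lambda>x. l (half_turn x))"
      by (rule continuous_on_compose2[OF l(1)])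
        (auto simp: symT intro: bounded_linear.continuous_on[OF bounded_linear_half_turn continuous_on_id])
    then show ?thesis
      unfolding g_def Complex_eq q_def using planar0 l(1) by (intro continuous_intros) auto
  qed
  moreover have "planar x = exp (g x)" if "x \<in> T" for x
  proof -
    from that obtain z where z: "F z = x" by (rule F_onto)
    have "norm (planar x) = exp (Re (L z))"
      using L(2)[of z] z by simp
    then have "g x = L z"
      using \<kappa>[of z] by (simp add: g_def z complex_eq_iff)
    then show ?thesis using L(2)[of z] z by simp
  qed
  ultimately show "has_log T" unfolding has_log_def by blast
qed

end

section \<open>Equilibria under the half-turn\<close>

lemma diffeomorphism_sym: "diffeomorphism S T f g \<Longrightarrow> diffeomorphism T S g f"
  unfolding diffeomorphism_def by simp

text \<open>The half-turn has determinant 1, so it carries curls to curls; an orientation-reversing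
  isometry would bring in a sign.\<close>

lemma curl_vec_half_turn:
  assumes "linear L"
  shows "curl_vec (\<lambda>v. half_turn (L (half_turn v))) = half_turn (curl_vec L)"
  using linear_nth_3[OF assms, of "half_turn (axis 1 1)"] linear_nth_3[OF assms, of "half_turn (axis 2 1)"]
    linear_nth_3[OF assms, of "half_turn (axis 3 1)"]
  by (simp add: curl_vec_def vec_eq_iff forall_3 axis_def)

lemma div_sum_half_turn:
  assumes "linear L"
  shows "div_sum (\<lambda>v. half_turn (L (half_turn v))) = div_sum L"
  using linear_nth_3[OF assms, of "half_turn (axis 1 1)"] linear_nth_3[OF assms, of "half_turn (axis 2 1)"]
    linear_nth_3[OF assms, of "half_turn (axis 3 1)"]
  by (simp add: div_sum_def sum_3 axis_def)

lemma inj_half_turn: "inj half_turn"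
  by (metis half_turn_half_turn injI)

locale half_turn_equilibrium = nested M D D' p \<gamma> for M D D' p \<gamma> +
  fixes B :: "real^3 \<Rightarrow> real^3"
  assumes invariant: "half_turn ` M = M" and equilibrium: "MHD_equilibrium M B p"
begin

lemma half_turn_in: "x \<in> M \<Longrightarrow> half_turn x \<in> M"
  using invariant by auto

lemma half_turn_interior: "x \<in> interior M \<Longrightarrow> half_turn x \<in> interior M"
proof -
  have "interior (half_turn ` M) = half_turn ` interior M"
    by (rule interior_injective_linear_image[OF linear_half_turn inj_half_turn])
  then show "x \<in> interior M \<Longrightarrow> half_turn x \<in> interior M"
    unfolding invariant by auto
qed

text \<open>The half-turn is linear and its own inverse; uniqueness of derivatives within a regular
  domain pins down the derivative that \<open>pushforward\<close> selects.\<close>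

lemma pushforward_half_turn:
  assumes "x \<in> M"
  shows "pushforward M half_turn B x = half_turn (B (half_turn x))"
proof -
  have inv: "inv_into M half_turn x = half_turn x"
    by (rule inv_into_f_eq) (simp_all add: half_turn_in assms inj_on_subset[OF inj_half_turn])
  have d: "(half_turn has_derivative half_turn) (at (half_turn x) within M)"
    by (rule bounded_linear_imp_has_derivative[OF bounded_linear_half_turn])
  then have "(half_turn has_derivative frechet_derivative half_turn (at (half_turn x) within M)) (at (half_turn x) within M)"
    using frechet_derivative_works unfolding differentiable_def by blast
  from has_derivative_within_regular_domain_unique[OF regular half_turn_in[OF assms] this d]
  show ?thesis by (simp add: pushforward_def inv)
qed

lemma smooth_B: "smooth_on M B"
  using equilibrium unfolding MHD_equilibrium_def by blast

lemma CkB: "Ck_on k (interior M) B"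
  by (rule smooth_on_interior_Ck[OF smooth_B])

definition DB :: "real^3 \<Rightarrow> real^3 \<Rightarrow> real^3" where "DB x = frechet_derivative B (at x)"

lemma B_has_derivative: "x \<in> interior M \<Longrightarrow> (B has_derivative DB x) (at x)"
  unfolding DB_def by (rule Ck_on_has_derivative[OF CkB])

lemma linear_DB: "x \<in> interior M \<Longrightarrow> linear (DB x)"
  using has_derivative_bounded_linear[OF B_has_derivative] bounded_linear.linear by blast

lemma force_balance:
  assumes "x \<in> interior M"
  shows "cross3 (curl_vec (DB x)) (B x) = grad M p x"
proof -
  have "x \<in> M" using assms interior_subset by blast
  then have "cross3 (curl M B x) (B x) = grad M p x"
    using equilibrium unfolding MHD_equilibrium_def by blast
  then show ?thesis unfolding curl_eq[OF assms] DB_def .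
qed

lemma div_DB:
  assumes "x \<in> interior M"
  shows "div_sum (DB x) = 0"
proof -
  have "x \<in> M" using assms interior_subset by blast
  then have "divergence M B x = 0"
    using equilibrium unfolding MHD_equilibrium_def by blast
  then show ?thesis unfolding divergence_eq[OF assms] DB_def .
qed

text \<open>A cross product is orthogonal to both of its factors.\<close>

lemma B_tangent: "x \<in> interior M \<Longrightarrow> B x \<bullet> grad M p x = 0"
  and J_tangent: "x \<in> interior M \<Longrightarrow> curl_vec (DB x) \<bullet> grad M p x = 0"
  by (simp_all add: force_balance[symmetric] dot_cross_self inner_commute)

definition rotB :: "real^3 \<Rightarrow> real^3" where "rotB x = half_turn (B (half_turn x))"

lemma rotB_has_derivative:
  assumes "x \<in> interior M"
  shows "(rotB has_derivative (\<lambda>v. half_turn (DB (half_turn x) (half_turn v)))) (at x)"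
proof -
  have "(half_turn has_derivative half_turn) (at x)"
    by (rule bounded_linear_imp_has_derivative[OF bounded_linear_half_turn])
  from has_derivative_compose[OF this B_has_derivative[OF half_turn_interior[OF assms]]]
  show ?thesis
    unfolding rotB_def[abs_def] by (rule bounded_linear.has_derivative[OF bounded_linear_half_turn])
qed

lemma Ck_rotB: "Ck_on k (interior M) rotB"
  unfolding rotB_def[abs_def]
  by (intro Ck_on_bounded_linear[OF bounded_linear_half_turn] open_interior
      Ck_on_compose[OF _ Ck_on_linear[OF bounded_linear_half_turn] CkB]) (auto intro: half_turn_interior)

lemma closure_eq_zero:
  fixes f :: "real^3 \<Rightarrow> 'b::t1_space"
  assumes "continuous_on M f" "S \<subseteq> interior M" "interior M \<subseteq> closure S" "\<And>x. x \<in> S \<Longrightarrow> f x = a" "x \<in> M"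
  shows "f x = a"
proof -
  have "closure S = M"
    using closure_mono[OF assms(2)] closure_minimal[OF assms(3) closed_closure] closure_interior by simp
  then show ?thesis
    using continuous_constant_on_closure[of S f a x] assms by simp
qed

text \<open>Levels strictly between the extremes of p carry no logarithm, so \<open>C\<close>
  vanishes on them. They cover the interior off \<gamma>, which is dense in M, and continuity does
  the rest.\<close>

lemma reversed_if_symmetric:
  assumes sym: "\<And>x. x \<in> M \<Longrightarrow> p (half_turn x) = p x" and x: "x \<in> M"
  shows "rotB x = - B x"
proof -
  define G where "G = grad M p"
  define C where "C x = B x + rotB x" for x
  have symG: "G (half_turn x) = half_turn (G x)" if x: "x \<in> interior M" for x
  proof -
    have "(half_turn has_derivative half_turn) (at x)"
      by (rule bounded_linear_imp_has_derivative[OF bounded_linear_half_turn])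
    from has_derivative_compose[OF this grad_has_derivative[OF smooth_p half_turn_interior[OF x]]]
    have "((\<lambda>x. p (half_turn x)) has_derivative (\<lambda>v. G (half_turn x) \<bullet> half_turn v)) (at x)"
      unfolding G_def .
    then have "(p has_derivative (\<lambda>v. G (half_turn x) \<bullet> half_turn v)) (at x)"
      by (rule has_derivative_transform_within_open[OF _ open_interior x]) (use sym interior_subset in blast)
    moreover have "G (half_turn x) \<bullet> half_turn v = half_turn (G (half_turn x)) \<bullet> v" for v
      using inner_half_turn[of "half_turn (G (half_turn x))" v] by simp
    ultimately have "grad M p x = half_turn (G (half_turn x))"
      by (intro grad_eqI[OF smooth_p x]) simp
    then show ?thesis by (simp add: G_def)
  qed
  have CkC: "Ck_on k (interior M) C" for k
    unfolding C_def[abs_def] by (intro Ck_on_add open_interior CkB Ck_rotB)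
  have DC: "frechet_derivative C (at x) = (\<lambda>v. DB x v + half_turn (DB (half_turn x) (half_turn v)))"
    if "x \<in> interior M" for x
    unfolding C_def[abs_def]
    by (rule frechet_derivative_at[symmetric, OF has_derivative_add[OF B_has_derivative[OF that] rotB_has_derivative[OF that]]])
  \<comment> \<open>The normal component of a rotated field at x becomes that of the original field
    at the rotated point, where it is known to vanish.\<close>
  have inner_sym: "half_turn (Y (half_turn x)) \<bullet> G x = Y (half_turn x) \<bullet> G (half_turn x)"
    if "x \<in> interior M" for x Y
    using inner_half_turn[of "Y (half_turn x)" "half_turn (G x)"] symG[OF that] by simp
  have zero_level: "C x = 0" if c: "p_min < p x" "p x < p_max" and x: "x \<in> M" for x
  proof -
    let ?T = "level_set M p (p x)"
    note lev = level_interior[OF c]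
    obtain g\<^sub>0 f\<^sub>0 where "diffeomorphism ?T (sphere (0::real^2) 1 \<times> sphere (0::real^2) 1) g\<^sub>0 f\<^sub>0"
      using lev(4) unfolding diffeomorphic_def by blast
    note diffeo = diffeomorphism_sym[OF this]
    define X where "X = interior M \<inter> G -` (- {0})"
    have XM: "X \<subseteq> interior M" by (auto simp: X_def)
    interpret torus_field ?T f\<^sub>0 g\<^sub>0 X p G C "p x"
    proof unfold_locales
      show "diffeomorphism (sphere 0 1 \<times> sphere 0 1) ?T f\<^sub>0 g\<^sub>0" by (rule diffeo)
      show "open X"
        unfolding X_def G_def using Ck_on_continuous[OF Ck_grad[OF smooth_p]]
        by (intro continuous_open_preimage) auto
      show "?T \<subseteq> X"
        using lev(1,2) unfolding X_def G_def regular_level_def by blast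
      show "?T \<inter> z_axis = {}"
        using off_axis by (auto simp: level_set_def)
      show "(p has_derivative (\<lambda>v. G y \<bullet> v)) (at y)" if "y \<in> X" for y
        unfolding G_def using XM that by (intro grad_has_derivative[OF smooth_p]) auto
      show "Ck_on 2 X p" by (rule Ck_on_subset[OF smooth_on_interior_Ck[OF smooth_p] XM])
      show "Ck_on 1 X G" unfolding G_def by (rule Ck_on_subset[OF Ck_grad[OF smooth_p] XM])
      show "Ck_on 1 X C" by (rule Ck_on_subset[OF CkC XM])
      show "p y = p x" if "y \<in> ?T" for y using that by (simp add: level_set_def)
      show "G y \<noteq> 0" if "y \<in> X" for y using that by (simp add: X_def)
      fix y
      {
        assume "y \<in> X"
        then have y: "y \<in> interior M" using XM by blast
        note hy = half_turn_interior[OF y]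
        show "C y \<bullet> G y = 0"
          using B_tangent[OF y] B_tangent[OF hy] inner_sym[OF y, of B]
          by (simp add: C_def rotB_def inner_add_left G_def)
        show "curl_vec (frechet_derivative C (at y)) \<bullet> G y = 0"
          using J_tangent[OF y] J_tangent[OF hy] inner_sym[OF y, of "\<lambda>z. curl_vec (DB z)"]
          by (simp add: DC[OF y] curl_vec_add curl_vec_half_turn[OF linear_DB[OF hy]] inner_add_left G_def)
        show "div_sum (frechet_derivative C (at y)) = 0"
          by (simp add: DC[OF y] div_sum_add div_sum_half_turn[OF linear_DB[OF hy]] div_DB[OF y] div_DB[OF hy])
      }
      {
        assume y: "y \<in> ?T"
        then show "half_turn y \<in> ?T"
          using half_turn_in sym by (simp add: level_set_def)
        show "G (half_turn y) = half_turn (G y)"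
          using lev(1) y by (intro symG) blast
        show "C (half_turn y) = half_turn (C y)"
          by (simp add: C_def rotB_def linear_add[OF linear_half_turn])
      }
    qed
    have "x \<in> ?T" using x by (simp add: level_set_def)
    then show ?thesis
      using field_zero_or_log level_no_log[OF c] by blast
  qed
  have "C x = 0"
  proof (rule closure_eq_zero[of C "interior M - \<gamma>"])
    have "continuous_on M rotB"
      unfolding rotB_def[abs_def]
      by (intro bounded_linear.continuous_on[OF bounded_linear_half_turn]
          continuous_on_compose2[OF smooth_on_continuous[OF smooth_B]] continuous_on_id)
        (auto intro: half_turn_in)
    then show "continuous_on M C"
      unfolding C_def[abs_def] using smooth_on_continuous[OF smooth_B] by (intro continuous_on_add)
    show "interior M \<subseteq> closure (interior M - \<gamma>)"
      using open_Int_closure_subset[OF open_interior[of M], of "- \<gamma>"] interior_gamma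
      by (simp add: closure_complement Diff_eq)
    show "C x = 0" if "x \<in> interior M - \<gamma>" for x
      using that interior_off_gamma[of x] interior_subset by (intro zero_level) auto
  qed (use x in auto)
  then show ?thesis by (simp add: C_def eq_neg_iff_add_eq_0 add.commute)
qed

lemma symmetric_if_reversed:
  assumes rev: "\<And>x. x \<in> M \<Longrightarrow> rotB x = - B x" and x: "x \<in> M"
  shows "p (half_turn x) = p x"
proof -
  have B: "B (half_turn x) = - half_turn (B x)" if "x \<in> M" for x
    using rev[OF half_turn_in[OF that]] by (simp add: rotB_def)
  \<comment> \<open>The curl commutes with the half-turn and so is reversed together with B; the two
    signs cancel in the force.\<close>
  have curl: "curl_vec (DB (half_turn x)) = - half_turn (curl_vec (DB x))" if x: "x \<in> interior M" for x
  proof -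
    note hx = half_turn_interior[OF x]
    have "(rotB has_derivative (\<lambda>v. - DB x v)) (at x)"
      by (rule has_derivative_transform_within_open[OF has_derivative_minus[OF B_has_derivative[OF x]] open_interior x])
        (use rev interior_subset in force)
    then have "(\<lambda>v. half_turn (DB (half_turn x) (half_turn v))) = (\<lambda>v. - DB x v)"
      by (rule has_derivative_unique[OF rotB_has_derivative[OF x]])
    then have "half_turn (curl_vec (DB (half_turn x))) = curl_vec (\<lambda>v. - DB x v)"
      using curl_vec_half_turn[OF linear_DB[OF hx]] by simp
    also have "\<dots> = - curl_vec (DB x)" by (simp add: curl_vec_def vec_eq_iff forall_3)
    finally have "half_turn (half_turn (curl_vec (DB (half_turn x)))) = half_turn (- curl_vec (DB x))" by simp
    then show ?thesis by (simp add: linear_neg[OF linear_half_turn])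
  qed
  have grad: "grad M p (half_turn x) = half_turn (grad M p x)" if x: "x \<in> interior M" for x
  proof -
    have "x \<in> M" using x interior_subset by blast
    then show ?thesis
      using force_balance[OF half_turn_interior[OF x]] force_balance[OF x]
      by (simp add: B curl[OF x] cross3_half_turn)
  qed
  have "((\<lambda>x. p (half_turn x) - p x) has_derivative (\<lambda>v. 0)) (at x)" if x: "x \<in> interior M" for x
  proof -
    have "(half_turn has_derivative half_turn) (at x)"
      by (rule bounded_linear_imp_has_derivative[OF bounded_linear_half_turn])
    from has_derivative_compose[OF this grad_has_derivative[OF smooth_p half_turn_interior[OF x]]]
    have "((\<lambda>x. p (half_turn x)) has_derivative (\<lambda>v. grad M p x \<bullet> v)) (at x)"
      by (simp add: grad[OF x] inner_half_turn)
    from has_derivative_diff[OF this grad_has_derivative[OF smooth_p x]] show ?thesis by simp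
  qed
  then have const: "p (half_turn x) - p x = p (half_turn y) - p y" if "x \<in> interior M" "y \<in> interior M" for x y
    using has_derivative_zero_unique_connected[OF open_interior connected_interior, of "\<lambda>x. p (half_turn x) - p x" x y] that
    by blast
  have zero: "p (half_turn x) - p x = 0" if "x \<in> interior M" for x
    using const[OF that half_turn_interior[OF that]] by simp
  have "continuous_on M (\<lambda>x. p (half_turn x) - p x)"
    by (intro continuous_on_diff contp continuous_on_compose2[OF contp]
        bounded_linear.continuous_on[OF bounded_linear_half_turn] continuous_on_id) (auto intro: half_turn_in)
  then have "p (half_turn x) - p x = 0"
    by (rule closure_eq_zero[OF _ _ _ zero x]) (auto simp: closure_subset)
  then show ?thesis by simp
qed

end

theorem corollary1p9:
  fixes M :: "(real^3) set" and B :: "real^3 \<Rightarrow> real^3" and p :: "real^3 \<Rightarrow> real"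
  assumes "solid_torus M"
    and "M \<inter> z_axis = {}"
    and "hom_induced 1 (top_of_set M) {} (top_of_set (UNIV - z_axis)) {} id
           ` carrier (homology_group 1 (top_of_set M))
         = carrier (homology_group 1 (top_of_set (UNIV - z_axis)))"
    and "half_turn ` M = M"
    and "MHD_equilibrium M B p"
    and "toroidally_nested M p"
  shows "(\<forall>x\<in>M. (p \<circ> half_turn) x = p x) \<longleftrightarrow>
         (\<forall>x\<in>M. pushforward M half_turn B x = - B x)"
proof -
  obtain D D' where "diffeomorphism M (sphere (0::real^2) 1 \<times> cball (0::real^2) 1) D' D"
    using assms(1) unfolding solid_torus_def diffeomorphic_def by blast
  note D = diffeomorphism_sym[OF this]
  obtain \<gamma> where \<gamma>: "toroidally_nested_with_axis M p \<gamma>"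
    using assms(6) unfolding toroidally_nested_def by blast
  interpret half_turn_equilibrium M D D' p \<gamma> B
  proof unfold_locales
    show "regular_domain M" using assms(1) unfolding solid_torus_def by blast
    show "\<not> has_log M" by (rule no_log_if_H1_surjective[OF assms(3,2)])
  qed (fact D \<gamma> assms)+
  show ?thesis
    using reversed_if_symmetric symmetric_if_reversed pushforward_half_turn
    by (simp add: rotB_def) metis
qed

end
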